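(* Let $X:=\overline{\mathrm{span}}\,\{f_t:\ t\in T\}$ and $Y:=\overline{\mathrm{span}}\,\{h_t:\ t\in T\}$ (closures in $L_1[0,1]$), where the functions $f_t,h_t\in L_1[0,1]$, $t\in T=\bigcup_{n\ge 1}\{0,1\}^n$, are as defined in the context. Then: (1) $X$ is a non-reflexive subspace of $L_1[0,1]$ without the diametral local diameter 2 property (DLD2P), and $Y$ is a subspace of $X$ isometrically isomorphic to $L_1[0,1]$. (2) Every $y\in S_Y$ is a $\Delta$-point in $Y$ and in $X$, but no $y\in S_Y$ is a relative Daugavet-point in $X$. (3) Every $y\in S_Y$ is a super $\Delta$-point in $X$.
   Context: All Banach spaces are real. Construction. $T=\bigcup_{n\ge 1}\{0,1\}^n$; for $t\in\{0,1\}^n$ write $|t|=n$; $t^\frown(0)$, $t^\frown(1)$ denote $t$ extended by $0$ or $1$ at the end, with $\emptyset^\frown(0)=(0)$ and $\emptyset^\frown(1)=(1)$ for the empty sequence $\emptyset$. For $n\in\mathbb{N}=\{1,2,\dots\}$ put $B_n^\emptyset=[2^{-(n+1)},2^{-n})$ and $C_n^\emptyset=\tfrac12+B_n^\emptyset$. Inductively, for $A\in\{B_n,C_n\}$ and $t\in T\cup\{\emptyset\}$, if $A^t=[a,b)$ has been defined, put $A^{t^\frown(0)}=[a,\tfrac{a+b}{2})$ and $A^{t^\frown(1)}=[\tfrac{a+b}{2},b)$. This defines $B_n^t$ and $C_n^t$ for all $n\in\mathbb{N}$, $t\in T$. For $t\in T$ define $$f_t:=2^{|t|+1}\Big(\mathbf{1}_{C_{|t|}^t}+\sum_{i=1}^{|t|}\mathbf{1}_{B_i^t}\Big),\qquad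 h_t:=2^{|t|+1}\sum_{i=1}^\infty \mathbf{1}_{B_i^t}.$$ Notions. For a Banach space $Z$, $B_Z$ and $S_Z$ denote its closed unit ball and unit sphere. A slice of $B_Z$ is a set of the form $S(z^*,\alpha)=\{w\in B_Z:\ z^*(w)>\sup z^*(B_Z)-\alpha\}$ with $z^*\in Z^*$ and $\alpha>0$. For $z\in S_Z$ let $D(z)=\{z^*\in S_{Z^*}:\ z^*(z)=1\}$; a supporting slice at $z$ is a slice $S(z^*,\alpha)$ with $z^*\in D(z)$, $\alpha>0$. A point $z\in S_Z$ is: a $\Delta$-point of $Z$ if $\sup_{w\in S}\|z-w\|=2$ for every slice $S$ of $B_Z$ containing $z$; a super $\Delta$-point of $Z$ if $\sup_{w\in W}\|z-w\|=2$ for every relatively weakly open subset $W$ of $B_Z$ containing $z$; a Daugavet-point relative to a supporting slice $S$ at $z$ if $\sup_{w\in V}\|z-w\|=2$ for every slice $V$ of $B_Z$ with $V\subseteq S$; a relative Daugavet-point if it is a Daugavet-point relative to some supporting slice at $z$. $Z$ has the DLD2P if every point of $S_Z$ is a $\Delta$-point. *)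

theory Defs
  imports "HOL-Analysis.Analysis"
begin

section \<open>The Banach space $L_1[0,1]$\<close>

abbreviation leb01 :: "real measure" where
  "leb01 \<equiv> lebesgue_on {0..1}"

text \<open>Integrable functions modulo equality almost everywhere.\<close>

quotient_type L1 = "real \<Rightarrow> real" /
  partial: "\<lambda>f g. integrable leb01 f \<and> integrable leb01 g \<and> (AE x in leb01. f x = g x)"
proof (rule part_equivpI)
  show "\<exists>f. integrable leb01 f \<and> integrable leb01 f \<and> (AE x in leb01. f x = f x)"
    by (rule exI[of _ "\<lambda>_. 0"]) simp
  show "symp (\<lambda>f g. integrable leb01 f \<and> integrable leb01 g \<and> (AE x in leb01. f x = g x))"
    by (auto simp: symp_def elim: AE_mp)
  show "transp (\<lambda>f g. integrable leb01 f \<and> integrable leb01 g \<and> (AE x in leb01. f x = g x))"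
    by (auto simp: transp_def elim: AE_mp)
qed

instantiation L1 :: real_vector
begin

lift_definition zero_L1 :: L1 is "\<lambda>_. 0" by simp

lift_definition plus_L1 :: "L1 \<Rightarrow> L1 \<Rightarrow> L1" is "\<lambda>f g x. f x + g x"
  by (auto elim: AE_mp)

lift_definition minus_L1 :: "L1 \<Rightarrow> L1 \<Rightarrow> L1" is "\<lambda>f g x. f x - g x"
  by (auto elim: AE_mp)

lift_definition uminus_L1 :: "L1 \<Rightarrow> L1" is "\<lambda>f x. - f x"
  by (auto elim: AE_mp)

lift_definition scaleR_L1 :: "real \<Rightarrow> L1 \<Rightarrow> L1" is "\<lambda>c f x. c * f x"
  by (auto elim: AE_mp)

instance
  by standard (transfer; auto simp: algebra_simps)+

end

instantiation L1 :: real_normed_vector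
begin

lift_definition norm_L1 :: "L1 \<Rightarrow> real" is "\<lambda>f. LINT x|leb01. \<bar>f x\<bar>"
  by (rule integral_cong_AE) auto

definition sgn_L1 :: "L1 \<Rightarrow> L1" where
  "sgn_L1 x = inverse (norm x) *\<^sub>R x"

definition dist_L1 :: "L1 \<Rightarrow> L1 \<Rightarrow> real" where
  "dist_L1 x y = norm (x - y)"

definition uniformity_L1 :: "(L1 \<times> L1) filter" where
  "uniformity_L1 = (INF e\<in>{0<..}. principal {(x, y). dist x y < e})"

definition open_L1 :: "L1 set \<Rightarrow> bool" where
  "open_L1 U \<longleftrightarrow> (\<forall>x\<in>U. eventually (\<lambda>(x', y). x' = x \<longrightarrow> y \<in> U) uniformity)"

instance
proof
  fix x y :: L1 and a :: real
  show "norm x = 0 \<longleftrightarrow> x = 0"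
    by transfer (auto simp: integral_nonneg_eq_0_iff_AE)
  show "norm (x + y) \<le> norm x + norm y"
    by transfer (auto simp flip: Bochner_Integration.integral_add intro!: integral_mono)
  show "norm (a *\<^sub>R x) = \<bar>a\<bar> * norm x"
    by transfer (simp add: abs_mult)
qed (fact sgn_L1_def dist_L1_def uniformity_L1_def open_L1_def)+

end

lemma norm_series_L1:
  fixes d :: "nat \<Rightarrow> real \<Rightarrow> real"
  assumes int: "\<And>i. integrable leb01 (d i)"
    and sm: "summable (\<lambda>i. LINT x|leb01. \<bar>d i x\<bar>)"
  shows "integrable leb01 (\<lambda>x. \<Sum>i. d i x)"
    and "(\<lambda>n. LINT x|leb01. \<bar>(\<Sum>i<n. d i x) - (\<Sum>i. d i x)\<bar>) \<longlonglongrightarrow> 0"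
proof -
  have [measurable]: "d i \<in> borel_measurable leb01" for i
    using int by auto
  have "(\<integral>\<^sup>+x. (\<Sum>i. ennreal \<bar>d i x\<bar>) \<partial>leb01) = (\<Sum>i. \<integral>\<^sup>+x. ennreal \<bar>d i x\<bar> \<partial>leb01)"
    by (rule nn_integral_suminf) auto
  also have "\<dots> = (\<Sum>i. ennreal (LINT x|leb01. \<bar>d i x\<bar>))"
    using int by (intro suminf_cong nn_integral_eq_integral) auto
  also have "\<dots> = ennreal (\<Sum>i. LINT x|leb01. \<bar>d i x\<bar>)"
    by (rule suminf_ennreal2[OF _ sm]) auto
  finally have "(\<integral>\<^sup>+x. (\<Sum>i. ennreal \<bar>d i x\<bar>) \<partial>leb01) \<noteq> \<infinity>"
    by simp
  then have "AE x in leb01. (\<Sum>i. ennreal \<bar>d i x\<bar>) \<noteq> \<infinity>"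
    by (intro nn_integral_PInf_AE) auto
  then have AEs: "AE x in leb01. summable (\<lambda>i. norm (d i x))"
    by eventually_elim (auto intro!: summable_suminf_not_top)
  have sm': "summable (\<lambda>i. LINT x|leb01. norm (d i x))"
    using sm by simp
  show int_sum: "integrable leb01 (\<lambda>x. \<Sum>i. d i x)"
    by (rule integrable_suminf[OF int AEs sm'])
  have bound: "(LINT x|leb01. \<bar>(\<Sum>i<n. d i x) - (\<Sum>i. d i x)\<bar>)
      \<le> (\<Sum>i. LINT x|leb01. \<bar>d (i + n) x\<bar>)" for n
  proof -
    have AEn: "AE x in leb01. summable (\<lambda>i. norm \<bar>d (i + n) x\<bar>)"
      using AEs by eventually_elim (simp add: summable_iff_shift[where f = "\<lambda>i. \<bar>d i _\<bar>"])
    have smn: "summable (\<lambda>i. LINT x|leb01. norm \<bar>d (i + n) x\<bar>)"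
      using summable_ignore_initial_segment[OF sm, of n] by simp
    have intn: "integrable leb01 (\<lambda>x. \<bar>d (i + n) x\<bar>)" for i
      using int by auto
    have "(LINT x|leb01. \<bar>(\<Sum>i<n. d i x) - (\<Sum>i. d i x)\<bar>) \<le> (LINT x|leb01. (\<Sum>i. \<bar>d (i + n) x\<bar>))"
    proof (rule integral_mono_AE)
      show "integrable leb01 (\<lambda>x. \<bar>(\<Sum>i<n. d i x) - (\<Sum>i. d i x)\<bar>)"
        using int int_sum by auto
      show "integrable leb01 (\<lambda>x. \<Sum>i. \<bar>d (i + n) x\<bar>)"
        by (rule integrable_suminf[OF intn AEn smn])
      show "AE x in leb01. \<bar>(\<Sum>i<n. d i x) - (\<Sum>i. d i x)\<bar> \<le> (\<Sum>i. \<bar>d (i + n) x\<bar>)"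
        using AEs
      proof eventually_elim
        case (elim x)
        then have s: "summable (\<lambda>i. \<bar>d i x\<bar>)" by simp
        have "(\<Sum>i<n. d i x) - (\<Sum>i. d i x) = - (\<Sum>i. d (i + n) x)"
          using suminf_split_initial_segment[OF summable_rabs_cancel[OF s], of n] by simp
        then show ?case
          using summable_rabs[OF summable_ignore_initial_segment[OF s, of n]] by simp
      qed
    qed
    also have "\<dots> = (\<Sum>i. LINT x|leb01. \<bar>d (i + n) x\<bar>)"
      by (rule integral_suminf[OF intn AEn smn])
    finally show ?thesis .
  qed
  show "(\<lambda>n. LINT x|leb01. \<bar>(\<Sum>i<n. d i x) - (\<Sum>i. d i x)\<bar>) \<longlonglongrightarrow> 0"
    by (rule tendsto_sandwich[OF _ _ tendsto_const suminf_exist_split2[OF sm]])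
       (auto intro!: always_eventually bound)
qed

lemma rep_L1_integrable: "integrable leb01 (rep_L1 x)"
  using Quotient_rep_reflp[OF Quotient_L1, of x] by blast

lemma sum_L1_rep: "(\<Sum>i<(n::nat). a i) = abs_L1 (\<lambda>x. \<Sum>i<n. rep_L1 (a i) x)"
proof (induction n)
  case 0
  show ?case by (simp add: zero_L1_def)
next
  case (Suc n)
  have "abs_L1 (\<lambda>x. \<Sum>i<n. rep_L1 (a i) x) + abs_L1 (rep_L1 (a n))
      = abs_L1 (\<lambda>x. (\<Sum>i<n. rep_L1 (a i) x) + rep_L1 (a n) x)"
    by (rule plus_L1.abs_eq) (auto intro!: rep_L1_integrable)
  moreover have "abs_L1 (rep_L1 (a n)) = a n"
    by (rule Quotient_abs_rep[OF Quotient_L1])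
  ultimately show ?case
    using Suc by simp
qed

lemma series_L1_convergent:
  fixes a :: "nat \<Rightarrow> L1"
  assumes "summable (\<lambda>i. norm (a i))"
  shows "(\<lambda>n. \<Sum>i<n. a i) \<longlonglongrightarrow> abs_L1 (\<lambda>x. \<Sum>i. rep_L1 (a i) x)"
proof -
  have sm: "summable (\<lambda>i. LINT x|leb01. \<bar>rep_L1 (a i) x\<bar>)"
    using assms by (simp add: norm_L1.rep_eq)
  note * = norm_series_L1[OF rep_L1_integrable sm]
  have "norm ((\<Sum>i<n. a i) - abs_L1 (\<lambda>x. \<Sum>i. rep_L1 (a i) x))
      = (LINT x|leb01. \<bar>(\<Sum>i<n. rep_L1 (a i) x) - (\<Sum>i. rep_L1 (a i) x)\<bar>)" for n
  proof -
    have "abs_L1 (\<lambda>x. \<Sum>i<n. rep_L1 (a i) x) - abs_L1 (\<lambda>x. \<Sum>i. rep_L1 (a i) x)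
        = abs_L1 (\<lambda>x. (\<Sum>i<n. rep_L1 (a i) x) - (\<Sum>i. rep_L1 (a i) x))"
      by (rule minus_L1.abs_eq) (auto intro!: rep_L1_integrable *(1))
    moreover have "norm (abs_L1 (\<lambda>x. (\<Sum>i<n. rep_L1 (a i) x) - (\<Sum>i. rep_L1 (a i) x)))
        = (LINT x|leb01. \<bar>(\<Sum>i<n. rep_L1 (a i) x) - (\<Sum>i. rep_L1 (a i) x)\<bar>)"
      by (rule norm_L1.abs_eq) (auto intro!: rep_L1_integrable *(1))
    ultimately show ?thesis
      by (simp add: sum_L1_rep)
  qed
  with *(2) have "(\<lambda>n. norm ((\<Sum>i<n. a i) - abs_L1 (\<lambda>x. \<Sum>i. rep_L1 (a i) x))) \<longlonglongrightarrow> 0"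
    by (simp only:)
  then show ?thesis
    by (rule LIM_zero_cancel[OF tendsto_norm_zero_cancel])
qed

instance L1 :: banach
proof
  fix X :: "nat \<Rightarrow> L1"
  assume C: "Cauchy X"
  have "\<exists>N. \<forall>m\<ge>N. \<forall>k\<ge>N. dist (X m) (X k) < (1 / 2) ^ n" for n
    using C unfolding Cauchy_def by (metis half_gt_zero_iff zero_less_one zero_less_power)
  then obtain N where N: "\<And>n m k. m \<ge> N n \<Longrightarrow> k \<ge> N n \<Longrightarrow> dist (X m) (X k) < (1 / 2) ^ n"
    by metis
  define r where "r = rec_nat (N 0) (\<lambda>n k. max (Suc k) (N (Suc n)))"
  have r_Suc: "r (Suc n) = max (Suc (r n)) (N (Suc n))" for n
    by (simp add: r_def)
  have r_N: "r n \<ge> N n" for n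
    by (cases n) (auto simp: r_def)
  have r_mono: "strict_mono r"
    by (auto simp: strict_mono_Suc_iff r_Suc)
  have step: "norm (X (r (Suc n)) - X (r n)) \<le> (1 / 2) ^ n" for n
  proof -
    have "r (Suc n) \<ge> N n"
      using r_N[of n] by (simp add: r_Suc)
    from N[OF this r_N[of n]] show ?thesis
      by (simp add: dist_norm)
  qed
  have "summable (\<lambda>n. norm (X (r (Suc n)) - X (r n)))"
    by (rule summable_comparison_test'[OF summable_geometric[of "1 / 2 :: real"], of 0])
      (use step in auto)
  from series_L1_convergent[OF this] obtain l
    where "(\<lambda>n. \<Sum>i<n. X (r (Suc i)) - X (r i)) \<longlonglongrightarrow> l" by blast
  then have "(\<lambda>n. (X (r n) - X (r 0)) + X (r 0)) \<longlonglongrightarrow> l + X (r 0)"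
    unfolding sum_lessThan_telescope[of "\<lambda>i. X (r i)"] by (rule tendsto_add[OF _ tendsto_const])
  then have "(X \<circ> r) \<longlonglongrightarrow> l + X (r 0)"
    by (simp add: comp_def)
  then show "convergent X"
    using Cauchy_converges_subseq[OF C r_mono] by (auto simp: convergent_def)
qed


section \<open>Banach space notions for closed subspaces\<close>

text \<open>
  A Banach space is represented as a closed linear subspace \<open>Z\<close> of an ambient real normed space,
  so that a point can be viewed in several spaces at once.  All notions are intrinsic to \<open>Z\<close>.
\<close>

definition unit_ball :: "'a::real_normed_vector set \<Rightarrow> 'a set" where
  "unit_ball Z = Z \<inter> cball 0 1"

definition unit_sphere :: "'a::real_normed_vector set \<Rightarrow> 'a set" where
  "unit_sphere Z = Z \<inter> sphere 0 1"

text \<open>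
  The bounded linear functionals on \<open>Z\<close>.  They are normalised to be \<open>0\<close> outside \<open>Z\<close>, so that
  each functional is represented by exactly one function.
\<close>

definition dual_space :: "'a::real_normed_vector set \<Rightarrow> ('a \<Rightarrow> real) set" where
  "dual_space Z = {\<phi>.
     (\<forall>x\<in>Z. \<forall>y\<in>Z. \<phi> (x + y) = \<phi> x + \<phi> y) \<and>
     (\<forall>c. \<forall>x\<in>Z. \<phi> (c *\<^sub>R x) = c * \<phi> x) \<and>
     (\<exists>K. \<forall>x\<in>Z. \<bar>\<phi> x\<bar> \<le> K * norm x) \<and>
     (\<forall>x. x \<notin> Z \<longrightarrow> \<phi> x = 0)}"

definition dual_norm :: "'a::real_normed_vector set \<Rightarrow> ('a \<Rightarrow> real) \<Rightarrow> real" where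
  "dual_norm Z \<phi> = (SUP x\<in>unit_ball Z. \<bar>\<phi> x\<bar>)"

text \<open>Bounded linear functionals on \<open>dual_space Z\<close>; their values off \<open>dual_space Z\<close> are irrelevant.\<close>

definition bidual_functional :: "'a::real_normed_vector set \<Rightarrow> (('a \<Rightarrow> real) \<Rightarrow> real) \<Rightarrow> bool" where
  "bidual_functional Z \<Lambda> \<longleftrightarrow>
     (\<forall>\<phi>\<in>dual_space Z. \<forall>\<psi>\<in>dual_space Z. \<Lambda> (\<lambda>x. \<phi> x + \<psi> x) = \<Lambda> \<phi> + \<Lambda> \<psi>) \<and>
     (\<forall>c. \<forall>\<phi>\<in>dual_space Z. \<Lambda> (\<lambda>x. c * \<phi> x) = c * \<Lambda> \<phi>) \<and>
     (\<exists>K. \<forall>\<phi>\<in>dual_space Z. \<bar>\<Lambda> \<phi>\<bar> \<le> K * dual_norm Z \<phi>)"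

definition reflexive_space :: "'a::real_normed_vector set \<Rightarrow> bool" where
  "reflexive_space Z \<longleftrightarrow>
     (\<forall>\<Lambda>. bidual_functional Z \<Lambda> \<longrightarrow> (\<exists>z\<in>Z. \<forall>\<phi>\<in>dual_space Z. \<Lambda> \<phi> = \<phi> z))"

definition weak_topology :: "'a::real_normed_vector set \<Rightarrow> 'a topology" where
  "weak_topology Z = topology_generated_by {{x \<in> Z. \<phi> x \<in> U} |\<phi> U. \<phi> \<in> dual_space Z \<and> open U}"

definition isometrically_isomorphic ::
    "'a::real_normed_vector set \<Rightarrow> 'b::real_normed_vector set \<Rightarrow> bool" where
  "isometrically_isomorphic Z W \<longleftrightarrow> (\<exists>\<Phi>.
     (\<forall>x\<in>Z. \<forall>y\<in>Z. \<Phi> (x + y) = \<Phi> x + \<Phi> y) \<and>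
     (\<forall>c. \<forall>x\<in>Z. \<Phi> (c *\<^sub>R x) = c *\<^sub>R \<Phi> x) \<and>
     (\<forall>x\<in>Z. norm (\<Phi> x) = norm x) \<and>
     bij_betw \<Phi> Z W)"

definition slice :: "'a::real_normed_vector set \<Rightarrow> ('a \<Rightarrow> real) \<Rightarrow> real \<Rightarrow> 'a set" where
  "slice Z \<phi> \<alpha> = {w \<in> unit_ball Z. \<phi> w > (SUP x\<in>unit_ball Z. \<phi> x) - \<alpha>}"

definition is_slice :: "'a::real_normed_vector set \<Rightarrow> 'a set \<Rightarrow> bool" where
  "is_slice Z S \<longleftrightarrow> (\<exists>\<phi>\<in>dual_space Z. \<exists>\<alpha>>0. S = slice Z \<phi> \<alpha>)"

definition supporting_functionals :: "'a::real_normed_vector set \<Rightarrow> 'a \<Rightarrow> ('a \<Rightarrow> real) set" where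
  "supporting_functionals Z z = {\<phi> \<in> dual_space Z. dual_norm Z \<phi> = 1 \<and> \<phi> z = 1}"

definition is_supporting_slice :: "'a::real_normed_vector set \<Rightarrow> 'a \<Rightarrow> 'a set \<Rightarrow> bool" where
  "is_supporting_slice Z z S \<longleftrightarrow> (\<exists>\<phi>\<in>supporting_functionals Z z. \<exists>\<alpha>>0. S = slice Z \<phi> \<alpha>)"

definition Delta_point :: "'a::real_normed_vector set \<Rightarrow> 'a \<Rightarrow> bool" where
  "Delta_point Z z \<longleftrightarrow> z \<in> unit_sphere Z \<and>
     (\<forall>S. is_slice Z S \<and> z \<in> S \<longrightarrow> (SUP w\<in>S. norm (z - w)) = 2)"

definition super_Delta_point :: "'a::real_normed_vector set \<Rightarrow> 'a \<Rightarrow> bool" where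
  "super_Delta_point Z z \<longleftrightarrow> z \<in> unit_sphere Z \<and>
     (\<forall>W. openin (subtopology (weak_topology Z) (unit_ball Z)) W \<and> z \<in> W \<longrightarrow>
       (SUP w\<in>W. norm (z - w)) = 2)"

definition Daugavet_point_relative :: "'a::real_normed_vector set \<Rightarrow> 'a \<Rightarrow> 'a set \<Rightarrow> bool" where
  "Daugavet_point_relative Z z S \<longleftrightarrow> z \<in> unit_sphere Z \<and> is_supporting_slice Z z S \<and>
     (\<forall>V. is_slice Z V \<and> V \<subseteq> S \<longrightarrow> (SUP w\<in>V. norm (z - w)) = 2)"

definition relative_Daugavet_point :: "'a::real_normed_vector set \<Rightarrow> 'a \<Rightarrow> bool" where
  "relative_Daugavet_point Z z \<longleftrightarrow> (\<exists>S. Daugavet_point_relative Z z S)"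

definition DLD2P :: "'a::real_normed_vector set \<Rightarrow> bool" where
  "DLD2P Z \<longleftrightarrow> (\<forall>z\<in>unit_sphere Z. Delta_point Z z)"


section \<open>The construction\<close>

text \<open>
  A finite 0-1 sequence is a \<open>bool list\<close>, with \<open>False\<close> for 0 and \<open>True\<close> for 1.  An interval
  \<open>[a,b)\<close> is represented by \<open>(a, b)\<close>; since \<open>foldl\<close> consumes the list from its head, appending a
  digit at the end of \<open>t\<close> halves the interval obtained for \<open>t\<close>.
\<close>

definition T_tree :: "bool list set" where
  "T_tree = {t. t \<noteq> []}"

fun halve :: "real \<times> real \<Rightarrow> bool \<Rightarrow> real \<times> real" where
  "halve (a, b) False = (a, (a + b) / 2)"
| "halve (a, b) True = ((a + b) / 2, b)"

definition dyadic :: "real \<Rightarrow> real \<Rightarrow> bool list \<Rightarrow> real set" where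
  "dyadic a b t = (case foldl halve (a, b) t of (c, d) \<Rightarrow> {c..<d})"

definition B_ivl :: "nat \<Rightarrow> bool list \<Rightarrow> real set" where
  "B_ivl n t = dyadic (1 / 2 ^ (n + 1)) (1 / 2 ^ n) t"

definition C_ivl :: "nat \<Rightarrow> bool list \<Rightarrow> real set" where
  "C_ivl n t = dyadic (1 / 2 + 1 / 2 ^ (n + 1)) (1 / 2 + 1 / 2 ^ n) t"

definition f_fun :: "bool list \<Rightarrow> real \<Rightarrow> real" where
  "f_fun t x = 2 ^ (length t + 1) *
     (indicator (C_ivl (length t) t) x + (\<Sum>i = 1..length t. indicator (B_ivl i t) x))"

definition h_fun :: "bool list \<Rightarrow> real \<Rightarrow> real" where
  "h_fun t x = 2 ^ (length t + 1) * (\<Sum>i. indicator (B_ivl (Suc i) t) x)"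

lemma foldl_halve_bounds:
  assumes "a \<le> b" "foldl halve (a, b) t = (c, d)"
  shows "a \<le> c \<and> c \<le> d \<and> d \<le> b"
  using assms
proof (induction t arbitrary: a b)
  case (Cons x t)
  have m: "a \<le> (a + b) / 2" "(a + b) / 2 \<le> b"
    using Cons.prems(1) by simp_all
  show ?case
  proof (cases x)
    case True
    then have "foldl halve ((a + b) / 2, b) t = (c, d)"
      using Cons.prems(2) by simp
    from Cons.IH[OF m(2) this] m show ?thesis by linarith
  next
    case False
    then have "foldl halve (a, (a + b) / 2) t = (c, d)"
      using Cons.prems(2) by simp
    from Cons.IH[OF m(1) this] m show ?thesis by linarith
  qed
qed simp

lemma dyadic_subset: "a \<le> b \<Longrightarrow> dyadic a b t \<subseteq> {a..<b}"
proof
  fix x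
  assume "a \<le> b" and x: "x \<in> dyadic a b t"
  obtain c d where cd: "foldl halve (a, b) t = (c, d)"
    by (rule prod.exhaust)
  have "x \<in> {c..<d}"
    using x unfolding dyadic_def cd by simp
  with foldl_halve_bounds[OF \<open>a \<le> b\<close> cd] show "x \<in> {a..<b}"
    by simp
qed

lemma B_subset: "B_ivl n t \<subseteq> {1 / 2 ^ (n + 1)..<1 / 2 ^ n}"
  unfolding B_ivl_def by (rule dyadic_subset) (intro divide_left_mono power_increasing; simp)

lemma B_disjoint:
  assumes "x \<in> B_ivl i t" "x \<in> B_ivl j t"
  shows "i = j"
proof -
  have False if m: "x \<in> B_ivl m t" and n: "x \<in> B_ivl n t" and "m < n" for m n
  proof -
    have "1 / 2 ^ (m + 1) \<le> x"
      using subsetD[OF B_subset m] by (simp only: atLeastLessThan_iff)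
    moreover have "x < 1 / 2 ^ n"
      using subsetD[OF B_subset n] by (simp only: atLeastLessThan_iff)
    moreover have "(2::real) ^ (m + 1) \<le> 2 ^ n"
      using \<open>m < n\<close> by (intro power_increasing) auto
    then have "(1::real) / 2 ^ n \<le> 1 / 2 ^ (m + 1)"
      by (intro divide_left_mono) auto
    ultimately show False by linarith
  qed
  with assms show ?thesis
    using linorder_neqE_nat by metis
qed

lemma dyadic_measurable [measurable]: "dyadic a b t \<in> sets lebesgue"
  by (auto simp: dyadic_def split: prod.splits)

lemma indicator_leb01_measurable [measurable]:
  "(indicator (B_ivl n t) :: real \<Rightarrow> real) \<in> borel_measurable leb01"
  "(indicator (C_ivl n t) :: real \<Rightarrow> real) \<in> borel_measurable leb01"
  unfolding B_ivl_def C_ivl_def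
  by (intro measurable_restrict_space1 borel_measurable_indicator dyadic_measurable)+

lemma sum_indicator_B: "(\<Sum>i. indicator (B_ivl (Suc i) t) x) = (indicator (\<Union>i. B_ivl (Suc i) t) x :: real)"
proof (cases "\<exists>j. x \<in> B_ivl (Suc j) t")
  case True
  then obtain j where j: "x \<in> B_ivl (Suc j) t" by blast
  have "(indicator (B_ivl (Suc i) t) x :: real) = (if i = j then 1 else 0)" for i
  proof (cases "i = j")
    case True
    with j show ?thesis by (simp only: indicator_simps if_True refl)
  next
    case False
    with B_disjoint[OF j, of "Suc i"] have "x \<notin> B_ivl (Suc i) t" by blast
    with False show ?thesis by (simp add: indicator_simps)
  qed
  then have "(\<lambda>i. indicator (B_ivl (Suc i) t) x :: real) sums 1"
    using sums_single[of j "\<lambda>_. 1 :: real"] by (simp only:)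
  then have "(\<Sum>i. indicator (B_ivl (Suc i) t) x) = (1::real)"
    by (rule sums_unique[symmetric])
  moreover have "x \<in> (\<Union>i. B_ivl (Suc i) t)"
    using True by blast
  ultimately show ?thesis
    by (simp only: indicator_simps)
next
  case False
  then show ?thesis
    by (simp add: indicator_def)
qed

lemma leb01_integrable_bounded:
  fixes g :: "real \<Rightarrow> real"
  assumes "g \<in> borel_measurable leb01" "\<And>x. \<bar>g x\<bar> \<le> K"
  shows "integrable leb01 g"
proof -
  interpret finite_measure leb01
    by (rule finite_measure_lebesgue_on) auto
  show ?thesis
    using assms by (intro integrable_const_bound[of _ K]) auto
qed

lemma integrable_f_fun: "integrable leb01 (f_fun t)"
proof -
  have "integrable leb01 (indicator (B_ivl n t) :: real \<Rightarrow> real)" for n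
    by (rule leb01_integrable_bounded[of _ 1, OF indicator_leb01_measurable(1)]) (simp add: indicator_def)
  moreover have "integrable leb01 (indicator (C_ivl n t) :: real \<Rightarrow> real)" for n
    by (rule leb01_integrable_bounded[of _ 1, OF indicator_leb01_measurable(2)]) (simp add: indicator_def)
  ultimately show ?thesis
    unfolding f_fun_def[abs_def]
    by (intro integrable_mult_right Bochner_Integration.integrable_add Bochner_Integration.integrable_sum)
qed

lemma integrable_h_fun: "integrable leb01 (h_fun t)"
proof -
  have "integrable leb01 (\<lambda>x. \<Sum>i. indicator (B_ivl (Suc i) t) x :: real)"
  proof (rule leb01_integrable_bounded)
    show "(\<lambda>x. \<Sum>i. indicator (B_ivl (Suc i) t) x :: real) \<in> borel_measurable leb01"
      by (intro borel_measurable_suminf indicator_leb01_measurable)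
    show "\<bar>\<Sum>i. indicator (B_ivl (Suc i) t) x :: real\<bar> \<le> 1" for x
      unfolding sum_indicator_B by (simp add: indicator_def)
  qed
  then show ?thesis
    unfolding h_fun_def[abs_def] by (rule integrable_mult_right)
qed

lift_definition f_L1 :: "bool list \<Rightarrow> L1" is f_fun
  by (simp add: integrable_f_fun)

lift_definition h_L1 :: "bool list \<Rightarrow> L1" is h_fun
  by (simp add: integrable_h_fun)

definition X_space :: "L1 set" where
  "X_space = closure (span (f_L1 ` T_tree))"

definition Y_space :: "L1 set" where
  "Y_space = closure (span (h_L1 ` T_tree))"

end

theory Submission
  imports Defs
begin

text \<open>
  The two halves of \<open>[0,1]\<close> play different roles.  The sets \<open>B_ivl i t\<close> are scaled copies, one in each
  block \<open>[2^-(i+1), 2^-i)\<close>, of the dyadic subinterval \<open>D_ivl t\<close> of \<open>[0,1)\<close>, so \<open>h_L1 t\<close> is the image of the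
  normalised indicator \<open>atom t\<close> of \<open>D_ivl t\<close> under the operator \<open>spread\<close> that copies a function into all
  blocks, scaled so that the copy in block \<open>i\<close> has norm \<open>2^-i\<close>.  The weights sum to 1 and the
  blocks are disjoint, so \<open>spread\<close> is an isometry; as dyadic averages converge in \<open>L_1\<close>, its range is
  \<open>Y\<close>.  Since \<open>f_L1 t\<close> differs from \<open>h_L1 t\<close> by at most \<open>2 / 2^n\<close> with \<open>n\<close> the length of \<open>t\<close>, and \<open>h_L1 t\<close> is
  the average of the \<open>h_L1 s\<close> over the \<open>s\<close> of any larger length that extend \<open>t\<close>, \<open>Y\<close> lies in \<open>X\<close>.

  Points of \<open>S_Y\<close> are super \<open>\<Delta>\<close>-points because \<open>L_1[0,1]\<close> has no atoms.  Cut a function \<open>u\<close> of norm 1 into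
  its restrictions to many short intervals and normalise the pieces.  Finitely many functionals
  sort the pieces into a number of cells that does not depend on the number of pieces.  Moving all the mass of a
  cell onto one piece of that cell changes the functionals only slightly, but the new function
  lives on a few short intervals, where \<open>u\<close> has almost no mass, so its distance to \<open>u\<close> is almost 2
  (\<open>weak_approximation_at_distance_2\<close>).  This takes place inside \<open>Y\<close>, hence works in every
  space that contains \<open>Y\<close>.

  The sets \<open>C_ivl n t\<close> in the right half are pairwise disjoint and record the coefficients: on the
  span of the \<open>f_L1 t\<close>, the coefficient of \<open>f_L1 s\<close> is an integral over \<open>C_ivl n s\<close>.  Passing from block \<open>i\<close> to block
  \<open>i + 1\<close> removes exactly the generators of length \<open>i\<close>, so for every \<open>x\<close> in \<open>X\<close> the difference of the two
  blocks is determined by these coefficients (\<open>X_block_relation\<close>).  If \<open>x\<close> has little mass off the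
  support of \<open>f_L1 t\<close>, then all coefficients of length at most \<open>n\<close> other than that of \<open>t\<close>, and the whole block \<open>n + 1\<close>, are small;
  going down the blocks shows that \<open>x\<close> is close to a multiple of \<open>f_L1 t\<close>
  (\<open>X_norm_diff_f_L1_le\<close>).  So integration over that support strongly exposes \<open>f_L1 t\<close> in the unit ball
  of \<open>X\<close>.  In particular \<open>f_L1 t\<close> is not a \<open>\<Delta>\<close>-point, and \<open>X\<close> fails the DLD2P.

  Given a supporting slice at a point \<open>y\<close> of \<open>S_Y\<close>, some \<open>\<plusminus> h_L1 t\<close> with \<open>t\<close> long and with the sign of the
  mass of \<open>y\<close> over \<open>t\<close> lies deep inside the slice, and so does \<open>\<plusminus> f_L1 t\<close>.  A small slice around the latter is contained in the
  given one, while \<open>y\<close> and \<open>\<plusminus> f_L1 t\<close> overlap with the same sign and so have distance less than 2.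
  Finally, \<open>X\<close> is not reflexive because the unit vectors \<open>h_L1 t\<close> with \<open>t = 0, 00, 000, \<dots>\<close> concentrate
  on a null set; a weak cluster point of them in \<open>X\<close> would have mass in arbitrarily short intervals.
\<close>

section \<open>Restriction, integration and affine substitution on $L_1[0,1]$\<close>

lemma integrable_leb01_iff:
  "integrable leb01 f \<longleftrightarrow> integrable lebesgue (\<lambda>x. indicator {0..1} x * f x)"
  for f :: "real \<Rightarrow> real"
  by (subst integrable_restrict_space) auto

lemma integral_leb01:
  "(LINT x|leb01. f x) = (LINT x|lebesgue. indicator {0..1} x * f x)"
  for f :: "real \<Rightarrow> real"
  by (subst integral_restrict_space) auto

lemma AE_leb01_iff: "(AE x in leb01. P x) \<longleftrightarrow> (AE x in lebesgue. x \<in> {0..1} \<longrightarrow> P x)"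
  by (subst AE_restrict_space_iff) auto

lemma integrable_indicator_mult:
  fixes f :: "real \<Rightarrow> real"
  assumes "A \<in> sets lebesgue" "integrable leb01 f"
  shows "integrable leb01 (\<lambda>x. indicator A x * f x)"
proof -
  have "integrable lebesgue (\<lambda>x. indicator A x *\<^sub>R (indicator {0..1} x * f x))"
    using assms by (intro integrable_mult_indicator) (auto simp: integrable_leb01_iff)
  then show ?thesis
    by (simp add: integrable_leb01_iff mult_ac)
qed

lemma integrable_indicator_leb01:
  assumes "A \<in> sets lebesgue"
  shows "integrable leb01 (indicator A :: real \<Rightarrow> real)"
  using integrable_indicator_mult[OF assms, of "\<lambda>_. 1"] integrable_const
  by (simp add: integrable_leb01_iff)

lemma integrable_affine_leb01:
  fixes f :: "real \<Rightarrow> real"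
  assumes "c \<noteq> 0" "integrable leb01 f"
  shows "integrable leb01 (\<lambda>x. indicator {0..1} (a + c * x) * f (a + c * x))"
proof -
  have "integrable lebesgue (\<lambda>x. indicator {0..1} (a + c * x) * f (a + c * x))"
    using lebesgue_integrable_real_affine[OF iffD1[OF integrable_leb01_iff assms(2)] assms(1)] .
  then have "integrable lebesgue (\<lambda>x. indicator {0..1} x *\<^sub>R (indicator {0..1} (a + c * x) * f (a + c * x)))"
    by (intro integrable_mult_indicator) auto
  then show ?thesis
    by (simp add: integrable_leb01_iff)
qed

text \<open>
  An affine bijection maps null sets to null sets, since it changes Lebesgue measure only by a
  constant factor.
\<close>

lemma AE_affine:
  fixes c :: real
  assumes "c \<noteq> 0" "AE x in lebesgue. P x"
  shows "AE x in lebesgue. P (a + c * x)"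
proof -
  have m: "(\<lambda>x. a + c * x) \<in> lebesgue \<rightarrow>\<^sub>M lebesgue"
    using lebesgue_affine_measurable[where c= "\<lambda>x::real. c"] assms by simp
  have "AE x in density (distr lebesgue lebesgue (\<lambda>x. a + c * x)) (\<lambda>_. ennreal \<bar>c\<bar>). P x"
    using assms(2) by (subst (asm) lebesgue_real_affine[OF assms(1), of a])
  then have "AE x in distr lebesgue lebesgue (\<lambda>x. a + c * x). P x"
    using assms(1) by (subst (asm) AE_density) auto
  then show ?thesis
    by (rule AE_distrD[OF m])
qed

text \<open>
  Multiplication by the indicator of a set.  On a non-measurable set the product need not be
  integrable, so the value there is 0; this choice keeps the operator linear for every set.
\<close>

lift_definition restr :: "real set \<Rightarrow> L1 \<Rightarrow> L1" is
  "\<lambda>A f x. if A \<in> sets lebesgue then indicator A x * f x else 0"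
  subgoal for A f g
    by (cases "A \<in> sets lebesgue") (auto intro!: integrable_indicator_mult elim: AE_mp)
  done

lift_definition ind :: "real set \<Rightarrow> L1" is
  "\<lambda>A x. if A \<in> sets lebesgue then indicator A x else 0"
  subgoal for A
    by (cases "A \<in> sets lebesgue") (auto intro!: integrable_indicator_leb01)
  done

lift_definition integ :: "L1 \<Rightarrow> real" is "\<lambda>f. LINT x|leb01. f x"
  by (rule integral_cong_AE) auto

text \<open>
  The substitution \<open>f (a + c * x)\<close>, with \<open>f\<close> extended by zero outside \<open>[0,1]\<close>.  For \<open>c = 0\<close> it would not
  respect equality almost everywhere, whence the default value 0.
\<close>

lift_definition affine_comp :: "real \<Rightarrow> real \<Rightarrow> L1 \<Rightarrow> L1" is
  "\<lambda>a c f x. if c = 0 then 0 else indicator {0..1} (a + c * x) * f (a + c * x)"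
  subgoal for a c f g
  proof (cases "c = 0")
    case False
    assume *: "integrable leb01 f \<and> integrable leb01 g \<and> (AE x in leb01. f x = g x)"
    then have "AE x in lebesgue. x \<in> {0..1} \<longrightarrow> f x = g x"
      by (simp add: AE_leb01_iff)
    then have "AE x in lebesgue. a + c * x \<in> {0..1} \<longrightarrow> f (a + c * x) = g (a + c * x)"
      by (rule AE_affine[OF False])
    then have "AE x in lebesgue. x \<in> {0..1} \<longrightarrow> indicator {0..1} (a + c * x) * f (a + c * x)
        = indicator {0..1} (a + c * x) * g (a + c * x)"
      by eventually_elim (auto simp: indicator_def)
    then have "AE x in leb01. indicator {0..1} (a + c * x) * f (a + c * x)
        = indicator {0..1} (a + c * x) * g (a + c * x)"
      by (simp only: AE_leb01_iff)
    moreover have "integrable leb01 (\<lambda>x. indicator {0..1} (a + c * x) * f (a + c * x))"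
      "integrable leb01 (\<lambda>x. indicator {0..1} (a + c * x) * g (a + c * x))"
      using * False by (intro integrable_affine_leb01; blast)+
    ultimately show ?thesis
      using False by simp
  qed auto
  done

lemma ind_empty [simp]: "ind {} = 0"
  by transfer simp

lemma L1_cases:
  obtains f where "integrable leb01 f" "u = abs_L1 f"
  using rep_L1_integrable Quotient_abs_rep[OF Quotient_L1] by metis

lemma abs_L1_cong:
  assumes "integrable leb01 f" "integrable leb01 g" "AE x in lebesgue. x \<in> {0..1} \<longrightarrow> f x = g x"
  shows "abs_L1 f = abs_L1 g"
  using assms by (intro Quotient_rel_abs[OF Quotient_L1]) (simp add: AE_leb01_iff)

lemma abs_L1_plus:
  "integrable leb01 f \<Longrightarrow> integrable leb01 g \<Longrightarrow> abs_L1 f + abs_L1 g = abs_L1 (\<lambda>x. f x + g x)"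
  by (rule plus_L1.abs_eq) auto

lemma abs_L1_minus:
  "integrable leb01 f \<Longrightarrow> integrable leb01 g \<Longrightarrow> abs_L1 f - abs_L1 g = abs_L1 (\<lambda>x. f x - g x)"
  by (rule minus_L1.abs_eq) auto

lemma abs_L1_scaleR: "integrable leb01 f \<Longrightarrow> c *\<^sub>R abs_L1 f = abs_L1 (\<lambda>x. c * f x)"
  by (rule scaleR_L1.abs_eq) auto

lemma norm_abs_L1: "integrable leb01 f \<Longrightarrow> norm (abs_L1 f) = (LINT x|leb01. \<bar>f x\<bar>)"
  by (rule norm_L1.abs_eq) auto

lemma integ_abs_L1: "integrable leb01 f \<Longrightarrow> integ (abs_L1 f) = (LINT x|leb01. f x)"
  by (rule integ.abs_eq) auto

lemma restr_abs_L1: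
  "A \<in> sets lebesgue \<Longrightarrow> integrable leb01 f \<Longrightarrow> restr A (abs_L1 f) = abs_L1 (\<lambda>x. indicator A x * f x)"
  by (subst restr.abs_eq) auto

lemma restr_not_measurable: "A \<notin> sets lebesgue \<Longrightarrow> restr A u = 0"
  by transfer auto

lemma ind_eq_abs_L1: "A \<in> sets lebesgue \<Longrightarrow> ind A = abs_L1 (indicator A)"
  by (simp add: ind_def)

lemma affine_comp_abs_L1:
  "c \<noteq> 0 \<Longrightarrow> integrable leb01 f \<Longrightarrow>
    affine_comp a c (abs_L1 f) = abs_L1 (\<lambda>x. indicator {0..1} (a + c * x) * f (a + c * x))"
  by (subst affine_comp.abs_eq) auto

lemma restr_add: "restr A (u + v) = restr A u + restr A v"
proof (cases "A \<in> sets lebesgue")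
  case True
  obtain f g where "integrable leb01 f" "u = abs_L1 f" "integrable leb01 g" "v = abs_L1 g"
    by (metis L1_cases)
  with True show ?thesis
    by (simp add: abs_L1_plus restr_abs_L1 integrable_indicator_mult[of A] distrib_left)
qed (simp add: restr_not_measurable)

lemma restr_scaleR: "restr A (c *\<^sub>R u) = c *\<^sub>R restr A u"
proof (cases "A \<in> sets lebesgue")
  case True
  obtain f where "integrable leb01 f" "u = abs_L1 f"
    by (metis L1_cases)
  with True show ?thesis
    by (simp add: abs_L1_scaleR restr_abs_L1 integrable_indicator_mult[of A] mult.left_commute)
qed (simp add: restr_not_measurable)

lemma norm_restr_Un:
  assumes "A \<in> sets lebesgue" "B \<in> sets lebesgue" "A \<inter> B = {}"
  shows "norm (restr (A \<union> B) u) = norm (restr A u) + norm (restr B u)"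
proof -
  obtain f where f: "integrable leb01 f" "u = abs_L1 f"
    by (metis L1_cases)
  note i = integrable_indicator_mult[OF _ f(1)]
  have "(LINT x|leb01. \<bar>indicator (A \<union> B) x * f x\<bar>)
    = (LINT x|leb01. \<bar>indicator A x * f x\<bar> + \<bar>indicator B x * f x\<bar>)"
    using assms(3) by (intro Bochner_Integration.integral_cong) (auto simp: indicator_def)
  also have "\<dots> = (LINT x|leb01. \<bar>indicator A x * f x\<bar>) + (LINT x|leb01. \<bar>indicator B x * f x\<bar>)"
    using assms by (intro Bochner_Integration.integral_add integrable_abs i)
  finally show ?thesis
    using assms by (simp add: f restr_abs_L1 norm_abs_L1 i)
qed

lemma restr_restr:
  assumes "A \<in> sets lebesgue" "B \<in> sets lebesgue"
  shows "restr A (restr B u) = restr (A \<inter> B) u"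
proof -
  obtain f where f: "integrable leb01 f" "u = abs_L1 f"
    by (metis L1_cases)
  note i = integrable_indicator_mult[OF _ f(1)]
  show ?thesis
    using assms by (simp add: f restr_abs_L1 i indicator_inter_arith mult.assoc)
qed

lemma restr_cong:
  assumes "A \<in> sets lebesgue" "B \<in> sets lebesgue"
    "AE x in lebesgue. x \<in> {0..1} \<longrightarrow> (x \<in> A \<longleftrightarrow> x \<in> B)"
  shows "restr A u = restr B u"
proof -
  obtain f where f: "integrable leb01 f" "u = abs_L1 f"
    by (metis L1_cases)
  note i = integrable_indicator_mult[OF _ f(1)]
  have "AE x in lebesgue. x \<in> {0..1} \<longrightarrow> indicator A x * f x = indicator B x * f x"
    using assms(3) by eventually_elim (auto simp: indicator_def)
  with assms have "abs_L1 (\<lambda>x. indicator A x * f x) = abs_L1 (\<lambda>x. indicator B x * f x)"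
    by (intro abs_L1_cong i)
  with assms show ?thesis
    by (simp add: f restr_abs_L1)
qed

lemma restr_UNIV: "restr UNIV u = u"
  by transfer simp

lemma restr_empty: "restr {} u = 0"
  by transfer simp

lemma restr_disjoint:
  "A \<in> sets lebesgue \<Longrightarrow> B \<in> sets lebesgue \<Longrightarrow> A \<inter> B = {} \<Longrightarrow> restr A (restr B u) = 0"
  by (simp add: restr_restr restr_empty)

lemma restr_Un:
  assumes "A \<in> sets lebesgue" "B \<in> sets lebesgue" "A \<inter> B = {}"
  shows "restr (A \<union> B) u = restr A u + restr B u"
proof -
  obtain f where f: "integrable leb01 f" "u = abs_L1 f"
    by (metis L1_cases)
  note i = integrable_indicator_mult[OF _ f(1)]
  have "indicator (A \<union> B) x * f x = indicator A x * f x + indicator B x * f x" for x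
    using assms(3) by (auto simp: indicator_def)
  then show ?thesis
    using assms by (simp add: f restr_abs_L1 i abs_L1_plus)
qed

lemma norm_restr_Compl:
  assumes "A \<in> sets lebesgue"
  shows "norm u = norm (restr A u) + norm (restr (- A) u)"
proof -
  have "- A \<in> sets lebesgue"
    using sets.compl_sets[OF assms] by (simp add: Compl_eq_Diff_UNIV)
  from norm_restr_Un[OF assms this Compl_disjoint, of u] show ?thesis
    by (simp only: Compl_partition restr_UNIV)
qed

lemma norm_restr_le: "norm (restr A u) \<le> norm u"
proof (cases "A \<in> sets lebesgue")
  case True
  show ?thesis
    using norm_restr_Compl[OF True, of u] norm_ge_zero[of "restr (- A) u"] by linarith
qed (simp add: restr_not_measurable)

lemma bounded_linear_restr: "bounded_linear (restr A)"
  by (rule bounded_linear_intro[of _ 1]) (auto simp: restr_add restr_scaleR norm_restr_le)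

lemmas restr_diff = bounded_linear.linear[OF bounded_linear_restr, THEN linear_diff]
lemmas restr_sum = bounded_linear.linear[OF bounded_linear_restr, THEN linear_sum]

lemma integ_add: "integ (u + v) = integ u + integ v"
  by transfer auto

lemma integ_scaleR: "integ (c *\<^sub>R u) = c * integ u"
  by transfer auto

lemma abs_integ_le: "\<bar>integ u\<bar> \<le> norm u"
  by transfer auto

lemma bounded_linear_integ: "bounded_linear integ"
  by (rule bounded_linear_intro[of _ 1]) (auto simp: integ_add integ_scaleR abs_integ_le)

lemma restr_ind:
  assumes "A \<in> sets lebesgue" "B \<in> sets lebesgue"
  shows "restr A (ind B) = ind (A \<inter> B)"
proof -
  have "(indicator (A \<inter> B) :: real \<Rightarrow> real) = (\<lambda>x. indicator A x * indicator B x)"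
    by (auto simp: indicator_def)
  with assms show ?thesis
    by (simp add: ind_eq_abs_L1 restr_abs_L1 integrable_indicator_leb01)
qed

lemma integ_ind:
  assumes "A \<in> sets lebesgue"
  shows "integ (ind A) = measure lebesgue (A \<inter> {0..1})"
proof -
  have "(LINT x|leb01. indicator A x) = (LINT x|lebesgue. indicator (A \<inter> {0..1}) x :: real)"
    by (subst integral_leb01, rule Bochner_Integration.integral_cong) (auto simp: indicator_def)
  with assms show ?thesis
    by (simp add: ind_eq_abs_L1 integ_abs_L1 integrable_indicator_leb01)
qed

lemma norm_ind: "A \<in> sets lebesgue \<Longrightarrow> norm (ind A) = measure lebesgue (A \<inter> {0..1})"
  using integ_ind[of A] by (simp add: ind_eq_abs_L1 integ_abs_L1 norm_abs_L1 integrable_indicator_leb01)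

lemma affine_comp_add: "c > 0 \<Longrightarrow> affine_comp a c (u + v) = affine_comp a c u + affine_comp a c v"
proof -
  assume c: "c > 0"
  obtain f g where "integrable leb01 f" "u = abs_L1 f" "integrable leb01 g" "v = abs_L1 g"
    by (metis L1_cases)
  with c show ?thesis
    using integrable_affine_leb01[of c f a] integrable_affine_leb01[of c g a]
    by (simp add: abs_L1_plus affine_comp_abs_L1 distrib_left)
qed

lemma affine_comp_scaleR: "c > 0 \<Longrightarrow> affine_comp a c (r *\<^sub>R u) = r *\<^sub>R affine_comp a c u"
proof -
  assume c: "c > 0"
  obtain f where "integrable leb01 f" "u = abs_L1 f"
    by (metis L1_cases)
  with c show ?thesis
    using integrable_affine_leb01[of c f a]
    by (simp add: abs_L1_scaleR affine_comp_abs_L1 mult.left_commute)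
qed

lemma integral_affine_leb01:
  fixes f :: "real \<Rightarrow> real"
  assumes "c > 0"
  shows "(LINT x|leb01. indicator {0..1} (a + c * x) * f (a + c * x))
    = (LINT x|leb01. indicator {a..a + c} x * f x) / c"
proof -
  have *: "indicator {a..a+c} (a + c * x) = (indicator {0..1} x :: real)" for x
    using assms by (auto simp: indicator_def zero_le_mult_iff)
  have "(LINT x|lebesgue. indicator {0..1} x * (indicator {a..a + c} x * f x))
    = c * (LINT x|lebesgue. indicator {0..1} (a + c * x) * (indicator {a..a + c} (a + c * x) * f (a + c * x)))"
    using lebesgue_integral_real_affine[of c "\<lambda>x. indicator {0..1} x * (indicator {a..a + c} x * f x)" a] assms
    by simp
  then show ?thesis
    unfolding integral_leb01 * using assms by (simp add: mult.left_commute)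
qed

text \<open>
  Change of variables: as \<open>x\<close> runs through \<open>[0,1]\<close>, the point \<open>a + c * x\<close> sees only \<open>[a, a + c]\<close>.
\<close>

lemma norm_affine_comp:
  assumes "c > 0"
  shows "norm (affine_comp a c u) = norm (restr {a..a + c} u) / c"
proof -
  obtain f where f: "integrable leb01 f" "u = abs_L1 f"
    by (metis L1_cases)
  show ?thesis
    using assms integrable_affine_leb01[OF _ f(1), of c a] integral_affine_leb01[of c a "\<lambda>x. \<bar>f x\<bar>"]
      integrable_indicator_mult[OF _ f(1), of "{a..a + c}"]
    by (simp add: f affine_comp_abs_L1 restr_abs_L1 norm_abs_L1 abs_mult)
qed

lemma integ_affine_comp:
  assumes "c > 0"
  shows "integ (affine_comp a c u) = integ (restr {a..a + c} u) / c"
proof -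
  obtain f where f: "integrable leb01 f" "u = abs_L1 f"
    by (metis L1_cases)
  show ?thesis
    using assms integrable_affine_leb01[OF _ f(1), of c a] integral_affine_leb01[of c a f]
      integrable_indicator_mult[OF _ f(1), of "{a..a + c}"]
    by (simp add: f affine_comp_abs_L1 restr_abs_L1 integ_abs_L1)
qed

lemma bounded_linear_affine_comp: "c > 0 \<Longrightarrow> bounded_linear (affine_comp a c)"
  by (rule bounded_linear_intro[of _ "1/c"])
    (auto simp: affine_comp_add affine_comp_scaleR norm_affine_comp norm_restr_le divide_right_mono)

text \<open>
  Substitutions compose up to the cut-off of the outer one, which keeps only those \<open>x\<close> with
  \<open>a + c * x\<close> in \<open>[0,1]\<close>.
\<close>

lemma affine_comp_affine_comp:
  assumes "c > 0" "d > 0"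
  shows "affine_comp a c (affine_comp b d u)
    = restr {- a / c..(1 - a) / c} (affine_comp (b + d * a) (d * c) u)"
proof -
  obtain f where f: "integrable leb01 f" "u = abs_L1 f"
    by (metis L1_cases)
  have *: "indicator {0..1} (a + c * x) = (indicator {- a / c..(1 - a) / c} x :: real)" for x
    using assms by (auto simp: indicator_def field_simps)
  have **: "b + d * (a + c * x) = b + d * a + d * c * x" for x
    by (simp add: algebra_simps)
  show ?thesis
    using assms integrable_affine_leb01[OF _ f(1), of d b] integrable_affine_leb01[OF _ f(1), of "d * c" "b + d * a"]
    by (simp add: f affine_comp_abs_L1 restr_abs_L1 * ** )
qed

lemma affine_comp_id: "affine_comp 0 1 u = u"
proof -
  obtain f where f: "integrable leb01 f" "u = abs_L1 f"
    by (metis L1_cases)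
  show ?thesis
    using integrable_affine_leb01[OF _ f(1), of 1 0]
    by (simp add: f affine_comp_abs_L1) (intro abs_L1_cong; simp add: f)
qed

section \<open>Dyadic intervals and a density criterion\<close>

text \<open>
  The intervals \<open>D_ivl t\<close> with \<open>t\<close> in \<open>level n\<close> partition \<open>[0,1)\<close>.
\<close>

definition level :: "nat \<Rightarrow> bool list set" where
  "level n = {t. length t = n}"

abbreviation D_ivl :: "bool list \<Rightarrow> real set" where
  "D_ivl t \<equiv> dyadic 0 1 t"

lemma finite_level [simp]: "finite (level n)"
  using finite_lists_length_eq[of "UNIV :: bool set" n] by (simp add: level_def)

lemma foldl_halve_affine:
  "foldl halve (a + c * p, a + c * q) t
    = (a + c * fst (foldl halve (p, q) t), a + c * snd (foldl halve (p, q) t))"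
proof (induction t arbitrary: p q)
  case (Cons b t)
  have *: "(a + c * p + (a + c * q)) / 2 = a + c * ((p + q) / 2)"
    by (simp add: field_simps)
  show ?case
    by (cases b) (simp_all only: foldl_Cons halve.simps * Cons.IH)
qed simp

text \<open>
  Bisecting commutes with affine maps, so every family of dyadic intervals is an affine image of
  the one on \<open>[0,1)\<close>.
\<close>

lemma mem_dyadic_iff:
  assumes "c > 0" "b = a + c"
  shows "x \<in> dyadic a b t \<longleftrightarrow> (x - a) / c \<in> D_ivl t"
proof -
  have "foldl halve (a, b) t = (a + c * fst (foldl halve (0, 1) t), a + c * snd (foldl halve (0, 1) t))"
    using foldl_halve_affine[of a c 0 1 t] assms by simp
  then show ?thesis
    using assms(1) by (auto simp: dyadic_def field_simps split: prod.splits)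
qed

lemma D_ivl_eq: "\<exists>p\<ge>0. p + 1 / 2 ^ length t \<le> 1 \<and> D_ivl t = {p..<p + 1 / 2 ^ length t}"
proof -
  have "\<exists>p. foldl halve (0, 1) t = (p, p + 1 / 2 ^ length t)"
  proof (induction t rule: rev_induct)
    case (snoc b t)
    define h :: real where "h = 1 / 2 ^ length (t @ [b])"
    have "1 / 2 ^ length t = 2 * h"
      by (simp add: h_def)
    with snoc obtain p where p: "foldl halve (0, 1) t = (p, p + 2 * h)" by metis
    have "(p + (p + 2 * h)) / 2 = p + h"
      by simp
    then have "foldl halve (0, 1) (t @ [b]) = (if b then p + h else p, (if b then p + h else p) + h)"
      using p by (cases b) simp_all
    then show ?case
      unfolding h_def by blast
  qed simp
  then obtain p where p: "foldl halve (0, 1) t = (p, p + 1 / 2 ^ length t)" by blast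
  from foldl_halve_bounds[OF _ this] show ?thesis
    by (intro exI[of _ p]) (auto simp: dyadic_def p)
qed

lemma D_ivl_subset: "D_ivl t \<subseteq> {0..<1}"
  by (rule dyadic_subset) simp

lemma D_ivl_Nil [simp]: "D_ivl [] = {0..<1}"
  by (simp add: dyadic_def)

lemma D_ivl_snoc:
  "D_ivl (t @ [False]) \<union> D_ivl (t @ [True]) = D_ivl t"
  "D_ivl (t @ [False]) \<inter> D_ivl (t @ [True]) = {}"
proof -
  obtain p q where pq: "foldl halve (0, 1) t = (p, q)"
    by (rule prod.exhaust)
  have "p \<le> q"
    using foldl_halve_bounds[OF _ pq] by simp
  then show "D_ivl (t @ [False]) \<union> D_ivl (t @ [True]) = D_ivl t"
    "D_ivl (t @ [False]) \<inter> D_ivl (t @ [True]) = {}"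
    by (auto simp: dyadic_def pq)
qed

lemma D_ivl_cover: "x \<in> {0..<1} \<Longrightarrow> \<exists>t\<in>level n. x \<in> D_ivl t"
proof (induction n)
  case 0
  then show ?case by (auto simp: level_def)
next
  case (Suc n)
  then obtain t where "t \<in> level n" "x \<in> D_ivl t" by blast
  then have "\<exists>b. x \<in> D_ivl (t @ [b])"
    using D_ivl_snoc(1)[of t] by blast
  moreover have "t @ [b] \<in> level (Suc n)" for b
    using \<open>t \<in> level n\<close> by (simp add: level_def)
  ultimately show ?case
    by blast
qed

lemma D_ivl_unique: "x \<in> D_ivl s \<Longrightarrow> x \<in> D_ivl t \<Longrightarrow> length s = length t \<Longrightarrow> s = t"
proof (induction s arbitrary: t rule: rev_induct)
  case (snoc b s)
  then obtain c t' where t: "t = t' @ [c]"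
    by (cases t rule: rev_cases) auto
  have sub: "D_ivl (r @ [a]) \<subseteq> D_ivl r" for r a
    using D_ivl_snoc(1)[of r] by (cases a) auto
  have "s = t'"
    using snoc t sub by (intro snoc.IH) auto
  moreover have "b = c"
    using snoc.prems D_ivl_snoc(2)[of s] unfolding t \<open>s = t'\<close> by (cases b; cases c) auto
  ultimately show ?case
    by (simp add: t)
qed simp

lemma disjoint_D_ivl: "disjoint_family_on D_ivl (level n)"
  using D_ivl_unique by (fastforce simp: disjoint_family_on_def level_def)

lemma UN_D_ivl: "(\<Union>t\<in>level n. D_ivl t) = {0..<1}"
  using D_ivl_cover D_ivl_subset by blast

lemma measure_D_ivl: "measure lebesgue (D_ivl t) = 1 / 2 ^ length t"
  using D_ivl_eq[of t] by auto

lemma restr_UN: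
  assumes "finite I" "disjoint_family_on A I" "\<And>i. i \<in> I \<Longrightarrow> A i \<in> sets lebesgue"
  shows "restr (\<Union>i\<in>I. A i) u = (\<Sum>i\<in>I. restr (A i) u)"
  using assms
proof (induction I rule: finite_induct)
  case (insert i I)
  have "restr (A i \<union> (\<Union>i\<in>I. A i)) u = restr (A i) u + restr (\<Union>i\<in>I. A i) u"
    using insert by (intro restr_Un) (auto simp: disjoint_family_on_def)
  with insert show ?case
    by (auto simp: disjoint_family_on_def)
qed (simp add: restr_empty)

lemma norm_restr_UN:
  assumes "finite I" "disjoint_family_on A I" "\<And>i. i \<in> I \<Longrightarrow> A i \<in> sets lebesgue"
  shows "norm (restr (\<Union>i\<in>I. A i) u) = (\<Sum>i\<in>I. norm (restr (A i) u))"
  using assms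
proof (induction I rule: finite_induct)
  case (insert i I)
  have "norm (restr (A i \<union> (\<Union>i\<in>I. A i)) u) = norm (restr (A i) u) + norm (restr (\<Union>i\<in>I. A i) u)"
    using insert by (intro norm_restr_Un) (auto simp: disjoint_family_on_def)
  with insert show ?case
    by (auto simp: disjoint_family_on_def)
qed (simp add: restr_empty)

lemma restr_ae_UNIV:
  assumes "A \<in> sets lebesgue" "AE x in lebesgue. x \<in> {0..1} \<longrightarrow> x \<in> A"
  shows "restr A u = u"
  using restr_cong[of A UNIV u] assms by (simp add: restr_UNIV)

lemma AE_neq_lebesgue: "AE x in lebesgue. x \<noteq> (a::real)"
  by (rule AE_I[of _ _ "{a}"]) auto

lemma restr_01: "restr {0..<1} u = u"
  by (rule restr_ae_UNIV) (use AE_neq_lebesgue[of 1] in auto)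

lemma sum_restr_level: "(\<Sum>t\<in>level n. restr (D_ivl t) u) = u"
  using restr_UN[OF finite_level disjoint_D_ivl] by (simp add: UN_D_ivl restr_01)

lemma sum_norm_restr_level: "(\<Sum>t\<in>level n. norm (restr (D_ivl t) u)) = norm u"
  using norm_restr_UN[OF finite_level disjoint_D_ivl] by (simp add: UN_D_ivl restr_01)

text \<open>
  Dominated convergence, stated for classes of functions.
\<close>

lemma abs_L1_tendsto:
  fixes s :: "nat \<Rightarrow> real \<Rightarrow> real"
  assumes f: "integrable leb01 f" and s: "\<And>i. integrable leb01 (s i)" and g: "integrable leb01 g"
    and lim: "\<And>x. x \<in> {0..1} \<Longrightarrow> (\<lambda>i. s i x) \<longlonglongrightarrow> f x"
    and bound: "\<And>i x. x \<in> {0..1} \<Longrightarrow> \<bar>s i x\<bar> \<le> g x"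
  shows "(\<lambda>i. abs_L1 (s i)) \<longlonglongrightarrow> abs_L1 f"
proof -
  have "(\<lambda>i. LINT x|leb01. \<bar>s i x - f x\<bar>) \<longlonglongrightarrow> (LINT x|leb01. 0)"
  proof (rule integral_dominated_convergence)
    show "integrable leb01 (\<lambda>x. g x + \<bar>f x\<bar>)"
      using f g by auto
    show "AE x in leb01. (\<lambda>i. \<bar>s i x - f x\<bar>) \<longlonglongrightarrow> 0"
    proof (rule AE_I2)
      fix x assume "x \<in> space leb01"
      then have "(\<lambda>i. \<bar>s i x - f x\<bar>) \<longlonglongrightarrow> \<bar>f x - f x\<bar>"
        by (intro tendsto_intros lim) auto
      then show "(\<lambda>i. \<bar>s i x - f x\<bar>) \<longlonglongrightarrow> 0" by simp
    qed
    show "AE x in leb01. norm \<bar>s i x - f x\<bar> \<le> g x + \<bar>f x\<bar>" for i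
    proof (rule AE_I2)
      fix x assume "x \<in> space leb01"
      then show "norm \<bar>s i x - f x\<bar> \<le> g x + \<bar>f x\<bar>"
        using bound[of x i] by auto
    qed
    show "(\<lambda>x. \<bar>s i x - f x\<bar>) \<in> borel_measurable leb01" for i
      using f s by (intro borel_measurable_integrable) auto
  qed auto
  then have "(\<lambda>i. norm (abs_L1 (s i) - abs_L1 f)) \<longlonglongrightarrow> 0"
    using f s by (simp add: abs_L1_minus norm_abs_L1)
  then show ?thesis
    by (rule LIM_zero_cancel[OF tendsto_norm_zero_cancel])
qed

lemma ind_cong:
  assumes "A \<in> sets lebesgue" "B \<in> sets lebesgue"
    "AE x in lebesgue. x \<in> {0..1} \<longrightarrow> (x \<in> A \<longleftrightarrow> x \<in> B)"
  shows "ind A = ind B"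
  using restr_cong[OF assms, of "ind UNIV"] assms by (simp add: restr_ind)

lemma ind_UN:
  assumes "finite I" "disjoint_family_on A I" "\<And>i. i \<in> I \<Longrightarrow> A i \<in> sets lebesgue"
  shows "ind (\<Union>i\<in>I. A i) = (\<Sum>i\<in>I. ind (A i))"
proof -
  have "(\<Union>i\<in>I. A i) \<in> sets lebesgue"
    using assms by (intro sets.finite_UN) auto
  moreover have "(\<Sum>i\<in>I. restr (A i) (ind UNIV)) = (\<Sum>i\<in>I. ind (A i))"
    using assms by (intro sum.cong) (auto simp: restr_ind)
  ultimately show ?thesis
    using restr_UN[OF assms, where u = "ind UNIV"] by (simp add: restr_ind)
qed

lemma ind_Diff:
  assumes "A \<in> sets lebesgue" "B \<in> sets lebesgue" "B \<subseteq> A"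
  shows "ind (A - B) = ind A - ind B"
proof -
  have "restr (B \<union> (A - B)) (ind UNIV) = restr B (ind UNIV) + restr (A - B) (ind UNIV)"
    using assms by (intro restr_Un) auto
  moreover have "B \<union> (A - B) = A"
    using assms by auto
  ultimately show ?thesis
    using assms by (simp add: restr_ind)
qed

lemma ind_UN_sums:
  assumes "disjoint_family A" "\<And>i. A i \<in> sets lebesgue"
  shows "(\<lambda>i. ind (A i)) sums ind (\<Union>i. A i)"
proof -
  have m: "(\<Union>i<n. A i) \<in> sets lebesgue" "(\<Union>i. A i) \<in> sets lebesgue" for n
    using assms(2) by auto
  have "(\<lambda>n. abs_L1 (indicator (\<Union>i<n. A i))) \<longlonglongrightarrow> abs_L1 (indicator (\<Union>i. A i))"
    by (intro abs_L1_tendsto[where g = "\<lambda>_. 1"] integrable_indicator_leb01 LIMSEQ_indicator_UN m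
      leb01_integrable_bounded[of _ 1]) (auto simp: indicator_def)
  moreover have "abs_L1 (indicator (\<Union>i<n. A i)) = (\<Sum>i<n. ind (A i))" for n
    using assms ind_UN[of "{..<n}" A] m by (simp add: ind_eq_abs_L1 disjoint_family_on_def)
  ultimately show ?thesis
    using m by (simp add: sums_def ind_eq_abs_L1)
qed

text \<open>
  The sets with indicator in \<open>V\<close> form a Dynkin system, and the half-lines are a generator of the
  Borel sets that is stable under intersection.
\<close>

lemma ind_borel_mem:
  assumes V: "closed V" "subspace V" and base: "\<And>a. ind {..<a} \<in> V" and A: "A \<in> sets borel"
  shows "ind A \<in> V"
proof -
  have borel: "sets borel = sigma_sets UNIV (range lessThan :: real set set)"
    by (simp add: borel_Iio)
  have meas: "B \<in> sets lebesgue" if "B \<in> sigma_sets UNIV (range lessThan)" for B :: "real set"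
    using that borel sets_completionI_sets[of B lborel] by simp
  have "Int_stable (range lessThan :: real set set)"
  proof (rule Int_stableI; clarify)
    fix a b :: real
    have "{..<a} \<inter> {..<b} = {..<min a b}"
      by auto
    then show "{..<a} \<inter> {..<b} \<in> range lessThan"
      by blast
  qed
  moreover have "range lessThan \<subseteq> Pow (UNIV :: real set)"
    by simp
  ultimately show ?thesis
    using A[unfolded borel]
  proof (induction rule: sigma_sets_induct_disjoint)
    case empty
    show ?case using V(2) by (simp add: subspace_0)
  next
    case (compl A)
    have "ind UNIV = ind {..<2}"
      by (rule ind_cong) auto
    then have "ind UNIV \<in> V"
      using base by simp
    moreover have "ind (UNIV - A) = ind UNIV - ind A"
      using meas[OF compl(1)] by (intro ind_Diff) auto
    ultimately show ?case
      using compl(2) V(2) by (simp add: subspace_diff)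
  next
    case (union A)
    have m: "A i \<in> sets lebesgue" for i
      using union(2) by (intro meas) auto
    have "(\<lambda>i. ind (A i)) sums ind (\<Union>i. A i)"
      by (rule ind_UN_sums[OF union(1) m])
    moreover have "(\<Sum>i<n. ind (A i)) \<in> V" for n
      using union(3) V(2) by (simp add: subspace_sum)
    ultimately show ?case
      unfolding sums_def by (rule closed_sequentially[OF V(1), rotated])
  qed (use base in auto)
qed

lemma ind_lebesgue_mem:
  assumes V: "closed V" "subspace V" and base: "\<And>a. ind {..<a} \<in> V" and A: "A \<in> sets lebesgue"
  shows "ind A \<in> V"
proof -
  obtain S N N' where *: "A = S \<union> N" "N \<subseteq> N'" "N' \<in> null_sets lborel" "S \<in> sets lborel"
    using A by (rule sets_completionE)
  have "AE x in lebesgue. x \<notin> N'"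
    using AE_not_in[OF null_sets_completionI[OF *(3)]] .
  then have "AE x in lebesgue. x \<in> {0..1} \<longrightarrow> (x \<in> A \<longleftrightarrow> x \<in> S)"
    by eventually_elim (use * in auto)
  then have "ind A = ind S"
    using A sets_completionI_sets[OF *(4)] by (intro ind_cong)
  then show ?thesis
    using ind_borel_mem[OF V base, of S] *(4) by simp
qed

text \<open>
  The density criterion used below: indicators of half-lines span a dense subspace.  Indicators
  generate all integrable functions by linear combinations and dominated limits.
\<close>

lemma closed_subspace_eq_UNIV:
  assumes V: "closed V" "subspace V" and base: "\<And>a. ind {..<a} \<in> V"
  shows "u \<in> V"
proof -
  obtain f where f: "integrable leb01 f" "u = abs_L1 f"
    by (metis L1_cases)
  have "abs_L1 f \<in> V"
    using f(1)
  proof (induct rule: integrable_induct)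
    case (base A c)
    then have A: "A \<in> sets lebesgue"
      by (auto simp: sets_restrict_space)
    have "abs_L1 (\<lambda>x. indicator A x *\<^sub>R c) = c *\<^sub>R ind A"
      using A by (simp add: ind_eq_abs_L1 abs_L1_scaleR integrable_indicator_leb01 mult.commute)
    then show ?case
      using ind_lebesgue_mem[OF V assms(3) A] V(2) by (simp add: subspace_scale)
  next
    case (add f g)
    then show ?case
      using subspace_add[OF V(2) add(2,4)] abs_L1_plus[OF add(1,3)] by simp
  next
    case (lim f s)
    have *: "(\<lambda>i. abs_L1 (s i)) \<longlonglongrightarrow> abs_L1 f"
    proof (rule abs_L1_tendsto)
      show "integrable leb01 (\<lambda>x. 2 * norm (f x))"
        using integrable_abs[OF lim(5)] by simp
      show "(\<lambda>i. s i x) \<longlonglongrightarrow> f x" "\<bar>s i x\<bar> \<le> 2 * norm (f x)" if "x \<in> {0..1}" for i x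
        using lim(3)[of x] lim(4)[of x i] that by simp_all
    qed (rule lim)+
    then show ?case
      using closed_sequentially[OF V(1) _ *] lim(2) by simp
  qed
  then show ?thesis by (simp add: f)
qed

text \<open>
  Equicontinuous seminorms that tend to 0 on a set with dense span tend to 0 everywhere.
\<close>

lemma seminorms_tendsto_0:
  fixes p :: "nat \<Rightarrow> L1 \<Rightarrow> real"
  assumes add: "\<And>n u v. p n (u + v) \<le> p n u + p n v"
    and scale: "\<And>n c u. p n (c *\<^sub>R u) \<le> \<bar>c\<bar> * p n u"
    and nonneg: "\<And>n u. 0 \<le> p n u"
    and bound: "\<And>n u. p n u \<le> K * norm u"
    and base: "\<And>a. (\<lambda>n. p n (ind {..<a})) \<longlonglongrightarrow> 0"
  shows "(\<lambda>n. p n u) \<longlonglongrightarrow> 0"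
proof -
  define V where "V = {u. (\<lambda>n. p n u) \<longlonglongrightarrow> 0}"
  have squeeze: "u \<in> V" if "\<And>n. p n u \<le> q n" "q \<longlonglongrightarrow> 0" for u q
    unfolding V_def mem_Collect_eq
    by (rule tendsto_sandwich[OF _ _ tendsto_const that(2)]) (simp_all add: that(1) nonneg)
  have "subspace V"
  proof (rule subspaceI)
    show "0 \<in> V"
      using bound[of _ 0] by (intro squeeze[of _ "\<lambda>_. 0"]) simp_all
  next
    fix u v assume "u \<in> V" "v \<in> V"
    then have "(\<lambda>n. p n u + p n v) \<longlonglongrightarrow> 0"
      unfolding V_def mem_Collect_eq by (rule tendsto_add_zero)
    then show "u + v \<in> V"
      by (rule squeeze[OF add])
  next
    fix c u assume "u \<in> V"
    then have "(\<lambda>n. \<bar>c\<bar> * p n u) \<longlonglongrightarrow> 0"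
      unfolding V_def mem_Collect_eq by (rule tendsto_mult_right_zero)
    then show "c *\<^sub>R u \<in> V"
      by (rule squeeze[OF scale])
  qed
  moreover have "closed V"
    unfolding closed_sequential_limits
  proof safe
    fix s u assume s: "\<forall>n. s n \<in> V" "s \<longlonglongrightarrow> u"
    show "u \<in> V"
      unfolding V_def mem_Collect_eq LIMSEQ_iff
    proof safe
      fix e :: real assume "e > 0"
      \<comment> \<open>A positive bound, since \<open>K\<close> is arbitrary.\<close>
      define K' where "K' = \<bar>K\<bar> + 1"
      have "K' > 0" "K \<le> K'"
        unfolding K'_def by linarith+
      then have "e / (2 * K') > 0"
        using \<open>e > 0\<close> by simp
      with s(2) obtain k where k: "norm (s k - u) < e / (2 * K')"
        by (auto simp: LIMSEQ_iff)
      from s(1) have "(\<lambda>n. p n (s k)) \<longlonglongrightarrow> 0"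
        by (simp add: V_def)
      then obtain N where N: "\<And>n. n \<ge> N \<Longrightarrow> norm (p n (s k) - 0) < e / 2"
        unfolding LIMSEQ_iff using \<open>e > 0\<close> by (meson half_gt_zero)
      have "norm (p n u - 0) < e" if "n \<ge> N" for n
      proof -
        have "p n u \<le> p n (s k) + p n (u - s k)"
          using add[of n "s k" "u - s k"] by simp
        also have "p n (u - s k) \<le> K' * norm (s k - u)"
          using bound[of n "u - s k"] mult_right_mono[OF \<open>K \<le> K'\<close>, of "norm (u - s k)"]
          by (simp add: norm_minus_commute)
        also have "K' * norm (s k - u) < e / 2"
          using k \<open>K' > 0\<close> by (simp add: field_simps)
        finally show ?thesis
          using N[OF that] nonneg[of n u] by simp
      qed
      then show "\<exists>N. \<forall>n\<ge>N. norm (p n u - 0) < e" by blast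
    qed
  qed
  moreover have "ind {..<a} \<in> V" for a
    using base by (simp add: V_def)
  ultimately have "u \<in> V"
    using closed_subspace_eq_UNIV[of V u] by blast
  then show ?thesis by (simp add: V_def)
qed

section \<open>Dyadic averages\<close>

definition atom :: "bool list \<Rightarrow> L1" where
  "atom t = 2 ^ length t *\<^sub>R ind (D_ivl t)"

text \<open>
  The conditional expectation with respect to the partition into dyadic intervals of level \<open>n\<close>.
\<close>

definition dyadic_avg :: "nat \<Rightarrow> L1 \<Rightarrow> L1" where
  "dyadic_avg n u = (\<Sum>t\<in>level n. integ (restr (D_ivl t) u) *\<^sub>R atom t)"

lemma D_ivl_Int_01: "D_ivl t \<inter> {0..1} = D_ivl t"
  using D_ivl_subset[of t] by auto

lemma integ_atom: "integ (atom t) = 1"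
  by (simp add: atom_def integ_scaleR integ_ind D_ivl_Int_01 measure_D_ivl)

lemma norm_atom: "norm (atom t) = 1"
  by (simp add: atom_def norm_ind D_ivl_Int_01 measure_D_ivl)

lemma restr_D_ivl_atom:
  assumes "length s = length t"
  shows "restr (D_ivl s) (atom t) = (if s = t then atom t else 0)"
proof (cases "s = t")
  case False
  then have "D_ivl s \<inter> D_ivl t = {}"
    using D_ivl_unique assms by blast
  then show ?thesis
    using False by (simp add: atom_def restr_scaleR restr_ind)
qed (simp add: atom_def restr_scaleR restr_ind)

lemma atom_split: "atom t = (1/2) *\<^sub>R (atom (t @ [False]) + atom (t @ [True]))"
proof -
  have "restr (D_ivl (t @ [False]) \<union> D_ivl (t @ [True])) (ind UNIV)
      = restr (D_ivl (t @ [False])) (ind UNIV) + restr (D_ivl (t @ [True])) (ind UNIV)"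
    using D_ivl_snoc(2) by (intro restr_Un) auto
  then have "ind (D_ivl t) = ind (D_ivl (t @ [False])) + ind (D_ivl (t @ [True]))"
    by (simp add: D_ivl_snoc(1) restr_ind)
  then show ?thesis
    by (simp add: atom_def scaleR_add_right)
qed

lemma dyadic_avg_add: "dyadic_avg n (u + v) = dyadic_avg n u + dyadic_avg n v"
  by (simp add: dyadic_avg_def restr_add integ_add scaleR_add_left sum.distrib)

lemma dyadic_avg_scaleR: "dyadic_avg n (c *\<^sub>R u) = c *\<^sub>R dyadic_avg n u"
  by (simp add: dyadic_avg_def restr_scaleR integ_scaleR scaleR_sum_right)

lemma sum_abs_integ_le: "(\<Sum>t\<in>level n. \<bar>integ (restr (D_ivl t) u)\<bar>) \<le> norm u"
proof -
  have "(\<Sum>t\<in>level n. \<bar>integ (restr (D_ivl t) u)\<bar>) \<le> (\<Sum>t\<in>level n. norm (restr (D_ivl t) u))"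
    by (rule sum_mono) (rule abs_integ_le)
  then show ?thesis
    by (simp add: sum_norm_restr_level)
qed

lemma norm_dyadic_avg_le: "norm (dyadic_avg n u) \<le> norm u"
proof -
  have "norm (dyadic_avg n u) \<le> (\<Sum>t\<in>level n. \<bar>integ (restr (D_ivl t) u)\<bar>)"
    unfolding dyadic_avg_def by (rule order_trans[OF norm_sum]) (simp add: norm_atom)
  then show ?thesis
    using sum_abs_integ_le[where u = u and n = n] by linarith
qed

lemma dyadic_avg_atom:
  assumes "t \<in> level n"
  shows "dyadic_avg n (atom t) = atom t"
proof -
  have "dyadic_avg n (atom t) = (\<Sum>s\<in>level n. if s = t then atom t else 0)"
    unfolding dyadic_avg_def
    using assms by (intro sum.cong) (auto simp: level_def restr_D_ivl_atom integ_atom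
      bounded_linear.linear[OF bounded_linear_integ, THEN linear_0])
  then show ?thesis
    using assms by simp
qed

lemma dyadic_avg_sum: "dyadic_avg n (\<Sum>i\<in>I. f i) = (\<Sum>i\<in>I. dyadic_avg n (f i))"
  by (rule linear_sum) (auto intro!: linearI dyadic_avg_add dyadic_avg_scaleR)

text \<open>
  Averaging fixes indicators of unions of intervals of level \<open>n\<close>.  The half-line differs from the
  largest such union inside it only within the one interval that contains \<open>a\<close>.
\<close>

lemma dyadic_avg_ind:
  "norm (dyadic_avg n (ind {..<a}) - ind {..<a}) \<le> 2 * (1 / 2) ^ n"
proof -
  define F where "F = {t \<in> level n. D_ivl t \<subseteq> {..<a}}"
  define B where "B = (\<Union>t\<in>F. D_ivl t)"
  define v where "v = ind B"
  have F: "finite F" "F \<subseteq> level n"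
    by (auto simp: F_def)
  have B: "B \<in> sets lebesgue" "B \<subseteq> {..<a}"
    using F by (auto simp: B_def F_def)
  have "v = (\<Sum>t\<in>F. ind (D_ivl t))"
    unfolding v_def B_def using F disjoint_family_on_mono[OF F(2) disjoint_D_ivl] by (intro ind_UN) auto
  also have "\<dots> = (\<Sum>t\<in>F. (1 / 2 ^ n) *\<^sub>R atom t)"
    by (intro sum.cong) (auto simp: atom_def F_def level_def)
  finally have v: "v = (\<Sum>t\<in>F. (1 / 2 ^ n) *\<^sub>R atom t)" .
  have avg_v: "dyadic_avg n v = v"
    unfolding v dyadic_avg_sum using F
    by (intro sum.cong) (auto simp: dyadic_avg_scaleR dyadic_avg_atom)
  \<comment> \<open>The endpoint 1 lies in no interval of the partition; it is a null set.\<close>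
  have sub: "({..<a} - B) \<inter> {0..1} \<subseteq> {a - 1 / 2 ^ n..<a} \<union> {1}"
  proof
    fix x assume x: "x \<in> ({..<a} - B) \<inter> {0..1}"
    show "x \<in> {a - 1 / 2 ^ n..<a} \<union> {1}"
    proof (cases "x = 1")
      case False
      then have "x \<in> {0..<1}" using x by auto
      then obtain t where t: "t \<in> level n" "x \<in> D_ivl t"
        using D_ivl_cover by blast
      with x have "\<not> D_ivl t \<subseteq> {..<a}"
        by (auto simp: B_def F_def)
      then obtain y where "y \<in> D_ivl t" "y \<ge> a"
        by (force simp: subset_eq)
      moreover have "length t = n"
        using t by (simp add: level_def)
      ultimately have "a - 1 / 2 ^ n \<le> x"
        using D_ivl_eq[of t] t(2) by auto
      with x show ?thesis by auto
    qed auto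
  qed
  have "norm (ind {..<a} - v) = norm (ind ({..<a} - B))"
    unfolding v_def using B by (subst ind_Diff) auto
  also have "\<dots> = measure lebesgue (({..<a} - B) \<inter> {0..1})"
    using B by (intro norm_ind) auto
  also have "\<dots> \<le> measure lebesgue ({a - 1 / 2 ^ n..<a} \<union> {1})"
    by (intro measure_mono_fmeasurable[OF sub] sets.Int sets.Diff B bounded_set_imp_lmeasurable bounded_Un[THEN iffD2] conjI) auto
  also have "\<dots> = measure lebesgue {a - 1 / 2 ^ n..<a}"
    by (intro measure_Un_null_set) auto
  also have "\<dots> = (1 / 2) ^ n"
    by (simp add: power_divide)
  finally have *: "norm (ind {..<a} - v) \<le> (1 / 2) ^ n" .
  have "dyadic_avg n (ind {..<a}) - ind {..<a} = dyadic_avg n (ind {..<a} - v) - (ind {..<a} - v)"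
    using dyadic_avg_add[of n "ind {..<a} - v" v] by (simp add: avg_v)
  also have "norm \<dots> \<le> norm (dyadic_avg n (ind {..<a} - v)) + norm (ind {..<a} - v)"
    by (rule norm_triangle_ineq4)
  finally show ?thesis
    using * norm_dyadic_avg_le[of n "ind {..<a} - v"] by linarith
qed

lemma half_power_tendsto: "(\<lambda>n. c * (1 / 2 :: real) ^ n) \<longlonglongrightarrow> 0"
  by (intro tendsto_mult_right_zero LIMSEQ_power_zero) simp

lemma dyadic_avg_tendsto: "(\<lambda>n. dyadic_avg n u) \<longlonglongrightarrow> u"
proof -
  have "(\<lambda>n. norm (dyadic_avg n u - u)) \<longlonglongrightarrow> 0"
  proof (rule seminorms_tendsto_0[where K = 2])
    fix n and u v :: L1 and c :: real
    have *: "dyadic_avg n (u + v) - (u + v) = (dyadic_avg n u - u) + (dyadic_avg n v - v)"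
      by (simp add: dyadic_avg_add)
    show "norm (dyadic_avg n (u + v) - (u + v)) \<le> norm (dyadic_avg n u - u) + norm (dyadic_avg n v - v)"
      unfolding * by (rule norm_triangle_ineq)
    show "norm (dyadic_avg n (c *\<^sub>R u) - c *\<^sub>R u) \<le> \<bar>c\<bar> * norm (dyadic_avg n u - u)"
      by (simp add: dyadic_avg_scaleR flip: scaleR_diff_right)
    show "norm (dyadic_avg n u - u) \<le> 2 * norm u"
      using norm_triangle_ineq4[of "dyadic_avg n u" u] norm_dyadic_avg_le[of n u] by linarith
  next
    fix a
    show "(\<lambda>n. norm (dyadic_avg n (ind {..<a}) - ind {..<a})) \<longlonglongrightarrow> 0"
      by (rule tendsto_sandwich[OF _ _ tendsto_const half_power_tendsto[of 2]])
        (simp_all only: dyadic_avg_ind norm_ge_zero always_eventually simp_thms)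
  qed auto
  then show ?thesis
    by (rule LIM_zero_cancel[OF tendsto_norm_zero_cancel])
qed

lemma level_nonempty: "level n \<noteq> {}"
  using Ex_list_of_length[of n] by (auto simp: level_def)

text \<open>
  Lebesgue measure is non-atomic, in quantitative form: the mass of \<open>u\<close> on an interval of level \<open>n\<close>
  tends to 0 uniformly over the level.  On indicators this mass is at most \<open>2^-n\<close>.
\<close>

lemma restr_D_ivl_uniformly_small:
  assumes "e > 0"
  shows "\<forall>\<^sub>F n in sequentially. \<forall>t\<in>level n. norm (restr (D_ivl t) u) < e"
proof -
  define p where "p n u = Max ((\<lambda>t. norm (restr (D_ivl t) u)) ` level n)" for n u
  have ge: "norm (restr (D_ivl t) u) \<le> p n u" if "t \<in> level n" for n t u
    using that by (auto simp: p_def)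
  have le: "p n u \<le> r" if "\<And>t. t \<in> level n \<Longrightarrow> norm (restr (D_ivl t) u) \<le> r" for n r u
    using that level_nonempty by (auto simp: p_def)
  have nonneg: "0 \<le> p n u" for n u
  proof -
    obtain t where "t \<in> level n"
      using level_nonempty by blast
    from ge[OF this, of u] norm_ge_zero[of "restr (D_ivl t) u"] show ?thesis
      by linarith
  qed
  have "(\<lambda>n. p n u) \<longlonglongrightarrow> 0"
  proof (rule seminorms_tendsto_0[where K = 1])
    fix n and u v :: L1 and c :: real
    show "p n (u + v) \<le> p n u + p n v"
      by (rule le) (use ge in \<open>auto simp: restr_add intro!: order_trans[OF norm_triangle_ineq] add_mono\<close>)
    show "p n (c *\<^sub>R u) \<le> \<bar>c\<bar> * p n u"
      by (rule le) (use ge in \<open>auto simp: restr_scaleR intro!: mult_left_mono\<close>)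
    show "p n u \<le> 1 * norm u"
      by (rule le) (simp add: norm_restr_le)
  next
    fix a
    have *: "p n (ind {..<a}) \<le> 1 * (1 / 2) ^ n" for n
    proof (rule le)
      fix t assume "t \<in> level n"
      have "norm (restr (D_ivl t) (ind {..<a})) = measure lebesgue (D_ivl t \<inter> {..<a} \<inter> {0..1})"
        using norm_ind[of "D_ivl t \<inter> {..<a}"] by (simp add: restr_ind sets.Int)
      also have "\<dots> \<le> measure lebesgue (D_ivl t)"
        using D_ivl_eq[of t] by (intro measure_mono_fmeasurable bounded_set_imp_lmeasurable) auto
      finally show "norm (restr (D_ivl t) (ind {..<a})) \<le> 1 * (1 / 2) ^ n"
        using \<open>t \<in> level n\<close> by (simp add: measure_D_ivl level_def power_divide)
    qed
    show "(\<lambda>n. p n (ind {..<a})) \<longlonglongrightarrow> 0"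
      by (rule tendsto_sandwich[OF _ _ tendsto_const half_power_tendsto[of 1]])
        (simp_all only: * nonneg always_eventually simp_thms)
  qed (rule nonneg)
  then have "\<forall>\<^sub>F n in sequentially. p n u < e"
    using assms by (rule order_tendstoD)
  then show ?thesis
  proof eventually_elim
    case (elim n)
    then show ?case
      using le_less_trans[OF ge] by blast
  qed
qed

section \<open>The isometric embedding and the generators\<close>

text \<open>
  \<open>copy i\<close> places a scaled copy of a function on the block \<open>[2^-(i+1), 2^-i)\<close>, and \<open>pull i\<close> reads the
  block off again.  The factor 2 makes the norms of the copies in the blocks \<open>i = 1, 2, \<dots>\<close> sum to
  the norm of the original.
\<close>

definition copy :: "nat \<Rightarrow> L1 \<Rightarrow> L1" where
  "copy i u = 2 *\<^sub>R affine_comp (- 1) (2 ^ (i + 1)) u"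

definition pull :: "nat \<Rightarrow> L1 \<Rightarrow> L1" where
  "pull i x = (1 / 2) *\<^sub>R affine_comp (1 / 2 ^ (i + 1)) (1 / 2 ^ (i + 1)) x"

definition blk :: "nat \<Rightarrow> real set" where
  "blk i = {1 / 2 ^ (i + 1)..<1 / 2 ^ i}"

lemma blk_measurable [simp, measurable]: "blk i \<in> sets lebesgue"
  by (simp add: blk_def)

lemma bounded_linear_copy: "bounded_linear (copy i)"
  unfolding copy_def by (intro bounded_linear_scaleR_right[THEN bounded_linear_compose] bounded_linear_affine_comp) simp

lemma bounded_linear_pull: "bounded_linear (pull i)"
  unfolding pull_def by (intro bounded_linear_scaleR_right[THEN bounded_linear_compose] bounded_linear_affine_comp) simp

lemma restr_blk: "restr (blk i) x = restr {1 / 2 ^ (i + 1)..1 / 2 ^ i} x"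
  by (rule restr_cong) (use AE_neq_lebesgue[of "1 / 2 ^ i"] in \<open>auto simp: blk_def elim!: AE_mp\<close>)

lemma restr_superset: "A \<in> sets lebesgue \<Longrightarrow> {0..1} \<subseteq> A \<Longrightarrow> restr A u = u"
  by (rule restr_ae_UNIV) (auto intro!: AE_I2)

lemma norm_copy: "norm (copy i u) = norm u / 2 ^ i"
proof -
  have "{0..1} \<subseteq> {- 1..- 1 + (2::real) ^ (i + 1)}"
    using one_le_power[of "2::real" i] by auto
  then have "restr {- 1..- 1 + 2 ^ (i + 1)} u = u"
    by (intro restr_superset) auto
  then show ?thesis
    by (simp add: copy_def norm_affine_comp)
qed

lemma integ_copy: "integ (copy i u) = integ u / 2 ^ i"
proof -
  have "{0..1} \<subseteq> {- 1..- 1 + (2::real) ^ (i + 1)}"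
    using one_le_power[of "2::real" i] by auto
  then have "restr {- 1..- 1 + 2 ^ (i + 1)} u = u"
    by (intro restr_superset) auto
  then show ?thesis
    by (simp add: copy_def integ_affine_comp integ_scaleR)
qed

lemma norm_pull: "norm (pull i x) = 2 ^ i * norm (restr (blk i) x)"
  by (simp add: pull_def norm_affine_comp restr_blk)

text \<open>
  The composite is a substitution with slope \<open>2^(j+1) / 2^(i+1)\<close>.  It is the identity when \<open>i = j\<close>; otherwise its
  image of \<open>[0,1]\<close> meets \<open>[0,1]\<close> in at most one point.
\<close>

lemma pull_copy: "pull i (copy j u) = (if i = j then u else 0)"
proof -
  define r :: real where "r = 2 ^ (j + 1) / 2 ^ (i + 1)"
  have "r > 0" by (simp add: r_def)
  have "pull i (copy j u)
    = affine_comp (1 / 2 ^ (i + 1)) (1 / 2 ^ (i + 1)) (affine_comp (- 1) (2 ^ (j + 1)) u)"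
    by (simp add: copy_def pull_def affine_comp_scaleR)
  also have "\<dots> = restr {- 1..2 ^ (i + 1) - 1} (affine_comp (r - 1) r u)"
  proof -
    have "(1 - 1 / e) / (1 / e) = e - 1" if "e > 0" for e :: real
      using that by (simp add: field_simps)
    from this[of "2 ^ (i + 1)"] show ?thesis
      by (subst affine_comp_affine_comp) (simp_all add: r_def)
  qed
  also have "\<dots> = affine_comp (r - 1) r u"
    using one_le_power[of "2::real" i] by (intro restr_superset) auto
  finally have *: "pull i (copy j u) = affine_comp (r - 1) r u" .
  consider "i = j" | "i < j" | "j < i" by linarith
  then show ?thesis
  proof cases
    case 1
    then have "r = 1" by (simp add: r_def)
    then show ?thesis unfolding * by (simp add: 1 affine_comp_id)
  next
    case 2
    have "r = 2 ^ (j - i)"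
      using 2 by (simp add: r_def power_diff)
    moreover have "(2::real) ^ 1 \<le> 2 ^ (j - i)"
      using 2 by (intro power_increasing) auto
    ultimately have "2 \<le> r" by simp
    then have "restr {r - 1..r - 1 + r} u = restr {} u"
      using AE_neq_lebesgue[of 1] by (intro restr_cong) (auto elim!: AE_mp)
    then have "norm (affine_comp (r - 1) r u) = 0"
      using \<open>r > 0\<close> by (simp only: norm_affine_comp restr_empty) simp
    with 2 show ?thesis by (simp add: *)
  next
    case 3
    have "1 / r = 2 ^ (i - j)"
      using 3 by (simp add: r_def power_diff)
    moreover have "(2::real) ^ 1 \<le> 2 ^ (i - j)"
      using 3 by (intro power_increasing) auto
    ultimately have "2 \<le> 1 / r" by simp
    then have "2 * r \<le> 1"
      using \<open>r > 0\<close> by (simp add: field_simps)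
    then have "restr {r - 1..r - 1 + r} u = restr {} u"
      using AE_neq_lebesgue[of 0] by (intro restr_cong) (auto elim!: AE_mp)
    then have "norm (affine_comp (r - 1) r u) = 0"
      using \<open>r > 0\<close> by (simp only: norm_affine_comp restr_empty) simp
    with 3 show ?thesis by (simp add: *)
  qed
qed

lemma disjoint_blk: "disjoint_family_on blk I"
proof -
  have "blk m \<inter> blk n = {}" if "m < n" for m n
  proof -
    have "(1::real) / 2 ^ n \<le> 1 / 2 ^ (m + 1)"
      using that by (intro divide_left_mono power_increasing) auto
    then show ?thesis by (auto simp: blk_def)
  qed
  then show ?thesis
    unfolding disjoint_family_on_def by (metis inf_commute linorder_neqE_nat)
qed

text \<open>
  The blocks are disjoint, so the norms on them add up to at most the norm of \<open>x\<close>.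
\<close>

lemma sum_norm_pull_le: "(\<Sum>i<n. norm (pull (Suc i) x) / 2 ^ Suc i) \<le> norm x"
proof -
  have "disjoint_family_on (\<lambda>i. blk (Suc i)) {..<n}"
    using disjoint_blk[of UNIV] by (auto simp: disjoint_family_on_def)
  then have "norm (restr (\<Union>i<n. blk (Suc i)) x) = (\<Sum>i<n. norm (restr (blk (Suc i)) x))"
    by (intro norm_restr_UN) auto
  then show ?thesis
    using norm_restr_le[of "\<Union>i<n. blk (Suc i)" x] by (simp add: norm_pull)
qed

text \<open>
  The embedding of \<open>L_1[0,1]\<close> with range \<open>Y\<close>.  Block 0, which is \<open>[1/2, 1)\<close>, remains free for the
  sets \<open>C_ivl n t\<close>.
\<close>

definition spread :: "L1 \<Rightarrow> L1" where
  "spread u = (\<Sum>i. copy (Suc i) u)"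

lemma half_sums: "(\<lambda>i. c / 2 ^ (Suc (i + n))) sums (c / 2 ^ n :: real)"
  using sums_mult[OF power_half_series, of "c / 2 ^ n"] by (simp add: power_add power_divide field_simps)

lemma summable_norm_copy: "summable (\<lambda>i. norm (copy (Suc i) u))"
  using half_sums[of "norm u" 0] by (simp add: norm_copy sums_iff)

lemmas summable_copy = summable_norm_cancel[OF summable_norm_copy]

lemma spread_add: "spread (u + v) = spread u + spread v"
  unfolding spread_def using suminf_add[OF summable_copy summable_copy]
  by (simp add: bounded_linear.linear[OF bounded_linear_copy, THEN linear_add])

lemma spread_scaleR: "spread (c *\<^sub>R u) = c *\<^sub>R spread u"
  unfolding spread_def using suminf_scaleR_right[OF summable_copy]
  by (simp add: bounded_linear.linear[OF bounded_linear_copy, THEN linear_scale])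

lemma linear_spread: "linear spread"
  by (intro linearI spread_add spread_scaleR)

lemma pull_spread: "pull (Suc i) (spread u) = u"
proof -
  have "pull (Suc i) (spread u) = (\<Sum>j. pull (Suc i) (copy (Suc j) u))"
    unfolding spread_def by (rule bounded_linear.suminf[OF bounded_linear_pull summable_copy])
  also have "\<dots> = (\<Sum>j. if j = i then u else 0)"
    by (intro suminf_cong) (auto simp: pull_copy)
  also have "\<dots> = u"
    using sums_single[of i "\<lambda>_. u"] by (simp add: sums_iff)
  finally show ?thesis .
qed

text \<open>
  The triangle inequality bounds the norm from above; reading off the disjoint blocks
  bounds it from below, since each of them returns \<open>u\<close>.
\<close>

lemma norm_spread: "norm (spread u) = norm u"
proof (rule antisym)
  have s: "(\<lambda>i. norm u / 2 ^ Suc i) sums norm u"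
    using half_sums[of "norm u" 0] by simp
  have "norm (spread u) \<le> (\<Sum>i. norm (copy (Suc i) u))"
    unfolding spread_def by (rule summable_norm[OF summable_norm_copy])
  also have "\<dots> = norm u"
    using s by (simp only: norm_copy sums_iff)
  finally show "norm (spread u) \<le> norm u" .
  have "(\<Sum>i<n. norm u / 2 ^ Suc i) \<le> norm (spread u)" for n
    using sum_norm_pull_le[where n = n and x = "spread u"] by (simp only: pull_spread)
  with s show "norm u \<le> norm (spread u)"
    unfolding sums_def by (intro LIMSEQ_le_const2) auto
qed

lemma bounded_linear_spread: "bounded_linear spread"
  by (rule bounded_linear_intro[of _ 1]) (simp_all add: spread_add spread_scaleR norm_spread)

lemma B_ivl_measurable [simp]: "B_ivl i t \<in> sets lebesgue"
  by (simp add: B_ivl_def)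

lemma C_ivl_measurable [simp]: "C_ivl i t \<in> sets lebesgue"
  by (simp add: C_ivl_def)

lemma mem_B_ivl_iff: "x \<in> B_ivl i t \<longleftrightarrow> - 1 + 2 ^ (i + 1) * x \<in> D_ivl t"
proof -
  have "(x - 1 / e) / (1 / e) = - 1 + e * x" if "e > 0" for e
    using that by (simp add: field_simps)
  from this[of "2 ^ (i + 1)"] show ?thesis
    unfolding B_ivl_def by (subst mem_dyadic_iff[of "1 / 2 ^ (i + 1)"]) simp_all
qed

lemma mem_C_ivl_iff: "x \<in> C_ivl i t \<longleftrightarrow> - 1 + 2 ^ (i + 1) * (x - 1 / 2) \<in> D_ivl t"
proof -
  have "(x - (1 / 2 + 1 / e)) / (1 / e) = - 1 + e * (x - 1 / 2)" if "e > 0" for e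
    using that by (simp add: field_simps)
  from this[of "2 ^ (i + 1)"] show ?thesis
    unfolding C_ivl_def by (subst mem_dyadic_iff[of "1 / 2 ^ (i + 1)"]) simp_all
qed

lemma copy_ind:
  assumes "A \<in> sets lebesgue" "A \<subseteq> {0..1}"
    and "B \<in> sets lebesgue" "\<And>x. x \<in> B \<longleftrightarrow> - 1 + 2 ^ (i + 1) * x \<in> A"
  shows "copy i (ind A) = 2 *\<^sub>R ind B"
proof -
  have "(\<lambda>x. indicator {0..1} (- 1 + 2 ^ (i + 1) * x) * indicator A (- 1 + 2 ^ (i + 1) * x)) = (indicator B :: real \<Rightarrow> real)"
    using assms by (auto simp: indicator_def fun_eq_iff)
  then show ?thesis
    using assms by (simp add: copy_def ind_eq_abs_L1 affine_comp_abs_L1 integrable_indicator_leb01)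
qed

lemma copy_atom: "copy i (atom t) = 2 ^ (length t + 1) *\<^sub>R ind (B_ivl i t)"
proof -
  have "copy i (ind (D_ivl t)) = 2 *\<^sub>R ind (B_ivl i t)"
    using D_ivl_subset[of t] by (intro copy_ind mem_B_ivl_iff) auto
  then show ?thesis
    by (simp add: atom_def bounded_linear.linear[OF bounded_linear_copy, THEN linear_scale])
qed

text \<open>
  The generators of \<open>Y\<close> are the images of the normalised dyadic indicators.
\<close>

lemma spread_atom: "spread (atom t) = h_L1 t"
proof -
  let ?B = "\<Union>i. B_ivl (Suc i) t"
  have m: "?B \<in> sets lebesgue" by auto
  have "disjoint_family (\<lambda>i. B_ivl (Suc i) t)"
    using B_disjoint by (fastforce simp: disjoint_family_on_def)
  then have "(\<lambda>i. ind (B_ivl (Suc i) t)) sums ind ?B"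
    by (intro ind_UN_sums) auto
  then have "(\<lambda>i. copy (Suc i) (atom t)) sums (2 ^ (length t + 1) *\<^sub>R ind ?B)"
    unfolding copy_atom by (rule sums_scaleR_right)
  then have "spread (atom t) = 2 ^ (length t + 1) *\<^sub>R ind ?B"
    by (simp add: spread_def sums_iff)
  also have "\<dots> = abs_L1 (\<lambda>x. 2 ^ (length t + 1) * indicator ?B x)"
    using m by (simp only: ind_eq_abs_L1 abs_L1_scaleR integrable_indicator_leb01)
  also have "\<dots> = h_L1 t"
    by (simp only: h_L1_def map_fun_apply id_apply h_fun_def[abs_def] sum_indicator_B)
  finally show ?thesis .
qed

definition supp :: "bool list \<Rightarrow> real set" where
  "supp t = C_ivl (length t) t \<union> (\<Union>i\<in>{1..length t}. B_ivl i t)"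

lemma supp_measurable [simp]: "supp t \<in> sets lebesgue"
  unfolding supp_def by (intro sets.Un sets.finite_UN) auto

lemma C_subset: "C_ivl n t \<subseteq> {1 / 2 + 1 / 2 ^ (n + 1)..<1 / 2 + 1 / 2 ^ n}"
  unfolding C_ivl_def by (rule dyadic_subset) (intro add_left_mono divide_left_mono power_increasing; simp)

lemma blk_subset: "i \<ge> 1 \<Longrightarrow> blk i \<subseteq> {0..<1/2}"
proof -
  assume "i \<ge> 1"
  then have "(1::real) / 2 ^ i \<le> 1 / 2 ^ 1"
    by (intro divide_left_mono power_increasing) auto
  moreover have "0 \<le> 1 / (2::real) ^ (i + 1)"
    by simp
  ultimately show ?thesis
    unfolding blk_def by auto
qed

lemma B_subset_blk: "B_ivl i t \<subseteq> blk i"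
  using B_subset by (simp add: blk_def)

lemma C_subset_half: "C_ivl n t \<subseteq> {1/2..<1}" if "n \<ge> 1"
proof -
  have "(1::real) / 2 ^ n \<le> 1 / 2 ^ 1"
    using that by (intro divide_left_mono power_increasing) auto
  then have n: "(1::real) / 2 ^ n \<le> 1 / 2"
    by simp
  have pos: "0 \<le> 1 / (2::real) ^ (n + 1)"
    by simp
  show ?thesis
  proof
    fix x assume "x \<in> C_ivl n t"
    then have "1 / 2 + 1 / 2 ^ (n + 1) \<le> x" "x < 1 / 2 + 1 / 2 ^ n"
      using C_subset[of n t] unfolding subset_iff atLeastLessThan_iff by blast+
    with n pos have "1 / 2 \<le> x" "x < 1"
      by linarith+
    then show "x \<in> {1 / 2..<1}"
      by simp
  qed
qed

lemma C_Int_blk: "n \<ge> 1 \<Longrightarrow> i \<ge> 1 \<Longrightarrow> C_ivl n t \<inter> blk i = {}"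
  using C_subset_half[of n t] blk_subset[of i]
  by (meson disjoint_iff atLeastLessThan_iff not_less subsetD)

lemma C_disjoint:
  assumes "s \<noteq> t"
  shows "C_ivl (length s) s \<inter> C_ivl (length t) t = {}"
proof (cases "length s = length t")
  case True
  then show ?thesis
    using D_ivl_unique[of _ s t] assms by (auto simp: mem_C_ivl_iff)
next
  case False
  have "C_ivl m s \<inter> C_ivl n t = {}" if "m < n" for m n s t
  proof -
    have "(1::real) / 2 ^ n \<le> 1 / 2 ^ (m + 1)"
      using that by (intro divide_left_mono power_increasing) auto
    then show ?thesis
      using C_subset[of m s] C_subset[of n t] by fastforce
  qed
  with False show ?thesis
    by (metis inf_commute linorder_neqE_nat)
qed

lemma disjoint_B_ivl: "disjoint_family_on (\<lambda>i. B_ivl i t) I"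
  unfolding disjoint_family_on_def using B_disjoint by blast

lemma C_Int_UN_B:
  assumes "t \<noteq> []"
  shows "C_ivl (length t) t \<inter> (\<Union>i\<in>{1..length t}. B_ivl i t) = {}"
proof -
  have "length t \<ge> 1"
    using assms by (simp add: Suc_le_eq)
  then have "C_ivl (length t) t \<inter> B_ivl i t = {}" if "i \<ge> 1" for i
    using C_Int_blk[OF _ that, of "length t" t] B_subset_blk[of i t] by blast
  then show ?thesis
    unfolding Int_UN_distrib by simp
qed

lemma ind_supp:
  assumes "t \<noteq> []"
  shows "ind (supp t) = ind (C_ivl (length t) t) + (\<Sum>i\<in>{1..length t}. ind (B_ivl i t))"
proof -
  have "C_ivl (length t) t \<inter> (\<Union>i\<in>{1..length t}. B_ivl i t) = {}"
    by (rule C_Int_UN_B[OF assms])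
  then have "restr (supp t) (ind UNIV) = restr (C_ivl (length t) t) (ind UNIV)
      + restr (\<Union>i\<in>{1..length t}. B_ivl i t) (ind UNIV)"
    unfolding supp_def by (intro restr_Un) auto
  moreover have "ind (\<Union>i\<in>{1..length t}. B_ivl i t) = (\<Sum>i\<in>{1..length t}. ind (B_ivl i t))"
    by (intro ind_UN disjoint_B_ivl) auto
  moreover have "(\<Union>i\<in>{1..length t}. B_ivl i t) \<in> sets lebesgue"
    by (intro sets.finite_UN) auto
  ultimately show ?thesis
    by (simp add: restr_ind)
qed

lemma f_L1_eq_supp:
  assumes "t \<noteq> []"
  shows "f_L1 t = 2 ^ (length t + 1) *\<^sub>R ind (supp t)"
proof -
  have "C_ivl (length t) t \<inter> (\<Union>i\<in>{1..length t}. B_ivl i t) = {}"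
    by (rule C_Int_UN_B[OF assms])
  moreover have "indicator (\<Union>i\<in>{1..length t}. B_ivl i t) x = (\<Sum>i = 1..length t. indicator (B_ivl i t) x :: real)" for x
    by (intro indicator_UN_disjoint disjoint_B_ivl) simp
  ultimately have "f_fun t = (\<lambda>x. 2 ^ (length t + 1) * indicator (supp t) x)"
    unfolding f_fun_def supp_def by (simp only: indicator_add[symmetric])
  then show ?thesis
    using supp_measurable[of t]
    by (simp only: f_L1_def map_fun_apply id_apply ind_eq_abs_L1 abs_L1_scaleR integrable_indicator_leb01)
qed

text \<open>
  The generator \<open>f_L1 t\<close> is \<open>h_L1 t\<close> cut off after block \<open>length t\<close>, plus a marker that belongs to \<open>t\<close>
  alone.
\<close>

lemma f_L1_eq:
  assumes "t \<noteq> []"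
  shows "f_L1 t = 2 ^ (length t + 1) *\<^sub>R ind (C_ivl (length t) t) + (\<Sum>i\<in>{1..length t}. copy i (atom t))"
  by (simp add: f_L1_eq_supp ind_supp assms copy_atom scaleR_add_right scaleR_sum_right)

section \<open>The spaces $X$ and $Y$\<close>

lemma measure_C_ivl:
  assumes "t \<noteq> []"
  shows "measure lebesgue (C_ivl (length t) t \<inter> {0..1}) = 1 / (2 * 4 ^ length t)"
proof -
  obtain p where p: "D_ivl t = {p..<p + 1 / 2 ^ length t}"
    using D_ivl_eq[of t] by blast
  have "- 1 + e * (x - 1 / 2) \<in> {p..<p + w} \<longleftrightarrow> x \<in> {1 / 2 + (1 + p) / e..<1 / 2 + (1 + p) / e + w / e}"
    if "e > 0" for e x w :: real
    using that by (auto simp: field_simps)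
  then have "C_ivl (length t) t = {1 / 2 + (1 + p) / 2 ^ (length t + 1)..<1 / 2 + (1 + p) / 2 ^ (length t + 1) + (1 / 2 ^ length t) / 2 ^ (length t + 1)}"
    unfolding set_eq_iff mem_C_ivl_iff p by (metis zero_less_numeral zero_less_power)
  then have "measure lebesgue (C_ivl (length t) t) = (1 / 2 ^ length t) / 2 ^ (length t + 1)"
    by simp
  also have "\<dots> = 1 / (2 * (2 * 2) ^ length t)"
    unfolding power_mult_distrib by simp
  moreover have "C_ivl (length t) t \<inter> {0..1} = C_ivl (length t) t"
    using C_subset_half[of "length t" t] assms by (force simp: Suc_le_eq)
  ultimately show ?thesis
    by simp
qed

lemma linear_pull: "linear (pull i)"
  using bounded_linear_pull by (rule bounded_linear.linear)

lemma integ_sum: "integ (\<Sum>i\<in>I. f i) = (\<Sum>i\<in>I. integ (f i))"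
  by (rule linear_sum) (intro linearI; simp add: integ_add integ_scaleR)

lemma sum_half_powers: "(\<Sum>i\<in>{1..n}. 1 / 2 ^ i) = 1 - 1 / (2::real) ^ n"
  by (induction n) (simp_all add: field_simps)

lemma power_2_4: "(2::real) ^ (n + 1) * (1 / (2 * 4 ^ n)) = 1 / 2 ^ n"
proof -
  have "(4::real) ^ n = 2 ^ n * 2 ^ n"
    by (simp add: power_mult_distrib[symmetric])
  then show ?thesis by simp
qed

lemma integ_f_L1: "t \<noteq> [] \<Longrightarrow> integ (f_L1 t) = 1"
  by (simp add: f_L1_eq integ_add integ_scaleR integ_ind measure_C_ivl integ_sum integ_copy integ_atom
    sum_half_powers[simplified] power_2_4[simplified])

lemma norm_f_L1:
  assumes "t \<noteq> []"
  shows "norm (f_L1 t) = 1"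
proof -
  have "norm (f_L1 t) = integ (f_L1 t)"
    using assms by (simp add: f_L1_eq_supp integ_scaleR norm_ind integ_ind)
  then show ?thesis
    using assms by (simp add: integ_f_L1)
qed

text \<open>
  The marker and the blocks that were cut off contribute \<open>2^-n\<close> each, where \<open>n = length t\<close>.
\<close>

lemma norm_f_L1_diff_h_L1:
  assumes "t \<noteq> []"
  shows "norm (f_L1 t - h_L1 t) \<le> 2 / 2 ^ length t"
proof -
  define n where "n = length t"
  have "h_L1 t = (\<Sum>i. copy (Suc (i + n)) (atom t)) + (\<Sum>i<n. copy (Suc i) (atom t))"
    unfolding spread_atom[symmetric] spread_def
    using suminf_split_initial_segment[OF summable_copy, of _ n] by simp
  moreover have "(\<Sum>i<n. copy (Suc i) (atom t)) = (\<Sum>i\<in>{1..n}. copy i (atom t))"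
    by (rule sum.reindex_bij_witness[of _ "\<lambda>i. i - 1" Suc]) auto
  ultimately have "f_L1 t - h_L1 t
      = 2 ^ (n + 1) *\<^sub>R ind (C_ivl n t) - (\<Sum>i. copy (Suc (i + n)) (atom t))"
    using assms by (simp add: f_L1_eq n_def)
  moreover have "norm (2 ^ (n + 1) *\<^sub>R ind (C_ivl n t)) = 1 / 2 ^ n"
    using assms power_2_4[of n] by (simp add: norm_ind n_def measure_C_ivl)
  moreover have "norm (\<Sum>i. copy (Suc (i + n)) (atom t)) \<le> 1 / 2 ^ n"
  proof -
    have s: "(\<lambda>i. norm (copy (Suc (i + n)) (atom t))) sums (1 / 2 ^ n)"
      using half_sums[of 1 n] by (simp add: norm_copy norm_atom)
    from summable_norm[OF sums_summable[OF s]] show ?thesis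
      using s by (simp add: sums_iff)
  qed
  ultimately show ?thesis
    using norm_triangle_ineq4[of "2 ^ (n + 1) *\<^sub>R ind (C_ivl n t)" "\<Sum>i. copy (Suc (i + n)) (atom t)"]
    by (simp add: n_def)
qed

lemma subspace_closure:
  fixes S :: "'a::real_normed_vector set"
  assumes "subspace S"
  shows "subspace (closure S)"
proof (rule subspaceI)
  show "0 \<in> closure S"
    using subspace_0[OF assms] closure_subset by blast
next
  fix x y assume "x \<in> closure S" "y \<in> closure S"
  then obtain f g where "\<forall>n. f n \<in> S" "f \<longlonglongrightarrow> x" "\<forall>n. g n \<in> S" "g \<longlonglongrightarrow> y"
    unfolding closure_sequential by blast
  then have "\<forall>n. f n + g n \<in> S" "(\<lambda>n. f n + g n) \<longlonglongrightarrow> x + y"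
    using assms by (auto intro: subspace_add tendsto_add)
  then show "x + y \<in> closure S"
    unfolding closure_sequential by (intro exI[of _ "\<lambda>n. f n + g n"]) simp
next
  fix c :: real and x assume "x \<in> closure S"
  then obtain f where "\<forall>n. f n \<in> S" "f \<longlonglongrightarrow> x"
    unfolding closure_sequential by blast
  then have "\<forall>n. c *\<^sub>R f n \<in> S" "(\<lambda>n. c *\<^sub>R f n) \<longlonglongrightarrow> c *\<^sub>R x"
    using assms by (auto intro: subspace_scale tendsto_scaleR)
  then show "c *\<^sub>R x \<in> closure S"
    unfolding closure_sequential by (intro exI[of _ "\<lambda>n. c *\<^sub>R f n"]) simp
qed

lemma closed_X: "closed X_space" and subspace_X: "subspace X_space"
  and closed_Y: "closed Y_space" and subspace_Y: "subspace Y_space"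
  by (simp_all add: X_space_def Y_space_def subspace_closure subspace_span)

lemma f_in_X: "t \<noteq> [] \<Longrightarrow> f_L1 t \<in> X_space"
  unfolding X_space_def T_tree_def by (rule subsetD[OF closure_subset]) (auto intro: span_base)

lemma h_L1_split: "h_L1 t = (1/2) *\<^sub>R (h_L1 (t @ [False]) + h_L1 (t @ [True]))"
  by (metis spread_atom atom_split spread_add spread_scaleR)

text \<open>
  Splitting \<open>h_L1 t\<close> into its two halves \<open>k\<close> times writes it as an average of \<open>h_L1 s\<close> with longer \<open>s\<close>,
  each of which is close to \<open>f_L1 s\<close>.
\<close>

lemma h_L1_near_span:
  "t \<noteq> [] \<Longrightarrow> \<exists>x\<in>span (f_L1 ` T_tree). norm (h_L1 t - x) \<le> 2 / 2 ^ (length t + k)"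
proof (induction k arbitrary: t)
  case 0
  then have "f_L1 t \<in> span (f_L1 ` T_tree)"
    by (auto simp: T_tree_def intro: span_base)
  then show ?case
    using norm_f_L1_diff_h_L1[OF 0] by (auto simp: norm_minus_commute)
next
  case (Suc k)
  have "\<exists>x\<in>span (f_L1 ` T_tree). norm (h_L1 (t @ [b]) - x) \<le> 2 / 2 ^ (length t + Suc k)" for b
    using Suc.IH[of "t @ [b]"] by simp
  then obtain x where x: "x b \<in> span (f_L1 ` T_tree)"
    "norm (h_L1 (t @ [b]) - x b) \<le> 2 / 2 ^ (length t + Suc k)" for b
    by metis
  let ?x = "(1/2) *\<^sub>R (x False + x True)"
  have "h_L1 t - ?x = (1/2) *\<^sub>R ((h_L1 (t @ [False]) - x False) + (h_L1 (t @ [True]) - x True))"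
    by (subst h_L1_split) (simp add: algebra_simps)
  moreover have "norm ((h_L1 (t @ [False]) - x False) + (h_L1 (t @ [True]) - x True))
      \<le> 2 * (2 / 2 ^ (length t + Suc k))"
    using x(2)[of False] x(2)[of True]
      norm_triangle_ineq[of "h_L1 (t @ [False]) - x False" "h_L1 (t @ [True]) - x True"]
    by linarith
  ultimately have "norm (h_L1 t - ?x) \<le> 2 / 2 ^ (length t + Suc k)"
    by simp
  moreover have "?x \<in> span (f_L1 ` T_tree)"
    using x(1) by (intro span_scale span_add)
  ultimately show ?case by blast
qed

lemma h_in_X:
  assumes "t \<noteq> []"
  shows "h_L1 t \<in> X_space"
  unfolding X_space_def closure_approachable
proof (intro allI impI)
  fix e :: real assume "e > 0"
  have "(\<lambda>k. (2 / 2 ^ length t) * (1 / 2 :: real) ^ k) \<longlonglongrightarrow> 0"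
    by (rule half_power_tendsto)
  then have "\<forall>\<^sub>F k in sequentially. (2 / 2 ^ length t) * (1 / 2 :: real) ^ k < e"
    using \<open>e > 0\<close> by (rule order_tendstoD)
  then obtain k where "(2 / 2 ^ length t) * (1 / 2 :: real) ^ k < e"
    by (meson eventually_happens sequentially_bot)
  then have k: "2 / 2 ^ (length t + k) < e"
    by (simp add: power_add power_divide)
  obtain x where "x \<in> span (f_L1 ` T_tree)" "norm (h_L1 t - x) \<le> 2 / 2 ^ (length t + k)"
    using h_L1_near_span[OF assms, of k] by blast
  with k show "\<exists>y\<in>span (f_L1 ` T_tree). dist y (h_L1 t) < e"
    unfolding dist_norm norm_minus_commute[of _ "h_L1 t"] by (intro bexI[of _ x]) linarith+
qed

lemma Y_subset_X: "Y_space \<subseteq> X_space"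
  unfolding Y_space_def
  by (intro closure_minimal span_minimal closed_X subspace_X) (auto simp: T_tree_def h_in_X)

text \<open>
  The range of an isometry on a complete space is closed, and it contains the generators.
  Conversely, a dyadic average is a combination of atoms, so its image lies in the span.
\<close>

lemma Y_eq_range_spread: "Y_space = range spread"
proof
  have "subspace (range spread)"
    using linear_subspace_image[OF linear_spread subspace_UNIV] .
  moreover have "complete (range spread)"
    by (rule complete_isometric_image[of 1])
      (auto simp: norm_spread bounded_linear_spread complete_UNIV)
  then have "closed (range spread)"
    by (rule complete_imp_closed)
  ultimately show "Y_space \<subseteq> range spread"
    unfolding Y_space_def
    by (intro closure_minimal span_minimal) (auto simp: spread_atom[symmetric])
next
  show "range spread \<subseteq> Y_space"
  proof safe
    fix u
    have "(\<lambda>n. spread (dyadic_avg (Suc n) u)) \<longlonglongrightarrow> spread u"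
      by (rule bounded_linear.tendsto[OF bounded_linear_spread LIMSEQ_Suc[OF dyadic_avg_tendsto]])
    moreover have "spread (dyadic_avg (Suc n) u) \<in> span (h_L1 ` T_tree)" for n
      unfolding dyadic_avg_def linear_sum[OF linear_spread] spread_scaleR spread_atom
      by (intro span_sum span_scale span_base) (auto simp: T_tree_def level_def)
    ultimately show "spread u \<in> Y_space"
      unfolding Y_space_def closure_sequential
      by (intro exI[of _ "\<lambda>n. spread (dyadic_avg (Suc n) u)"]) simp
  qed
qed

lemma Y_isometric_L1: "isometrically_isomorphic Y_space (UNIV :: L1 set)"
  unfolding isometrically_isomorphic_def
proof (intro exI[of _ "pull 1"] conjI ballI allI)
  show "bij_betw (pull 1) Y_space (UNIV :: L1 set)"
    unfolding Y_eq_range_spread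
    by (rule bij_betw_byWitness[where f' = spread]) (use pull_spread[of 0] in auto)
qed (use pull_spread[of 0] in \<open>auto simp: Y_eq_range_spread norm_spread linear_add[OF linear_pull] linear_scale[OF linear_pull]\<close>)

text \<open>
  On the span of the generators this is the coefficient of \<open>f_L1 t\<close>; see \<open>f_coord_f_L1\<close>.
\<close>

definition f_coord :: "bool list \<Rightarrow> L1 \<Rightarrow> real" where
  "f_coord t x = 2 ^ length t * integ (restr (C_ivl (length t) t) x)"

lemma bounded_linear_f_coord: "bounded_linear (f_coord t)"
  unfolding f_coord_def
  by (intro bounded_linear_const_mult bounded_linear_compose[OF bounded_linear_integ bounded_linear_restr])

text \<open>
  Continuous linear identities need to be checked on the generators only.  All structural
  facts about \<open>X\<close> below are obtained in this way.
\<close>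

lemma X_linear_eq:
  assumes "bounded_linear L" "bounded_linear M" "\<And>t. t \<noteq> [] \<Longrightarrow> L (f_L1 t) = M (f_L1 t)" "x \<in> X_space"
  shows "L x = M x"
proof -
  have "closed {x. L x = M x}"
    using assms(1,2) by (intro closed_Collect_eq linear_continuous_on)
  moreover have "subspace {x. L x = M x}"
    using assms(1,2)[THEN bounded_linear.linear]
    by (intro subspaceI) (simp_all add: linear_0 linear_add linear_scale)
  then have "span (f_L1 ` T_tree) \<subseteq> {x. L x = M x}"
    using assms(3) by (intro span_minimal) (auto simp: T_tree_def)
  ultimately have "X_space \<subseteq> {x. L x = M x}"
    unfolding X_space_def by (intro closure_minimal)
  then show ?thesis
    using assms(4) by blast
qed

lemma restr_C_f_L1:
  assumes "s \<noteq> []" "t \<noteq> []"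
  shows "restr (C_ivl (length s) s) (f_L1 t)
    = (if s = t then 2 ^ (length t + 1) *\<^sub>R ind (C_ivl (length t) t) else 0)"
proof (cases "s = t")
  case True
  then have "C_ivl (length s) s \<inter> supp t = C_ivl (length t) t"
    by (auto simp: supp_def)
  with True assms show ?thesis
    by (simp add: f_L1_eq_supp restr_scaleR restr_ind)
next
  case False
  have "C_ivl (length s) s \<inter> blk i = {}" if "i \<in> {1..length t}" for i
    using that assms by (intro C_Int_blk) (auto simp: Suc_le_eq)
  then have "C_ivl (length s) s \<inter> supp t = {}"
    using C_disjoint[OF False] B_subset_blk[of _ t] unfolding supp_def by blast
  then show ?thesis
    using False assms by (simp add: f_L1_eq_supp restr_scaleR restr_ind)
qed

lemma f_coord_f_L1:
  assumes "s \<noteq> []" "t \<noteq> []"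
  shows "f_coord s (f_L1 t) = (if s = t then 1 else 0)"
  using assms power_2_4[of "length t"]
  by (simp add: f_coord_def restr_C_f_L1 integ_scaleR integ_ind measure_C_ivl
    bounded_linear.linear[OF bounded_linear_integ, THEN linear_0])

lemma pull_f_L1:
  assumes "t \<noteq> []" "i \<ge> 1"
  shows "pull i (f_L1 t) = (if i \<le> length t then atom t else 0)"
proof -
  have "blk i \<inter> C_ivl (length t) t = {}"
    using C_Int_blk[of "length t" i t] assms by (auto simp: Suc_le_eq)
  then have "norm (pull i (ind (C_ivl (length t) t))) = 0"
    by (simp add: norm_pull restr_ind)
  then have "pull i (f_L1 t) = (\<Sum>j\<in>{1..length t}. if i = j then atom t else 0)"
    using assms(1)
    by (simp add: f_L1_eq linear_add[OF linear_pull] linear_scale[OF linear_pull] linear_sum[OF linear_pull] pull_copy)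
  then show ?thesis
    using assms by simp
qed

text \<open>
  A generator of length \<open>n\<close> occupies exactly the blocks \<open>1, \<dots>, n\<close>, so from block \<open>i\<close> to the next
  one precisely the generators of length \<open>i\<close> disappear.
\<close>

lemma X_block_relation:
  assumes "x \<in> X_space" "i \<ge> 1"
  shows "pull i x - pull (Suc i) x = (\<Sum>s\<in>level i. f_coord s x *\<^sub>R atom s)"
proof (rule X_linear_eq[OF _ _ _ assms(1)])
  show "bounded_linear (\<lambda>x. pull i x - pull (Suc i) x)"
    by (intro bounded_linear_sub bounded_linear_pull)
  show "bounded_linear (\<lambda>x. \<Sum>s\<in>level i. f_coord s x *\<^sub>R atom s)"
    by (intro bounded_linear_sum bounded_linear_scaleR_const bounded_linear_f_coord)
next
  fix t :: "bool list" assume t: "t \<noteq> []"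
  have "(\<Sum>s\<in>level i. f_coord s (f_L1 t) *\<^sub>R atom s) = (\<Sum>s\<in>level i. if s = t then atom t else 0)"
  proof (intro sum.cong refl)
    fix s assume "s \<in> level i"
    then have "s \<noteq> []"
      using assms(2) by (auto simp: level_def)
    with t show "f_coord s (f_L1 t) *\<^sub>R atom s = (if s = t then atom t else 0)"
      by (simp add: f_coord_f_L1)
  qed
  also have "\<dots> = (if t \<in> level i then atom t else 0)"
    by simp
  also have "\<dots> = (if length t = i then atom t else 0)"
    by (simp add: level_def)
  finally show "pull i (f_L1 t) - pull (Suc i) (f_L1 t) = (\<Sum>s\<in>level i. f_coord s (f_L1 t) *\<^sub>R atom s)"
    using t assms(2) by (auto simp: pull_f_L1)
qed

lemma X_restr_C:
  assumes "x \<in> X_space" "s \<noteq> []"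
  shows "restr (C_ivl (length s) s) x = f_coord s x *\<^sub>R 2 ^ (length s + 1) *\<^sub>R ind (C_ivl (length s) s)"
proof (rule X_linear_eq[OF bounded_linear_restr _ _ assms(1)])
  show "bounded_linear (\<lambda>x. f_coord s x *\<^sub>R 2 ^ (length s + 1) *\<^sub>R ind (C_ivl (length s) s))"
    by (intro bounded_linear_scaleR_const bounded_linear_f_coord)
qed (simp add: assms(2) restr_C_f_L1 f_coord_f_L1)

lemma norm_restr_mono:
  assumes "A \<in> sets lebesgue" "B \<in> sets lebesgue" "A \<subseteq> B"
  shows "norm (restr A x) \<le> norm (restr B x)"
proof -
  have "restr A x = restr A (restr B x)"
    using assms by (simp add: restr_restr Int_absorb2)
  then show ?thesis
    using norm_restr_le[of A "restr B x"] by simp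
qed

lemma Compl_supp_measurable [simp]: "- supp t \<in> sets lebesgue"
  using sets.compl_sets[OF supp_measurable[of t]] by (simp add: Compl_eq_Diff_UNIV)

text \<open>
  If \<open>y\<close> has no component along \<open>f_L1 t\<close>, its norm is controlled by its mass off the support of
  \<open>f_L1 t\<close>.  That support misses block \<open>n + 1\<close> and the markers of all \<open>s \<noteq> t\<close>; these bound the function
  on block \<open>n + 1\<close> and all remaining coefficients of length at most \<open>n\<close>, and the block relation carries the bound
  down to the blocks \<open>n, \<dots>, 1\<close>.
\<close>

lemma f_coord_0_norm_le:
  assumes y: "y \<in> X_space" "f_coord t y = 0" and t: "t \<noteq> []"
  shows "norm y \<le> (3 * 2 ^ length t + 1) * norm (restr (- supp t) y)"
proof -
  define n where "n = length t"
  define R where "R = norm (restr (- supp t) y)"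
  define I where "I = (\<Union>j\<in>{1..n}. level j)"
  \<comment> \<open>The coefficient of \<open>t\<close> itself vanishes; its marker is the only one inside the support.\<close>
  define w where "w s = (if s = t then 0 else norm (restr (C_ivl (length s) s) y))" for s
  have "n \<ge> 1"
    using t by (simp add: n_def Suc_le_eq)
  have "R \<ge> 0" by (simp add: R_def)
  have finI: "finite I" by (simp add: I_def)
  have w: "\<bar>f_coord s y\<bar> \<le> 2 ^ n * w s" if "s \<in> I" for s
  proof (cases "s = t")
    case False
    have "\<bar>f_coord s y\<bar> \<le> 2 ^ length s * w s"
      using False by (simp add: f_coord_def w_def abs_mult abs_integ_le)
    also have "\<dots> \<le> 2 ^ n * w s"
      using that by (intro mult_right_mono power_increasing) (auto simp: I_def level_def w_def)
    finally show ?thesis .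
  qed (simp add: y w_def)
  have sum_w: "(\<Sum>s\<in>I. w s) \<le> R"
  proof -
    have "(\<Sum>s\<in>I. w s) = (\<Sum>s\<in>I - {t}. norm (restr (C_ivl (length s) s) y))"
      using finI by (intro sum.mono_neutral_cong_right) (auto simp: w_def)
    also have "\<dots> = norm (restr (\<Union>s\<in>I - {t}. C_ivl (length s) s) y)"
      using finI C_disjoint by (intro norm_restr_UN[symmetric]) (auto simp: disjoint_family_on_def)
    also have "\<dots> \<le> R"
      unfolding R_def
    proof (rule norm_restr_mono)
      show "(\<Union>s\<in>I - {t}. C_ivl (length s) s) \<in> sets lebesgue"
        using finI by (intro sets.finite_UN) auto
      have "C_ivl (length s) s \<inter> supp t = {}" if "s \<in> I - {t}" for s
      proof -
        have "s \<noteq> t" "length s \<ge> 1"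
          using that by (auto simp: I_def level_def)
        then have "C_ivl (length s) s \<inter> B_ivl i t = {}" if "i \<ge> 1" for i
          using C_Int_blk[of "length s" i s] B_subset_blk[of i t] that by blast
        then show ?thesis
          using C_disjoint[OF \<open>s \<noteq> t\<close>] unfolding supp_def by fastforce
      qed
      then show "(\<Union>s\<in>I - {t}. C_ivl (length s) s) \<subseteq> - supp t" by blast
    qed simp
    finally show ?thesis .
  qed
  \<comment> \<open>Block \<open>n + 1\<close> lies off the support, and \<open>pull\<close> magnifies it by \<open>2^(n+1)\<close>.\<close>
  have tail: "norm (pull (Suc n) y) \<le> 2 ^ Suc n * R"
  proof -
    have "blk (Suc n) \<inter> supp t = {}"
    proof -
      have "blk (Suc n) \<inter> blk i = {}" if "i \<in> {1..n}" for i
        using disjoint_blk[of UNIV] that by (auto simp: disjoint_family_on_def)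
      then have "blk (Suc n) \<inter> B_ivl i t = {}" if "i \<in> {1..n}" for i
        using that B_subset_blk[of i t] by blast
      moreover have "blk (Suc n) \<inter> C_ivl n t = {}"
        using C_Int_blk[of n "Suc n" t] \<open>n \<ge> 1\<close> by auto
      ultimately show ?thesis
        unfolding supp_def n_def by blast
    qed
    then have "norm (restr (blk (Suc n)) y) \<le> R"
      unfolding R_def by (intro norm_restr_mono) auto
    then show ?thesis
      by (simp add: norm_pull)
  qed
  \<comment> \<open>Downward induction from block \<open>n + 1\<close>, one block relation per step.\<close>
  have block: "norm (pull i y) \<le> norm (pull (Suc n) y) + (\<Sum>j\<in>{i..n}. \<Sum>s\<in>level j. \<bar>f_coord s y\<bar>)"
    if "i \<le> Suc n" "i \<ge> 1" for i
    using that
  proof (induction rule: inc_induct)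
    case (step i)
    have "pull i y = pull (Suc i) y + (\<Sum>s\<in>level i. f_coord s y *\<^sub>R atom s)"
      using X_block_relation[OF y(1), of i] step by (simp add: algebra_simps)
    then have "norm (pull i y) \<le> norm (pull (Suc i) y) + norm (\<Sum>s\<in>level i. f_coord s y *\<^sub>R atom s)"
      by (simp add: norm_triangle_ineq)
    moreover have "norm (\<Sum>s\<in>level i. f_coord s y *\<^sub>R atom s) \<le> (\<Sum>s\<in>level i. \<bar>f_coord s y\<bar>)"
      by (rule order_trans[OF norm_sum]) (simp add: norm_atom)
    moreover have "(\<Sum>j\<in>{i..n}. \<Sum>s\<in>level j. \<bar>f_coord s y\<bar>)
        = (\<Sum>s\<in>level i. \<bar>f_coord s y\<bar>) + (\<Sum>j\<in>{Suc i..n}. \<Sum>s\<in>level j. \<bar>f_coord s y\<bar>)"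
      using step by (intro sum.atLeast_Suc_atMost) auto
    ultimately show ?case
      using step by simp
  qed simp
  have pull_le: "norm (pull i y) \<le> 3 * 2 ^ n * R" if "i \<in> {1..n}" for i
  proof -
    have "(\<Sum>j\<in>{i..n}. \<Sum>s\<in>level j. \<bar>f_coord s y\<bar>) \<le> (\<Sum>j\<in>{1..n}. \<Sum>s\<in>level j. \<bar>f_coord s y\<bar>)"
      using that by (intro sum_mono2) (auto intro: sum_nonneg)
    also have "\<dots> = (\<Sum>s\<in>I. \<bar>f_coord s y\<bar>)"
    proof -
      have "level i \<inter> level j = {}" if "i \<noteq> j" for i j
        using that by (auto simp: level_def)
      then show ?thesis
        unfolding I_def by (subst sum.UNION_disjoint) auto
    qed
    also have "\<dots> \<le> (\<Sum>s\<in>I. 2 ^ n * w s)"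
      using w by (rule sum_mono)
    also have "\<dots> \<le> 2 ^ n * R"
      using sum_w by (simp add: sum_distrib_left[symmetric])
    finally show ?thesis
      using block[of i] tail that by simp
  qed
  have "norm (restr (supp t) y) \<le> norm (restr (C_ivl n t) y) + norm (restr (\<Union>i\<in>{1..n}. B_ivl i t) y)"
  proof -
    have "restr (supp t) y = restr (C_ivl n t) y + restr (\<Union>i\<in>{1..n}. B_ivl i t) y"
      unfolding supp_def n_def by (intro restr_Un C_Int_UN_B t sets.finite_UN) auto
    then show ?thesis
      by (simp add: norm_triangle_ineq)
  qed
  also have "restr (C_ivl n t) y = 0"
    using X_restr_C[OF y(1) t] y(2) by (simp add: n_def)
  also have "norm (restr (\<Union>i\<in>{1..n}. B_ivl i t) y) = (\<Sum>i\<in>{1..n}. norm (restr (B_ivl i t) y))"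
    by (intro norm_restr_UN disjoint_B_ivl) auto
  also have "\<dots> \<le> (\<Sum>i\<in>{1..n}. (1 / 2 ^ i) * (3 * 2 ^ n * R))"
  proof (rule sum_mono)
    fix i assume i: "i \<in> {1..n}"
    have "norm (restr (B_ivl i t) y) \<le> norm (restr (blk i) y)"
      by (intro norm_restr_mono B_subset_blk) auto
    also have "\<dots> = (1 / 2 ^ i) * norm (pull i y)"
      by (simp add: norm_pull)
    also have "\<dots> \<le> (1 / 2 ^ i) * (3 * 2 ^ n * R)"
      using pull_le[OF i] by (intro mult_left_mono) auto
    finally show "norm (restr (B_ivl i t) y) \<le> (1 / 2 ^ i) * (3 * 2 ^ n * R)" .
  qed
  also have "\<dots> = (1 - 1 / 2 ^ n) * (3 * 2 ^ n * R)"
    unfolding sum_distrib_right[symmetric] sum_half_powers ..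
  also have "\<dots> \<le> 1 * (3 * 2 ^ n * R)"
    using \<open>R \<ge> 0\<close> by (intro mult_right_mono) auto
  finally have "norm (restr (supp t) y) \<le> 3 * 2 ^ n * R"
    by simp
  then show ?thesis
    using norm_restr_Compl[OF supp_measurable[of t], of y] by (simp add: R_def n_def algebra_simps)
qed

text \<open>
  Subtracting the component along \<open>f_L1 t\<close> does not change \<open>x\<close> off the support of \<open>f_L1 t\<close>.
\<close>

lemma X_norm_diff_f_L1_le:
  assumes x: "x \<in> X_space" and t: "t \<noteq> []"
  shows "norm (x - f_coord t x *\<^sub>R f_L1 t) \<le> (3 * 2 ^ length t + 1) * norm (restr (- supp t) x)"
proof -
  let ?y = "x - f_coord t x *\<^sub>R f_L1 t"
  have "?y \<in> X_space"
    using x t f_in_X by (intro subspace_diff subspace_scale subspace_X)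
  moreover have "f_coord t ?y = 0"
    using bounded_linear.linear[OF bounded_linear_f_coord[of t]] t
    by (simp add: linear_diff linear_scale f_coord_f_L1)
  moreover have "restr (- supp t) (f_L1 t) = 0"
  proof -
    show ?thesis
      using t by (simp add: f_L1_eq_supp restr_scaleR restr_ind)
  qed
  then have "restr (- supp t) ?y = restr (- supp t) x"
    by (simp add: restr_diff restr_scaleR)
  ultimately show ?thesis
    using f_coord_0_norm_le[of ?y t] t by simp
qed

section \<open>Weak neighbourhoods\<close>

text \<open>
  Every weak neighbourhood of \<open>u\<close> contains points of the ball of radius \<open>norm u\<close> at distance almost
  \<open>2 * norm u\<close> from \<open>u\<close>.  Two normalised pieces of \<open>u\<close> lie in the same cell if the functionals agree on them
  up to \<open>e\<close>.  The number of cells depends on the functionals and on \<open>e\<close> only, whereas the mass of a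
  single piece tends to 0 as the partition is refined; hence one representative piece per cell
  carries little mass of \<open>u\<close>, although it may replace the whole cell.
\<close>

lemma weak_approximation_at_distance_2:
  assumes F: "finite F" "\<And>\<phi>. \<phi> \<in> F \<Longrightarrow> bounded_linear (\<phi> :: L1 \<Rightarrow> real)" and "e > 0"
  shows "\<exists>v. norm v \<le> norm u \<and> (\<forall>\<phi>\<in>F. \<bar>\<phi> v - \<phi> u\<bar> \<le> e * norm u) \<and> 2 * norm u - e \<le> norm (u - v)"
proof -
  have "\<exists>k. \<forall>x. \<bar>\<phi> x\<bar> \<le> k * norm x" if "\<phi> \<in> F" for \<phi>
    using bounded_linear.bounded[OF F(2)[OF that]] by (auto simp: mult.commute)
  then obtain k where k: "\<And>\<phi> x. \<phi> \<in> F \<Longrightarrow> \<bar>\<phi> x\<bar> \<le> k \<phi> * norm x"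
    by metis
  define K where "K = (\<Sum>\<phi>\<in>F. \<bar>k \<phi>\<bar>)"
  have K: "\<bar>\<phi> x\<bar> \<le> K" if "\<phi> \<in> F" "norm x \<le> 1" for \<phi> x
  proof -
    have "\<bar>\<phi> x\<bar> \<le> \<bar>k \<phi>\<bar> * norm x"
      using k[OF that(1), of x] by (rule order_trans) (simp add: mult_right_mono)
    also have "\<dots> \<le> \<bar>k \<phi>\<bar> * 1"
      using that(2) by (intro mult_left_mono) auto
    also have "\<dots> \<le> K"
      unfolding K_def mult_1_right using F(1) that(1) by (intro member_le_sum) auto
    finally show ?thesis .
  qed
  define M where "M = \<lceil>K / e\<rceil> + 1"
  define cells where "cells = PiE F (\<lambda>_. {-M..M})"
  have fin_cells: "finite cells"
    unfolding cells_def using F(1) by (intro finite_PiE) auto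
  define P where "P = card cells"
  have "e / (2 * (real P + 1)) > 0"
    using \<open>e > 0\<close> by simp
  \<comment> \<open>So fine that \<open>P\<close> pieces together carry mass at most \<open>e / 2\<close>; the summand 1 keeps the denominator positive.\<close>
  from eventually_happens[OF restr_D_ivl_uniformly_small[OF this, of u]]
  obtain n where n: "\<And>t. t \<in> level n \<Longrightarrow> norm (restr (D_ivl t) u) < e / (2 * (real P + 1))"
    by auto
  define S where "S = {s \<in> level n. restr (D_ivl s) u \<noteq> 0}"
  define w where "w s = norm (restr (D_ivl s) u)" for s
  define g where "g s = sgn (restr (D_ivl s) u)" for s
  have S: "finite S" "S \<subseteq> level n"
    by (auto simp: S_def)
  have w_nonneg: "w s \<ge> 0" for s
    by (simp add: w_def)
  have norm_g: "norm (g s) = 1" if "s \<in> S" for s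
    using that by (simp add: g_def S_def norm_sgn)
  have wg: "w s *\<^sub>R g s = restr (D_ivl s) u" for s
    by (cases "restr (D_ivl s) u = 0") (simp_all add: w_def g_def sgn_div_norm)
  have restr_g: "restr (D_ivl s') (g s) = (if s' = s then g s else 0)" if "s \<in> level n" "s' \<in> level n" for s s'
  proof -
    have "D_ivl s' \<inter> D_ivl s = (if s' = s then D_ivl s else {})"
      using D_ivl_unique[of _ s s'] that by (auto simp: level_def)
    then show ?thesis
      by (simp add: g_def sgn_div_norm restr_scaleR restr_restr restr_empty)
  qed
  have u_eq: "u = (\<Sum>s\<in>S. w s *\<^sub>R g s)"
  proof -
    have "(\<Sum>s\<in>S. w s *\<^sub>R g s) = (\<Sum>s\<in>level n. restr (D_ivl s) u)"
      unfolding wg by (rule sum.mono_neutral_left) (auto simp: S_def)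
    then show ?thesis
      by (simp add: sum_restr_level)
  qed
  have norm_u: "norm u = (\<Sum>s\<in>S. w s)"
  proof -
    have "(\<Sum>s\<in>S. w s) = (\<Sum>s\<in>level n. norm (restr (D_ivl s) u))"
      unfolding w_def by (rule sum.mono_neutral_left) (auto simp: S_def)
    then show ?thesis
      by (simp add: sum_norm_restr_level)
  qed
  \<comment> \<open>Pieces in one cell have equal rounded values under all functionals.\<close>
  define cell where "cell s = restrict (\<lambda>\<phi>. \<lfloor>\<phi> (g s) / e\<rfloor>) F" for s
  have cell: "cell s \<in> cells" if "s \<in> S" for s
    unfolding cells_def cell_def
  proof (rule restrict_PiE_iff[THEN iffD2], rule ballI)
    fix \<phi> assume "\<phi> \<in> F"
    then have "\<bar>\<phi> (g s)\<bar> / e \<le> K / e"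
      using norm_g[OF that] K \<open>e > 0\<close> by (intro divide_right_mono) auto
    then have "\<bar>\<phi> (g s) / e\<bar> \<le> K / e"
      using \<open>e > 0\<close> by simp
    then have "\<phi> (g s) / e \<le> K / e" "- (K / e) \<le> \<phi> (g s) / e"
      by linarith+
    then have "- M \<le> \<lfloor>\<phi> (g s) / e\<rfloor>" "\<lfloor>\<phi> (g s) / e\<rfloor> \<le> M"
      unfolding M_def by linarith+
    then show "\<lfloor>\<phi> (g s) / e\<rfloor> \<in> {-M..M}"
      by simp
  qed
  define rep where "rep c = (SOME s. s \<in> S \<and> cell s = c)" for c
  define r where "r s = rep (cell s)" for s
  have r: "r s \<in> S \<and> cell (r s) = cell s" if "s \<in> S" for s
    unfolding r_def rep_def by (rule someI[of _ s]) (use that in simp)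
  have card_r: "card (r ` S) \<le> P"
  proof -
    have "r ` S = rep ` (cell ` S)"
      by (auto simp: r_def)
    then have "card (r ` S) \<le> card (cell ` S)"
      using S(1) by (simp add: card_image_le)
    also have "\<dots> \<le> P"
      unfolding P_def using cell by (intro card_mono fin_cells) auto
    finally show ?thesis .
  qed
  define v where "v = (\<Sum>s\<in>S. w s *\<^sub>R g (r s))"
  define G where "G = (\<Union>s\<in>r ` S. D_ivl s)"
  have rS: "r ` S \<subseteq> level n" "r ` S \<subseteq> S"
    using r S by auto
  have G_meas: "G \<in> sets lebesgue" "- G \<in> sets lebesgue"
  proof -
    show "G \<in> sets lebesgue"
      unfolding G_def using S(1) by (intro sets.finite_UN) auto
    from sets.compl_sets[OF this] show "- G \<in> sets lebesgue"
      by (simp add: Compl_eq_Diff_UNIV)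
  qed
  have v_le: "norm v \<le> norm u"
    unfolding v_def norm_u using r by (intro order_trans[OF norm_sum] sum_mono) (simp add: norm_g w_nonneg)
  have v_ge: "norm u \<le> norm v"
  proof -
    \<comment> \<open>The pieces have disjoint supports, so the masses moved onto a representative just add up.\<close>
    have v_s: "norm (restr (D_ivl s') v) = (\<Sum>s\<in>S. if s' = r s then w s else 0)" if "s' \<in> S" for s'
    proof -
      have "restr (D_ivl s') v = (\<Sum>s\<in>S. (if s' = r s then w s else 0) *\<^sub>R g s')"
        unfolding v_def restr_sum restr_scaleR
        using that r S(2) by (intro sum.cong refl) (auto simp: restr_g subset_eq)
      also have "\<dots> = (\<Sum>s\<in>S. if s' = r s then w s else 0) *\<^sub>R g s'"
        by (simp add: scaleR_sum_left)
      finally show ?thesis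
        using norm_g[OF that] by (simp add: sum_nonneg w_nonneg)
    qed
    have "norm u = (\<Sum>s\<in>S. \<Sum>s'\<in>S. if s' = r s then w s else 0)"
      unfolding norm_u using S(1) r by (intro sum.cong refl) simp
    also have "\<dots> = (\<Sum>s'\<in>S. norm (restr (D_ivl s') v))"
      by (subst sum.swap) (simp add: v_s)
    also have "\<dots> \<le> (\<Sum>s'\<in>level n. norm (restr (D_ivl s') v))"
      using S by (intro sum_mono2) auto
    finally show ?thesis
      by (simp add: sum_norm_restr_level)
  qed
  have restr_v: "restr G v = v"
  proof -
    have "restr G (g (r s)) = g (r s)" if "s \<in> S" for s
    proof -
      have "D_ivl (r s) \<subseteq> G"
        using that by (auto simp: G_def)
      then have "restr G (restr (D_ivl (r s)) (g (r s))) = restr (D_ivl (r s)) (g (r s))"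
        using G_meas by (simp add: restr_restr Int_absorb1)
      then show ?thesis
        using restr_g[of "r s" "r s"] rS that by auto
    qed
    then show ?thesis
      by (simp add: v_def restr_sum restr_scaleR)
  qed
  have "restr (- G) v = restr (- G) (restr G v)"
    by (simp add: restr_v)
  then have restr_v': "restr (- G) v = 0"
    using G_meas by (simp add: restr_disjoint)
  have small: "norm (restr G u) \<le> e / 2"
  proof -
    have "norm (restr G u) = (\<Sum>s\<in>r ` S. norm (restr (D_ivl s) u))"
      unfolding G_def using S(1) disjoint_family_on_mono[OF rS(1) disjoint_D_ivl]
      by (intro norm_restr_UN) auto
    also have "\<dots> \<le> (\<Sum>s\<in>r ` S. e / (2 * (real P + 1)))"
      using n rS(1) by (intro sum_mono) (auto intro: less_imp_le)
    also have "\<dots> = real (card (r ` S)) * (e / (2 * (real P + 1)))"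
      by simp
    also have "\<dots> \<le> (real P + 1) * (e / (2 * (real P + 1)))"
      using card_r \<open>e > 0\<close> by (intro mult_right_mono) auto
    also have "\<dots> = e / 2"
      by (simp add: field_simps)
    finally show ?thesis .
  qed
  have "2 * norm u - e \<le> norm (u - v)"
  proof -
    have "norm (restr G (u - v)) \<ge> norm v - norm (restr G u)"
      using norm_triangle_ineq3[of "restr G u" v] by (simp add: restr_diff restr_v)
    moreover have "norm (restr (- G) (u - v)) = norm u - norm (restr G u)"
      using norm_restr_Compl[OF G_meas(1), of u] by (simp add: restr_diff restr_v')
    ultimately show ?thesis
      using norm_restr_Compl[OF G_meas(1), of "u - v"] small v_ge by linarith
  qed
  moreover have "\<bar>\<phi> v - \<phi> u\<bar> \<le> e * norm u" if "\<phi> \<in> F" for \<phi>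
  proof -
    have lin: "linear \<phi>"
      using F(2)[OF that] by (rule bounded_linear.linear)
    have close: "\<bar>\<phi> (g (r s)) - \<phi> (g s)\<bar> \<le> e" if "s \<in> S" for s
    proof -
      have "cell (r s) \<phi> = cell s \<phi>"
        using r[OF that] by simp
      then have "\<lfloor>\<phi> (g (r s)) / e\<rfloor> = \<lfloor>\<phi> (g s) / e\<rfloor>"
        using \<open>\<phi> \<in> F\<close> by (simp add: cell_def)
      then have "\<bar>\<phi> (g (r s)) / e - \<phi> (g s) / e\<bar> \<le> 1"
        by linarith
      then show ?thesis
        using \<open>e > 0\<close> by (simp add: field_simps flip: diff_divide_distrib)
    qed
    have "\<phi> v - \<phi> u = (\<Sum>s\<in>S. w s * (\<phi> (g (r s)) - \<phi> (g s)))"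
      unfolding v_def by (subst u_eq)
        (simp add: linear_sum[OF lin] linear_scale[OF lin] right_diff_distrib sum_subtractf)
    also have "\<bar>\<dots>\<bar> \<le> (\<Sum>s\<in>S. \<bar>w s * (\<phi> (g (r s)) - \<phi> (g s))\<bar>)"
      by (rule sum_abs)
    also have "\<dots> \<le> (\<Sum>s\<in>S. w s * e)"
      using close w_nonneg by (intro sum_mono) (simp add: abs_mult mult_left_mono)
    also have "\<dots> = e * norm u"
      by (simp add: norm_u sum_distrib_left mult.commute)
    finally show ?thesis .
  qed
  ultimately show ?thesis
    using v_le by blast
qed

text \<open>
  The defining sets are only a subbasis of the weak topology; finite intersections lead to
  finitely many functionals with a common tolerance.
\<close>

lemma weak_neighbourhood_basis:
  assumes "openin (subtopology (weak_topology Z) (unit_ball Z)) W" "z \<in> W"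
  shows "\<exists>F e. finite F \<and> F \<subseteq> dual_space Z \<and> e > 0 \<and>
    (\<forall>w\<in>unit_ball Z. (\<forall>\<phi>\<in>F. \<bar>\<phi> w - \<phi> z\<bar> < e) \<longrightarrow> w \<in> W)"
proof -
  obtain V where V: "generate_topology_on {{x \<in> Z. \<phi> x \<in> U} |\<phi> U. \<phi> \<in> dual_space Z \<and> open U} V"
    "W = V \<inter> unit_ball Z"
    using assms(1) unfolding openin_subtopology weak_topology_def openin_topology_generated_by_iff by blast
  have basis: "\<exists>F e. finite F \<and> F \<subseteq> dual_space Z \<and> e > 0 \<and>
    (\<forall>w\<in>Z. (\<forall>\<phi>\<in>F. \<bar>\<phi> w - \<phi> z\<bar> < e) \<longrightarrow> w \<in> V)" if "z \<in> V"
    using V(1) that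
  proof induction
    case (Int a b)
    then obtain F e G d where "finite F" "F \<subseteq> dual_space Z" "e > 0" "finite G" "G \<subseteq> dual_space Z" "d > 0"
      and F: "\<forall>w\<in>Z. (\<forall>\<phi>\<in>F. \<bar>\<phi> w - \<phi> z\<bar> < e) \<longrightarrow> w \<in> a"
      and G: "\<forall>w\<in>Z. (\<forall>\<phi>\<in>G. \<bar>\<phi> w - \<phi> z\<bar> < d) \<longrightarrow> w \<in> b"
      by blast
    then show ?case
      by (intro exI[of _ "F \<union> G"] exI[of _ "min e d"]) auto
  next
    case (UN K)
    then obtain k where "k \<in> K" "z \<in> k" by blast
    with UN.IH[OF this] show ?case by blast
  next
    case (Basis s)
    then obtain \<phi> U where s: "s = {x \<in> Z. \<phi> x \<in> U}" "\<phi> \<in> dual_space Z" "open U" by blast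
    with Basis obtain e where "e > 0" "\<forall>y. dist y (\<phi> z) < e \<longrightarrow> y \<in> U"
      unfolding open_dist by blast
    with s show ?case
      by (intro exI[of _ "{\<phi>}"] exI[of _ e]) (auto simp: dist_real_def)
  qed auto
  have "z \<in> V"
    using assms(2) V(2) by simp
  from basis[OF this] obtain F e where "finite F" "F \<subseteq> dual_space Z" "e > 0"
    and "\<forall>w\<in>Z. (\<forall>\<phi>\<in>F. \<bar>\<phi> w - \<phi> z\<bar> < e) \<longrightarrow> w \<in> V"
    by (elim exE conjE) (rule that)
  then show ?thesis
    unfolding V(2) unit_ball_def by (intro exI[of _ F] exI[of _ e]) simp
qed

text \<open>
  Slices are relatively weakly open.
\<close>

lemma super_Delta_point_imp_Delta_point:
  assumes "super_Delta_point Z z"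
  shows "Delta_point Z z"
  unfolding Delta_point_def
proof (intro conjI allI impI)
  show "z \<in> unit_sphere Z"
    using assms by (simp add: super_Delta_point_def)
  fix S assume S: "is_slice Z S \<and> z \<in> S"
  then obtain \<phi> \<alpha> where \<phi>: "\<phi> \<in> dual_space Z" "S = slice Z \<phi> \<alpha>"
    by (auto simp: is_slice_def)
  define c where "c = (SUP x\<in>unit_ball Z. \<phi> x) - \<alpha>"
  have "S = {x \<in> Z. \<phi> x \<in> {c<..}} \<inter> unit_ball Z"
    by (auto simp: \<phi> slice_def c_def unit_ball_def)
  moreover have "openin (weak_topology Z) {x \<in> Z. \<phi> x \<in> {c<..}}"
    unfolding weak_topology_def openin_topology_generated_by_iff
    using \<phi>(1) open_greaterThan by (intro generate_topology_on.Basis) blast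
  ultimately have "openin (subtopology (weak_topology Z) (unit_ball Z)) S"
    unfolding openin_subtopology by blast
  then show "(SUP w\<in>S. norm (z - w)) = 2"
    using assms S by (simp add: super_Delta_point_def)
qed

section \<open>Functionals on a subspace\<close>

lemma dual_space_restrict:
  assumes "bounded_linear g" "subspace Z"
  shows "(\<lambda>x. if x \<in> Z then g x else 0) \<in> dual_space Z"
proof -
  obtain K where "\<And>x. norm (g x) \<le> norm x * K"
    using bounded_linear.bounded[OF assms(1)] by blast
  then have "\<forall>x\<in>Z. \<bar>if x \<in> Z then g x else 0\<bar> \<le> K * norm x"
    by (simp add: mult.commute)
  then show ?thesis
    using bounded_linear.linear[OF assms(1)] assms(2)
    by (auto simp: dual_space_def subspace_add subspace_scale linear_add linear_scale)
qed

lemma dual_space_bounded: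
  assumes "\<phi> \<in> dual_space Z"
  obtains K where "K \<ge> 0" "\<And>x. x \<in> Z \<Longrightarrow> \<bar>\<phi> x\<bar> \<le> K * norm x"
proof -
  obtain K where K: "\<forall>x\<in>Z. \<bar>\<phi> x\<bar> \<le> K * norm x"
    using assms by (auto simp: dual_space_def)
  show thesis
  proof (rule that)
    fix x assume "x \<in> Z"
    then have "\<bar>\<phi> x\<bar> \<le> K * norm x"
      using K by blast
    also have "\<dots> \<le> \<bar>K\<bar> * norm x"
      by (intro mult_right_mono) auto
    finally show "\<bar>\<phi> x\<bar> \<le> \<bar>K\<bar> * norm x" .
  qed simp
qed

lemma abs_le_dual_norm:
  assumes "\<phi> \<in> dual_space Z" "x \<in> unit_ball Z"
  shows "\<bar>\<phi> x\<bar> \<le> dual_norm Z \<phi>"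
proof -
  obtain K where K: "K \<ge> 0" "\<And>x. x \<in> Z \<Longrightarrow> \<bar>\<phi> x\<bar> \<le> K * norm x"
    using dual_space_bounded[OF assms(1)] by blast
  have "\<bar>\<phi> x\<bar> \<le> K" if "x \<in> unit_ball Z" for x
  proof -
    have "\<bar>\<phi> x\<bar> \<le> K * norm x"
      using that K by (simp add: unit_ball_def)
    also have "\<dots> \<le> K * 1"
      using that K(1) by (intro mult_left_mono) (auto simp: unit_ball_def)
    finally show ?thesis by simp
  qed
  then have "bdd_above ((\<lambda>x. \<bar>\<phi> x\<bar>) ` unit_ball Z)"
    by (intro bdd_aboveI2)
  then show ?thesis
    unfolding dual_norm_def using assms(2) by (intro cSUP_upper)
qed

lemma dual_space_diff:
  assumes "\<phi> \<in> dual_space Z" "subspace Z" "x \<in> Z" "y \<in> Z"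
  shows "\<phi> (x - y) = \<phi> x - \<phi> y"
proof -
  have "x - y \<in> Z"
    using assms subspace_diff by blast
  then have "\<phi> (x - y + y) = \<phi> (x - y) + \<phi> y"
    using assms unfolding dual_space_def by blast
  then show ?thesis by simp
qed

lemma bounded_linear_dual_spread:
  assumes "\<phi> \<in> dual_space Z" "range spread \<subseteq> Z"
  shows "bounded_linear (\<lambda>u. \<phi> (spread u))"
proof -
  obtain K where "\<And>x. x \<in> Z \<Longrightarrow> \<bar>\<phi> x\<bar> \<le> K * norm x"
    using dual_space_bounded[OF assms(1)] by blast
  then have "\<bar>\<phi> (spread u)\<bar> \<le> norm u * K" for u
    using assms(2) norm_spread[of u] by (metis mult.commute rangeI subsetD)
  moreover have "\<phi> (spread u + spread v) = \<phi> (spread u) + \<phi> (spread v)"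
    "\<phi> (c *\<^sub>R spread u) = c * \<phi> (spread u)" for u v c
    using assms unfolding dual_space_def by blast+
  ultimately show ?thesis
    by (intro bounded_linear_intro[of _ K]) (auto simp: spread_add spread_scaleR)
qed

section \<open>Points of $S_Y$ are super $\<Delta>$-points\<close>

text \<open>
  The approximating point is found inside \<open>Y\<close>, to which the functionals are pulled back along the
  isometry \<open>spread\<close>.  So the ambient space matters only through the functionals it provides.
\<close>

lemma super_Delta_point_Y:
  assumes Z: "Y_space \<subseteq> Z" and y: "y \<in> unit_sphere Y_space"
  shows "super_Delta_point Z y"
  unfolding super_Delta_point_def
proof (intro conjI allI impI)
  show y_sphere: "y \<in> unit_sphere Z"
    using assms by (auto simp: unit_sphere_def)
  obtain u where u: "y = spread u" "norm u = 1"
    using y by (auto simp: unit_sphere_def Y_eq_range_spread norm_spread)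
  fix W assume W: "openin (subtopology (weak_topology Z) (unit_ball Z)) W \<and> y \<in> W"
  then have W_ball: "W \<subseteq> unit_ball Z"
    unfolding openin_subtopology by auto
  have le2: "norm (y - w) \<le> 2" if "w \<in> W" for w
    using that W_ball norm_triangle_ineq4[of y w] y_sphere by (auto simp: unit_ball_def unit_sphere_def)
  obtain F e where F: "finite F" "F \<subseteq> dual_space Z" "e > 0"
    and near: "\<forall>w\<in>unit_ball Z. (\<forall>\<phi>\<in>F. \<bar>\<phi> w - \<phi> y\<bar> < e) \<longrightarrow> w \<in> W"
    using weak_neighbourhood_basis[of Z W y] W by (elim conjE exE) auto
  have far: "\<exists>w\<in>W. 2 - d \<le> norm (y - w)" if "d > 0" for d
  proof -
    define d' where "d' = min (e / 2) d"
    have d': "d' > 0" "d' < e" "d' \<le> d"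
      using F(3) that by (auto simp: d'_def)
    have "range spread \<subseteq> Z"
      using Z by (simp add: Y_eq_range_spread)
    then have bl: "bounded_linear \<psi>" if "\<psi> \<in> (\<lambda>\<phi> u. \<phi> (spread u)) ` F" for \<psi>
      using that F(2) bounded_linear_dual_spread by auto
    from weak_approximation_at_distance_2[OF finite_imageI[OF F(1)] this d'(1), of "\<lambda>\<phi> u. \<phi> (spread u)" u]
    obtain v where v: "norm v \<le> 1" "\<forall>\<phi>\<in>F. \<bar>\<phi> (spread v) - \<phi> (spread u)\<bar> \<le> d'" "2 - d' \<le> norm (u - v)"
      using u(2) by auto
    have "spread v \<in> unit_ball Z"
      using v(1) \<open>range spread \<subseteq> Z\<close> by (auto simp: unit_ball_def norm_spread)
    then have "spread v \<in> W"
      using near v(2) d'(2) u(1) by force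
    moreover have "norm (y - spread v) = norm (u - v)"
      unfolding u(1) linear_diff[OF linear_spread, symmetric] norm_spread ..
    ultimately show ?thesis
      using v(3) d'(3) by (intro bexI[of _ "spread v"]) auto
  qed
  have bdd: "bdd_above ((\<lambda>w. norm (y - w)) ` W)"
    using le2 by (intro bdd_aboveI2)
  show "(SUP w\<in>W. norm (y - w)) = 2"
  proof (rule antisym)
    show "(SUP w\<in>W. norm (y - w)) \<le> 2"
      using W le2 by (intro cSUP_least) auto
    show "2 \<le> (SUP w\<in>W. norm (y - w))"
    proof (rule field_le_epsilon)
      fix d :: real assume "d > 0"
      then obtain w where "w \<in> W" "2 - d \<le> norm (y - w)"
        using far by blast
      moreover have "norm (y - w) \<le> (SUP w\<in>W. norm (y - w))"
        using \<open>w \<in> W\<close> by (rule cSUP_upper[OF _ bdd])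
      ultimately show "2 \<le> (SUP w\<in>W. norm (y - w)) + d"
        by linarith
    qed
  qed
qed

section \<open>The generators are strongly exposed\<close>

lemma restr_supp_f_L1: "t \<noteq> [] \<Longrightarrow> restr (supp t) (f_L1 t) = f_L1 t"
  by (simp add: f_L1_eq_supp restr_scaleR restr_ind)

text \<open>
  If the functional that integrates over the support of \<open>f_L1 t\<close> is almost \<open>\<plusminus> 1\<close> at \<open>x\<close>, then \<open>x\<close> has
  little mass elsewhere and so is close to a multiple of \<open>f_L1 t\<close>; the functional itself determines
  the factor.  The real \<open>s\<close> is the sign.
\<close>

lemma f_L1_strongly_exposed:
  assumes x: "x \<in> X_space" "norm x \<le> 1" and t: "t \<noteq> []" and s: "\<bar>s\<bar> = 1"
    and d: "s * integ (restr (supp t) x) > 1 - d"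
  shows "norm (x - s *\<^sub>R f_L1 t) \<le> (2 * (3 * 2 ^ length t + 1) + 1) * d"
proof -
  define K :: real where "K = 3 * 2 ^ length t + 1"
  define a where "a = f_coord t x"
  define I where "I = integ (restr (supp t) x)"
  have s_cases: "s = 1 \<or> s = - 1"
    using s by linarith
  have "\<bar>I\<bar> \<le> norm (restr (supp t) x)"
    unfolding I_def by (rule abs_integ_le)
  moreover have "norm (restr (supp t) x) + norm (restr (- supp t) x) \<le> 1"
    using norm_restr_Compl[OF supp_measurable[of t], of x] x(2) by simp
  ultimately have sum: "\<bar>I\<bar> + norm (restr (- supp t) x) \<le> 1"
    by linarith
  then have "\<bar>I\<bar> \<le> 1"
    using norm_ge_zero[of "restr (- supp t) x"] by linarith
  with sum have R: "norm (restr (- supp t) x) \<le> d" and I: "\<bar>I - s\<bar> \<le> d"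
    using d s_cases unfolding I_def[symmetric] by (auto simp: abs_le_iff)
  have "norm (x - a *\<^sub>R f_L1 t) \<le> K * norm (restr (- supp t) x)"
    unfolding a_def K_def by (rule X_norm_diff_f_L1_le[OF x(1) t])
  also have "\<dots> \<le> K * d"
    using R by (intro mult_left_mono) (auto simp: K_def)
  finally have 1: "norm (x - a *\<^sub>R f_L1 t) \<le> K * d" .
  have "integ (restr (supp t) (x - a *\<^sub>R f_L1 t)) = I - a"
    using t bounded_linear.linear[OF bounded_linear_integ]
    by (simp add: restr_diff restr_scaleR restr_supp_f_L1 linear_diff integ_scaleR integ_f_L1 I_def)
  then have "\<bar>I - a\<bar> \<le> K * d"
    using abs_integ_le[of "restr (supp t) (x - a *\<^sub>R f_L1 t)"] norm_restr_le[of "supp t" "x - a *\<^sub>R f_L1 t"] 1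
    by simp
  with I have 2: "\<bar>a - s\<bar> \<le> K * d + d"
    by linarith
  have "norm (a *\<^sub>R f_L1 t - s *\<^sub>R f_L1 t) = \<bar>a - s\<bar>"
    using t by (simp add: norm_f_L1 flip: scaleR_diff_left)
  then have "norm (x - s *\<^sub>R f_L1 t) \<le> K * d + (K * d + d)"
    using norm_triangle_ineq[of "x - a *\<^sub>R f_L1 t" "a *\<^sub>R f_L1 t - s *\<^sub>R f_L1 t"] 1 2 by simp
  also have "\<dots> = (2 * K + 1) * d"
    by (simp add: algebra_simps)
  finally show ?thesis
    by (simp add: K_def)
qed

lemma f_L1_denting:
  assumes t: "t \<noteq> []" and s: "\<bar>s\<bar> = 1" and "r > 0"
  shows "\<exists>V. is_slice X_space V \<and> s *\<^sub>R f_L1 t \<in> V \<and> V \<subseteq> X_space \<inter> cball (s *\<^sub>R f_L1 t) r"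
proof -
  \<comment> \<open>The constant of \<open>f_L1_strongly_exposed\<close>, so that depth \<open>r / K\<close> gives radius \<open>r\<close>.\<close>
  define K :: real where "K = 2 * (3 * 2 ^ length t + 1) + 1"
  have "K > 0"
    by (simp add: K_def add_pos_pos)
  define \<psi> where "\<psi> x = (if x \<in> X_space then s * integ (restr (supp t) x) else 0)" for x
  define V where "V = slice X_space \<psi> (r / K)"
  have \<psi>: "\<psi> \<in> dual_space X_space"
    unfolding \<psi>_def by (intro dual_space_restrict subspace_X bounded_linear_const_mult
      bounded_linear_compose[OF bounded_linear_integ bounded_linear_restr])
  have ss: "s * s = 1"
    using s by (metis abs_mult_self_eq mult_1)
  have mem: "s *\<^sub>R f_L1 t \<in> unit_ball X_space"
    using t s by (simp add: unit_ball_def norm_f_L1 f_in_X subspace_scale[OF subspace_X])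
  then have val: "\<psi> (s *\<^sub>R f_L1 t) = 1"
    using t ss by (simp add: \<psi>_def unit_ball_def restr_scaleR restr_supp_f_L1 integ_scaleR integ_f_L1)
  have "\<psi> x \<le> 1" if "x \<in> unit_ball X_space" for x
  proof -
    have "\<psi> x \<le> \<bar>integ (restr (supp t) x)\<bar>"
      using s that by (auto simp: \<psi>_def unit_ball_def abs_mult intro: order_trans[OF abs_ge_self])
    also have "\<dots> \<le> norm x"
      using abs_integ_le norm_restr_le by (rule order_trans)
    finally show ?thesis
      using that by (simp add: unit_ball_def)
  qed
  then have sup: "(SUP x\<in>unit_ball X_space. \<psi> x) = 1"
    using mem val by (intro cSup_eq_maximum) (auto intro: rev_image_eqI)
  have "is_slice X_space V"
    unfolding is_slice_def V_def using \<psi> \<open>r > 0\<close> \<open>K > 0\<close> by (intro bexI[of _ \<psi>] exI[of _ "r / K"]) auto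
  moreover have "s *\<^sub>R f_L1 t \<in> V"
    using mem val \<open>r > 0\<close> \<open>K > 0\<close> by (simp add: V_def slice_def sup)
  moreover have "w \<in> X_space \<inter> cball (s *\<^sub>R f_L1 t) r" if "w \<in> V" for w
  proof -
    have w: "w \<in> X_space" "norm w \<le> 1" "s * integ (restr (supp t) w) > 1 - r / K"
    proof -
      have "w \<in> unit_ball X_space" "1 - r / K < \<psi> w"
        using that by (simp_all add: V_def slice_def sup)
      then show "w \<in> X_space" "norm w \<le> 1" "s * integ (restr (supp t) w) > 1 - r / K"
        by (simp_all add: unit_ball_def \<psi>_def)
    qed
    have "norm (w - s *\<^sub>R f_L1 t) \<le> K * (r / K)"
      unfolding K_def using f_L1_strongly_exposed[OF w(1,2) t s w(3)] by (simp add: K_def)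
    then show ?thesis
      using w(1) \<open>K > 0\<close> by (simp add: dist_norm norm_minus_commute)
  qed
  ultimately show ?thesis by blast
qed

lemma not_DLD2P_X: "\<not> DLD2P X_space"
proof
  assume "DLD2P X_space"
  define z where "z = f_L1 [True]"
  have "z \<in> unit_sphere X_space"
    by (simp add: z_def unit_sphere_def f_in_X norm_f_L1)
  with \<open>DLD2P X_space\<close> have "Delta_point X_space z"
    by (simp add: DLD2P_def)
  obtain V where V: "is_slice X_space V" "z \<in> V" "V \<subseteq> X_space \<inter> cball z 1"
    using f_L1_denting[of "[True]" 1 1] by (auto simp: z_def)
  have "(SUP w\<in>V. norm (z - w)) \<le> 1"
    using V by (intro cSUP_least) (auto simp: dist_norm)
  moreover have "(SUP w\<in>V. norm (z - w)) = 2"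
    using \<open>Delta_point X_space z\<close> V by (simp add: Delta_point_def)
  ultimately show False by simp
qed

section \<open>Failure of the relative Daugavet property\<close>

text \<open>
  Equality in the triangle inequality forces \<open>v\<close> to be nonpositive almost everywhere on \<open>B\<close>.
\<close>

lemma norm_diff_ind_eq_imp:
  assumes "B \<in> sets lebesgue" "c > 0" and eq: "norm (v - c *\<^sub>R ind B) = norm v + norm (c *\<^sub>R ind B)"
  shows "integ (restr B v) \<le> 0"
proof -
  obtain f where f: "integrable leb01 f" "v = abs_L1 f"
    by (metis L1_cases)
  define g where "g x = c * indicator B x" for x
  have g: "integrable leb01 g" "c *\<^sub>R ind B = abs_L1 g"
    using assms(1) integrable_indicator_leb01[OF assms(1)]
    by (simp_all add: g_def[abs_def] ind_eq_abs_L1 abs_L1_scaleR)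
  have g_nonneg: "g x \<ge> 0" for x
    using assms(2) by (simp add: g_def)
  have i: "integrable leb01 (\<lambda>x. \<bar>f x\<bar>)" "integrable leb01 (\<lambda>x. \<bar>g x\<bar>)" "integrable leb01 (\<lambda>x. \<bar>f x - g x\<bar>)"
    using f(1) g(1) by (auto intro: integrable_abs)
  have "(LINT x|leb01. \<bar>f x\<bar> + \<bar>g x\<bar> - \<bar>f x - g x\<bar>) = 0"
    using eq i f g by (simp add: f(2) g(2) abs_L1_minus norm_abs_L1)
  then have "AE x in leb01. \<bar>f x\<bar> + \<bar>g x\<bar> - \<bar>f x - g x\<bar> = 0"
    by (subst (asm) integral_nonneg_eq_0_iff_AE) (use i in auto)
  then have "AE x in leb01. indicator B x * f x \<le> 0"
  proof eventually_elim
    case (elim x)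
    show ?case
    proof (cases "x \<in> B")
      case True
      then have "g x > 0"
        using assms(2) by (simp add: g_def)
      with elim have "f x \<le> 0" by linarith
      with True show ?thesis by simp
    qed simp
  qed
  then have "(LINT x|leb01. indicator B x * f x) \<le> (LINT x|leb01. 0)"
    by (intro integral_mono_AE integrable_indicator_mult assms f) auto
  then show ?thesis
    using assms(1) f integrable_indicator_mult[OF assms(1) f(1)] by (simp add: restr_abs_L1 integ_abs_L1)
qed

text \<open>
  Block 1 carries half of the norm of both functions, and \<open>f_L1 t\<close> agrees there with the image of
  \<open>atom t\<close>.  A common sign on that block already makes the distance smaller than 2.
\<close>

lemma norm_spread_diff_f_L1_less_2:
  assumes u: "norm u = 1" and t: "t \<noteq> []" and s: "\<bar>s\<bar> = 1" and pos: "s * integ (restr (D_ivl t) u) > 0"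
  shows "norm (spread u - s *\<^sub>R f_L1 t) < 2"
proof -
  have ss: "s * s = 1"
    using s by (metis abs_mult_self_eq mult_1)
  have "norm (u - s *\<^sub>R atom t) < 2"
  proof (rule ccontr)
    assume "\<not> norm (u - s *\<^sub>R atom t) < 2"
    moreover have "norm (u - s *\<^sub>R atom t) = norm (s *\<^sub>R u - atom t)"
    proof -
      have "s *\<^sub>R u - atom t = s *\<^sub>R (u - s *\<^sub>R atom t)"
        by (simp add: scaleR_diff_right ss)
      then show ?thesis
        using s by simp
    qed
    ultimately have "norm (s *\<^sub>R u - atom t) = norm (s *\<^sub>R u) + norm (atom t)"
      using norm_triangle_ineq4[of "s *\<^sub>R u" "atom t"] u s by (simp add: norm_atom)
    then have "integ (restr (D_ivl t) (s *\<^sub>R u)) \<le> 0"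
      unfolding atom_def by (intro norm_diff_ind_eq_imp[of _ "2 ^ length t"]) auto
    with pos show False
      by (simp add: restr_scaleR integ_scaleR)
  qed
  moreover have pull: "pull 1 (spread u) = u" "pull 1 (f_L1 t) = atom t"
    using pull_spread[of 0 u] t by (simp_all add: pull_f_L1 Suc_le_eq)
  then have "norm (restr (blk 1) (spread u - s *\<^sub>R f_L1 t)) = norm (u - s *\<^sub>R atom t) / 2"
    using norm_pull[of 1 "spread u - s *\<^sub>R f_L1 t"]
    by (simp add: linear_diff[OF linear_pull] linear_scale[OF linear_pull])
  moreover have "norm (restr (- blk 1) (spread u - s *\<^sub>R f_L1 t)) \<le> 1"
  proof -
    have "norm (restr (- blk 1) (spread u)) = 1 / 2"
      using norm_restr_Compl[of "blk 1" "spread u"] norm_pull[of 1 "spread u"] pull u by (simp add: norm_spread)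
    moreover have "norm (restr (- blk 1) (f_L1 t)) = 1 / 2"
      using norm_restr_Compl[of "blk 1" "f_L1 t"] norm_pull[of 1 "f_L1 t"] pull t by (simp add: norm_f_L1 norm_atom)
    ultimately show ?thesis
      using norm_triangle_ineq4[of "restr (- blk 1) (spread u)" "restr (- blk 1) (s *\<^sub>R f_L1 t)"] s
      by (simp add: restr_diff restr_scaleR)
  qed
  ultimately show ?thesis
    using norm_restr_Compl[of "blk 1" "spread u - s *\<^sub>R f_L1 t"] by simp
qed

text \<open>
  The dyadic average of \<open>u\<close> is a combination of atoms with absolute coefficient sum at most 1,
  and \<open>g\<close> is almost 1 on it, so \<open>g\<close> is almost \<open>\<plusminus> 1\<close> on one of the atoms, with the sign of its coefficient.
\<close>

lemma exists_atom_almost_norming: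
  assumes g: "bounded_linear g" "\<And>v. \<bar>g v\<bar> \<le> norm v" and u: "norm u \<le> 1" "g u = 1" and "e > 0" "e \<le> 1"
  shows "\<forall>\<^sub>F n in sequentially. \<exists>t\<in>level n. integ (restr (D_ivl t) u) \<noteq> 0 \<and>
    sgn (integ (restr (D_ivl t) u)) * g (atom t) > 1 - e"
proof -
  have lin: "linear g"
    using g(1) by (rule bounded_linear.linear)
  have "(\<lambda>n. g (dyadic_avg n u)) \<longlonglongrightarrow> g u"
    by (rule bounded_linear.tendsto[OF g(1) dyadic_avg_tendsto])
  then have "\<forall>\<^sub>F n in sequentially. 1 - e < g (dyadic_avg n u)"
    using u(2) \<open>e > 0\<close> by (intro order_tendstoD) auto
  then show ?thesis
  proof eventually_elim
    case (elim n)
    define c where "c t = integ (restr (D_ivl t) u)" for t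
    show ?case
    proof (rule ccontr)
      assume "\<not> ?case"
      then have no: "sgn (c t) * g (atom t) \<le> 1 - e" if "t \<in> level n" "c t \<noteq> 0" for t
        using that by (auto simp: c_def not_less)
      have "c t * g (atom t) \<le> \<bar>c t\<bar> * (1 - e)" if "t \<in> level n" for t
      proof (cases "c t = 0")
        case False
        have "c t * g (atom t) = \<bar>c t\<bar> * (sgn (c t) * g (atom t))"
          by (simp only: abs_mult_sgn mult.assoc[symmetric])
        also have "\<dots> \<le> \<bar>c t\<bar> * (1 - e)"
          using no[OF that False] by (intro mult_left_mono) auto
        finally show ?thesis .
      qed simp
      then have "(\<Sum>t\<in>level n. c t * g (atom t)) \<le> (\<Sum>t\<in>level n. \<bar>c t\<bar>) * (1 - e)"
        unfolding sum_distrib_right by (rule sum_mono)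
      also have "\<dots> \<le> 1 * (1 - e)"
        using sum_abs_integ_le[of u n] u(1) \<open>e \<le> 1\<close> by (intro mult_right_mono) (auto simp: c_def)
      finally have "g (dyadic_avg n u) \<le> 1 - e"
        by (simp add: dyadic_avg_def c_def linear_sum[OF lin] linear_scale[OF lin])
      with elim show False by simp
    qed
  qed
qed

text \<open>
  The slice \<open>S\<close> contains some \<open>\<plusminus> f_L1 t\<close> at distance less than 2 from \<open>y\<close>, together with a small slice
  around it.
\<close>

lemma not_relative_Daugavet_point:
  assumes y: "y \<in> unit_sphere Y_space"
  shows "\<not> relative_Daugavet_point X_space y"
proof
  assume "relative_Daugavet_point X_space y"
  then obtain S where S: "Daugavet_point_relative X_space y S"
    by (auto simp: relative_Daugavet_point_def)
  then obtain \<phi> \<alpha> where \<phi>: "\<phi> \<in> dual_space X_space" "dual_norm X_space \<phi> = 1" "\<phi> y = 1"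
    and \<alpha>: "\<alpha> > 0" "S = slice X_space \<phi> \<alpha>"
    by (auto simp: Daugavet_point_relative_def is_supporting_slice_def supporting_functionals_def)
  obtain u where u: "y = spread u" "norm u = 1"
    using y by (auto simp: unit_sphere_def Y_eq_range_spread norm_spread)
  have range: "range spread \<subseteq> X_space"
    using Y_subset_X by (simp add: Y_eq_range_spread)
  have le1: "\<bar>\<phi> x\<bar> \<le> norm x" if "x \<in> X_space" for x
  proof (cases "x = 0")
    case False
    have "sgn x \<in> unit_ball X_space"
      using that False by (simp add: unit_ball_def norm_sgn sgn_div_norm subspace_scale[OF subspace_X])
    then have "\<bar>\<phi> (sgn x)\<bar> \<le> 1"
      using abs_le_dual_norm[OF \<phi>(1)] \<phi>(2) by fastforce
    moreover have "\<phi> (sgn x) = inverse (norm x) * \<phi> x"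
      using \<phi>(1) that by (simp add: sgn_div_norm dual_space_def)
    ultimately show ?thesis
      using False by (simp add: abs_mult field_simps)
  next
    case True
    have "\<phi> (0 *\<^sub>R x) = 0 * \<phi> x"
      using \<phi>(1) that unfolding dual_space_def by blast
    then show ?thesis
      using True by simp
  qed
  \<comment> \<open>Three errors of size at most \<open>e\<close> must stay below \<open>\<alpha>\<close>: the choice of \<open>t\<close>, passing from \<open>h_L1 t\<close> to \<open>f_L1 t\<close>, and the size of \<open>V\<close>.\<close>
  define e where "e = min \<alpha> 1 / 4"
  have e: "e > 0" "e \<le> 1" "4 * e \<le> \<alpha>"
    using \<alpha>(1) by (auto simp: e_def)
  have "\<bar>\<phi> (spread v)\<bar> \<le> norm v" for v
    using le1[of "spread v"] range norm_spread[of v] by auto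
  then have "\<forall>\<^sub>F n in sequentially. \<exists>t\<in>level n. integ (restr (D_ivl t) u) \<noteq> 0 \<and>
      sgn (integ (restr (D_ivl t) u)) * \<phi> (spread (atom t)) > 1 - e"
    using u \<phi>(3) e by (intro exists_atom_almost_norming bounded_linear_dual_spread[OF \<phi>(1) range]) auto
  moreover have "\<forall>\<^sub>F n in sequentially. 2 * (1 / 2) ^ n < e"
    using half_power_tendsto e(1) by (rule order_tendstoD)
  ultimately have "\<forall>\<^sub>F n in sequentially. n \<ge> 1 \<and> 2 * (1 / 2) ^ n < e \<and>
      (\<exists>t\<in>level n. integ (restr (D_ivl t) u) \<noteq> 0 \<and>
        sgn (integ (restr (D_ivl t) u)) * \<phi> (spread (atom t)) > 1 - e)"
    using eventually_ge_at_top[of 1] by eventually_elim simp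
  then obtain n t where n: "n \<ge> 1" "2 * (1 / 2) ^ n < e" and tn: "t \<in> level n"
    and c: "integ (restr (D_ivl t) u) \<noteq> 0"
    and norming: "sgn (integ (restr (D_ivl t) u)) * \<phi> (spread (atom t)) > 1 - e"
    using eventually_happens[of _ sequentially] sequentially_bot by blast
  define s where "s = sgn (integ (restr (D_ivl t) u))"
  have s: "\<bar>s\<bar> = 1" "s * integ (restr (D_ivl t) u) > 0"
    using c by (auto simp: s_def sgn_if)
  have t: "t \<noteq> []" "length t = n"
    using tn n(1) by (auto simp: level_def)
  have sf: "s *\<^sub>R f_L1 t \<in> X_space" and fX: "f_L1 t \<in> X_space" and hX: "h_L1 t \<in> X_space"
    using t by (auto intro: f_in_X h_in_X subspace_scale[OF subspace_X])
  \<comment> \<open>Small enough for \<open>V\<close> to stay inside \<open>S\<close> and within distance less than 2 of \<open>y\<close>.\<close>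
  define r where "r = min e ((2 - norm (y - s *\<^sub>R f_L1 t)) / 2)"
  have "r > 0"
    using norm_spread_diff_f_L1_less_2[OF u(2) t(1) s] e(1) by (simp add: r_def u(1))
  then obtain V where V: "is_slice X_space V" "s *\<^sub>R f_L1 t \<in> V" "V \<subseteq> X_space \<inter> cball (s *\<^sub>R f_L1 t) r"
    using f_L1_denting[OF t(1) s(1)] by blast
  have \<phi>sf: "\<phi> (s *\<^sub>R f_L1 t) > 1 - 2 * e"
  proof -
    have "\<phi> (s *\<^sub>R f_L1 t) = s * \<phi> (h_L1 t) + s * \<phi> (f_L1 t - h_L1 t)"
      using \<phi>(1) fX hX by (simp add: dual_space_diff[OF \<phi>(1) subspace_X] algebra_simps) (simp add: dual_space_def)
    moreover have "s * \<phi> (h_L1 t) > 1 - e"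
      using norming by (simp add: s_def spread_atom)
    moreover have "\<bar>s * \<phi> (f_L1 t - h_L1 t)\<bar> \<le> 2 * (1 / 2) ^ n"
      using le1[OF subspace_diff[OF subspace_X fX hX]] norm_f_L1_diff_h_L1[OF t(1)] s(1) t(2)
      by (simp add: abs_mult power_divide)
    ultimately show ?thesis
      using n(2) by linarith
  qed
  have "V \<subseteq> S"
  proof
    fix w assume "w \<in> V"
    then have w: "w \<in> X_space" "norm (w - s *\<^sub>R f_L1 t) \<le> r" "w \<in> unit_ball X_space"
      using V by (auto simp: dist_norm norm_minus_commute is_slice_def slice_def)
    have "\<bar>\<phi> (w - s *\<^sub>R f_L1 t)\<bar> \<le> r"
      using le1[OF subspace_diff[OF subspace_X w(1) sf]] w(2) by linarith
    then have "\<bar>\<phi> w - \<phi> (s *\<^sub>R f_L1 t)\<bar> \<le> e"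
      unfolding dual_space_diff[OF \<phi>(1) subspace_X w(1) sf] by (simp add: r_def)
    then have "\<phi> w > 1 - \<alpha>"
      using \<phi>sf e by linarith
    moreover have "(SUP x\<in>unit_ball X_space. \<phi> x) \<le> 1"
    proof (rule cSUP_least)
      fix x assume "x \<in> unit_ball X_space"
      then show "\<phi> x \<le> 1"
        using le1[of x] by (auto simp: unit_ball_def)
    qed (use w in auto)
    ultimately show "w \<in> S"
      using w(3) by (simp add: \<alpha>(2) slice_def)
  qed
  then have "2 = (SUP w\<in>V. norm (y - w))"
    using S V(1) by (simp add: Daugavet_point_relative_def)
  also have "\<dots> \<le> norm (y - s *\<^sub>R f_L1 t) + r"
  proof (rule cSUP_least)
    fix w assume "w \<in> V"
    then have "norm (s *\<^sub>R f_L1 t - w) \<le> r"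
      using V(3) by (auto simp: dist_norm)
    then show "norm (y - w) \<le> norm (y - s *\<^sub>R f_L1 t) + r"
      using norm_triangle_ineq[of "y - s *\<^sub>R f_L1 t" "s *\<^sub>R f_L1 t - w"] by simp
  qed (use V in auto)
  finally have "2 \<le> norm (y - s *\<^sub>R f_L1 t) + r" .
  moreover have "r \<le> (2 - norm (y - s *\<^sub>R f_L1 t)) / 2"
    unfolding r_def by (rule min.cobounded2)
  moreover have "norm (y - s *\<^sub>R f_L1 t) < 2"
    using norm_spread_diff_f_L1_less_2[OF u(2) t(1) s] by (simp add: u(1))
  ultimately show False
    by (simp add: field_simps)
qed

section \<open>Non-reflexivity\<close>

lemma dual_space_add:
  assumes "\<phi> \<in> dual_space Z" "\<psi> \<in> dual_space Z"
  shows "(\<lambda>x. \<phi> x + \<psi> x) \<in> dual_space Z"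
proof -
  obtain K L where "\<And>x. x \<in> Z \<Longrightarrow> \<bar>\<phi> x\<bar> \<le> K * norm x" "\<And>x. x \<in> Z \<Longrightarrow> \<bar>\<psi> x\<bar> \<le> L * norm x"
    using dual_space_bounded[OF assms(1)] dual_space_bounded[OF assms(2)] by metis
  then have "\<exists>K. \<forall>x\<in>Z. \<bar>\<phi> x + \<psi> x\<bar> \<le> K * norm x"
    by (intro exI[of _ "K + L"]) (auto simp: distrib_right intro: order_trans[OF abs_triangle_ineq] add_mono)
  with assms show ?thesis
    unfolding dual_space_def by (simp add: algebra_simps)
qed

lemma dual_space_mult:
  assumes "\<phi> \<in> dual_space Z"
  shows "(\<lambda>x. c * \<phi> x) \<in> dual_space Z"
proof -
  obtain K where "\<And>x. x \<in> Z \<Longrightarrow> \<bar>\<phi> x\<bar> \<le> K * norm x"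
    using dual_space_bounded[OF assms] by metis
  then have "\<exists>K. \<forall>x\<in>Z. \<bar>c * \<phi> x\<bar> \<le> K * norm x"
    by (intro exI[of _ "\<bar>c\<bar> * K"]) (auto simp: abs_mult mult.assoc intro: mult_left_mono)
  with assms show ?thesis
    unfolding dual_space_def by (simp add: algebra_simps)
qed

text \<open>
  Weak-star compactness of the unit ball of the bidual, for the evaluations at a sequence: the dual norms confine
  them to a product of compact intervals.  Linearity and the norm bound are closed conditions on
  finitely many coordinates, so they pass to a cluster point.
\<close>

lemma bounded_sequence_bidual_cluster_point:
  fixes x :: "nat \<Rightarrow> 'a::real_normed_vector"
  assumes x: "\<And>n. x n \<in> unit_ball Z"
  obtains \<Lambda> where "bidual_functional Z \<Lambda>"
    "\<And>\<phi> c. \<phi> \<in> dual_space Z \<Longrightarrow> (\<forall>\<^sub>F n in sequentially. \<phi> (x n) = c) \<Longrightarrow> \<Lambda> \<phi> = c"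
proof -
  define E where "E n = (\<lambda>\<phi>. if \<phi> \<in> dual_space Z then \<phi> (x n) else 0)" for n
  define Q where "Q = PiE UNIV (\<lambda>\<phi>. {- \<bar>dual_norm Z \<phi>\<bar>..\<bar>dual_norm Z \<phi>\<bar>})"
  have "compactin (product_topology (\<lambda>_. euclidean) UNIV) Q"
    unfolding Q_def compactin_PiE by simp
  then have "compact Q"
    by (simp add: euclidean_product_topology)
  moreover have "E n \<in> Q" for n
    using abs_le_dual_norm[OF _ x[of n]] by (fastforce simp: Q_def E_def abs_le_iff)
  then have "\<forall>\<^sub>F \<Lambda> in filtermap E sequentially. \<Lambda> \<in> Q"
    by (simp add: eventually_filtermap)
  moreover have "filtermap E sequentially \<noteq> bot"
    by (simp add: filtermap_bot_iff)
  ultimately obtain \<Lambda> where \<Lambda>: "inf (nhds \<Lambda>) (filtermap E sequentially) \<noteq> bot"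
    unfolding compact_filter by blast
  have closed_mem: "\<Lambda> \<in> C" if "closed C" "\<forall>\<^sub>F n in sequentially. E n \<in> C" for C
  proof (rule ccontr)
    assume "\<Lambda> \<notin> C"
    then have "\<forall>\<^sub>F \<Lambda>' in nhds \<Lambda>. \<Lambda>' \<in> - C"
      using that(1) by (intro eventually_nhds_in_open) auto
    moreover have "\<forall>\<^sub>F \<Lambda>' in filtermap E sequentially. \<Lambda>' \<in> C"
      using that(2) by (simp add: eventually_filtermap)
    ultimately have "\<forall>\<^sub>F \<Lambda>' in inf (nhds \<Lambda>) (filtermap E sequentially). False"
      unfolding eventually_inf by blast
    with \<Lambda> show False
      by (simp add: eventually_False)
  qed
  have cont: "continuous_on UNIV (\<lambda>\<Lambda>. \<Lambda> \<phi> :: real)" for \<phi> :: "'a \<Rightarrow> real"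
    by simp
  have E_apply: "E n \<phi> = \<phi> (x n)" if "\<phi> \<in> dual_space Z" for n \<phi>
    using that by (simp add: E_def)
  have "bidual_functional Z \<Lambda>"
    unfolding bidual_functional_def
  proof (intro conjI ballI allI exI[of _ 1])
    fix \<phi> \<psi> assume *: "\<phi> \<in> dual_space Z" "\<psi> \<in> dual_space Z"
    have "\<Lambda> \<in> {\<Lambda>. \<Lambda> (\<lambda>x. \<phi> x + \<psi> x) = \<Lambda> \<phi> + \<Lambda> \<psi>}"
      using * by (intro closed_mem closed_Collect_eq continuous_on_add cont)
        (simp add: E_apply dual_space_add)
    then show "\<Lambda> (\<lambda>x. \<phi> x + \<psi> x) = \<Lambda> \<phi> + \<Lambda> \<psi>" by simp
  next
    fix \<phi> and c :: real assume *: "\<phi> \<in> dual_space Z"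
    have "\<Lambda> \<in> {\<Lambda>. \<Lambda> (\<lambda>x. c * \<phi> x) = c * \<Lambda> \<phi>}"
      using * by (intro closed_mem closed_Collect_eq continuous_on_mult continuous_on_const cont)
        (simp add: E_apply dual_space_mult)
    then show "\<Lambda> (\<lambda>x. c * \<phi> x) = c * \<Lambda> \<phi>" by simp
  next
    fix \<phi> assume *: "\<phi> \<in> dual_space Z"
    have "\<Lambda> \<in> {\<Lambda>. \<bar>\<Lambda> \<phi>\<bar> \<le> dual_norm Z \<phi>}"
      using * by (intro closed_mem closed_Collect_le continuous_on_rabs continuous_on_const cont)
        (simp add: E_apply abs_le_dual_norm x)
    then show "\<bar>\<Lambda> \<phi>\<bar> \<le> 1 * dual_norm Z \<phi>" by simp
  qed
  moreover have "\<Lambda> \<phi> = c" if "\<phi> \<in> dual_space Z" "\<forall>\<^sub>F n in sequentially. \<phi> (x n) = c" for \<phi> c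
  proof -
    have "\<Lambda> \<in> {\<Lambda>. \<Lambda> \<phi> = c}"
      using that by (intro closed_mem closed_Collect_eq continuous_on_const cont) (simp add: E_apply)
    then show ?thesis by simp
  qed
  ultimately show thesis
    using that by blast
qed

lemma D_ivl_append_subset: "D_ivl (s @ t) \<subseteq> D_ivl s"
proof (induction t rule: rev_induct)
  case (snoc b t)
  have "D_ivl ((s @ t) @ [b]) \<subseteq> D_ivl (s @ t)"
    using D_ivl_snoc(1)[of "s @ t"] by (cases b) auto
  with snoc show ?case by simp
qed simp

text \<open>
  The unit vectors \<open>h_L1 (z n)\<close>, read off on block 1, keep all their mass in \<open>D_ivl\<close> of every fixed initial segment
  of zeros.  A representing vector would inherit this for all these intervals, although they
  shrink to a point.
\<close>

lemma not_reflexive_X: "\<not> reflexive_space X_space"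
proof
  assume refl: "reflexive_space X_space"
  define z where "z n = replicate (Suc n) False" for n
  have "h_L1 (z n) \<in> unit_ball X_space" for n
    using h_in_X[of "z n"] norm_spread[of "atom (z n)"]
    by (simp add: unit_ball_def z_def spread_atom norm_atom)
  then obtain \<Lambda> where \<Lambda>: "bidual_functional X_space \<Lambda>"
    and eval: "\<And>\<phi> c. \<phi> \<in> dual_space X_space \<Longrightarrow> (\<forall>\<^sub>F n in sequentially. \<phi> (h_L1 (z n)) = c) \<Longrightarrow> \<Lambda> \<phi> = c"
    by (rule bounded_sequence_bidual_cluster_point[of "\<lambda>n. h_L1 (z n)" X_space]) blast
  from refl \<Lambda> obtain x where x: "x \<in> X_space" "\<forall>\<phi>\<in>dual_space X_space. \<Lambda> \<phi> = \<phi> x"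
    unfolding reflexive_space_def by blast
  have mass: "integ (restr (D_ivl (replicate m False)) (pull 1 x)) = 1" for m
  proof -
    define \<phi> where "\<phi> x = (if x \<in> X_space then integ (restr (D_ivl (replicate m False)) (pull 1 x)) else 0)" for x
    have "\<phi> \<in> dual_space X_space"
      unfolding \<phi>_def
      by (intro dual_space_restrict subspace_X bounded_linear_compose[OF bounded_linear_integ]
        bounded_linear_compose[OF bounded_linear_restr bounded_linear_pull])
    moreover have "\<phi> (h_L1 (z n)) = 1" if "n \<ge> m" for n
    proof -
      have "z n = replicate m False @ replicate (Suc n - m) False"
        using that by (simp add: z_def flip: replicate_add)
      then have "D_ivl (z n) \<subseteq> D_ivl (replicate m False)"
        by (metis D_ivl_append_subset)
      then have "restr (D_ivl (replicate m False)) (atom (z n)) = atom (z n)"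
        by (simp add: atom_def restr_scaleR restr_ind Int_absorb1)
      moreover have "pull 1 (h_L1 (z n)) = atom (z n)"
        using pull_spread[of 0 "atom (z n)"] by (simp add: spread_atom)
      moreover have "h_L1 (z n) \<in> X_space"
        by (rule h_in_X) (simp add: z_def)
      ultimately show ?thesis
        by (simp add: \<phi>_def integ_atom)
    qed
    then have "\<forall>\<^sub>F n in sequentially. \<phi> (h_L1 (z n)) = 1"
      unfolding eventually_sequentially by blast
    ultimately have "\<phi> x = 1"
      using eval x(2) by metis
    then show ?thesis
      using x(1) by (simp add: \<phi>_def)
  qed
  obtain m where "\<forall>t\<in>level m. norm (restr (D_ivl t) (pull 1 x)) < 1"
    using eventually_happens[OF restr_D_ivl_uniformly_small[of 1 "pull 1 x"]] by auto
  then have "norm (restr (D_ivl (replicate m False)) (pull 1 x)) < 1"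
    by (simp add: level_def)
  with mass[of m] abs_integ_le[of "restr (D_ivl (replicate m False)) (pull 1 x)"] show False
    by simp
qed

section \<open>$\<Delta>$-points and relative Daugavet points of $X$ in $S_Y$\<close>

theorem theorem4p16:
  shows "(closed X_space \<and> subspace X_space \<and>
          \<not> reflexive_space X_space \<and> \<not> DLD2P X_space \<and>
          closed Y_space \<and> subspace Y_space \<and> Y_space \<subseteq> X_space \<and>
          isometrically_isomorphic Y_space (UNIV :: L1 set)) \<and>
         (\<forall>y\<in>unit_sphere Y_space. Delta_point Y_space y \<and> Delta_point X_space y) \<and>
         (\<forall>y\<in>unit_sphere Y_space. \<not> relative_Daugavet_point X_space y) \<and>
         (\<forall>y\<in>unit_sphere Y_space. super_Delta_point X_space y)"
  by (intro conjI ballI closed_X subspace_X not_reflexive_X not_DLD2P_X closed_Y subspace_Y Y_subset_X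
      Y_isometric_L1 super_Delta_point_imp_Delta_point super_Delta_point_Y order_refl
      not_relative_Daugavet_point)

end
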